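(* Let $\delta_n$ be the diagonal coefficients (the coefficients of $x_1^n\cdots x_d^n$) of the power series expansion at the origin of $$F_{c,d}(x_1,\dots,x_d)=\frac{1}{1-e_1+c\,e_d},$$ where $c$ is a real parameter, and let $c_*=(d-1)^{d-1}$. Then when $c\neq c_*$, $$\delta_n=\sum_{x\in E}\left(\frac{x^{-dn}}{n^{(d-1)/2}}\cdot\left(\frac{2\pi(1-(d-1)x)}{x^{(d-1)/2}}\right)^{(d-1)/2}\cdot\frac{1}{d^{1/2}\,(1-(d-1)x)}\right)\left(1+O\!\left(\frac1n\right)\right),$$ where $E$ consists of the minimal modulus roots of the polynomial $1/F_{c,d}(x,\dots,x)=1-dx+cx^d$.
   Context: $d$ is the number of variables; $e_1=x_1+\cdots+x_d$ and $e_d=x_1x_2\cdots x_d$ are elementary symmetric polynomials in $x_1,\dots,x_d$.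
   Formalization: The printed factor (2π(1-(d-1)x)/x^{(d-1)/2})^{(d-1)/2} is false (d=2, c=0: δ_n = C(2n,n)) and is corrected to ((1-(d-1)x)/(2πx))^{(d-1)/2}, with principal powers; each x in E has its own factor 1+O(1/n). *)

theory Defs
  imports "HOL-Analysis.Analysis" "HOL-Library.Landau_Symbols"
    "HOL-Computational_Algebra.Polynomial"
begin

definition F_sym :: "real \<Rightarrow> complex ^ 'd \<Rightarrow> complex" where
  "F_sym c x = 1 / (1 - (\<Sum>i\<in>UNIV. x $ i) + of_real c * (\<Prod>i\<in>UNIV. x $ i))"

text \<open>
  Since the index type \<open>'d\<close> is finite, functions \<open>'d \<Rightarrow> nat\<close> are exactly the exponent vectors of
  monomials. The coefficients \<open>a\<close> are uniquely determined by \<open>f\<close>.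
\<close>

definition has_power_series_at_origin ::
    "(complex ^ 'd \<Rightarrow> complex) \<Rightarrow> (('d \<Rightarrow> nat) \<Rightarrow> complex) \<Rightarrow> bool" where
  "has_power_series_at_origin f a \<longleftrightarrow>
     (\<exists>r>0. \<forall>x. (\<forall>i. cmod (x $ i) < r) \<longrightarrow>
        ((\<lambda>\<alpha>. a \<alpha> * (\<Prod>i\<in>UNIV. (x $ i) ^ \<alpha> i)) has_sum f x) UNIV)"

definition diag_poly :: "nat \<Rightarrow> real \<Rightarrow> complex poly" where
  "diag_poly d c = 1 - monom (of_nat d) 1 + monom (of_real c) d"

lemma poly_diag_poly: "poly (diag_poly d c) x = 1 - of_nat d * x + of_real c * x ^ d"
  by (simp add: diag_poly_def poly_monom)

lemma F_sym_diagonal: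
  "F_sym c ((\<chi> i. x) :: complex ^ 'd) = 1 / poly (diag_poly CARD('d) c) x"
  by (simp add: F_sym_def poly_diag_poly)

definition min_modulus_roots :: "complex poly \<Rightarrow> complex set" where
  "min_modulus_roots p = {x. poly p x = 0 \<and> (\<forall>y. poly p y = 0 \<longrightarrow> cmod x \<le> cmod y)}"

text \<open>
  The contribution of a critical point \<open>(x, \<dots>, x)\<close> to the diagonal asymptotics. It is
  \<open>x\<^sup>-\<^sup>d\<^sup>n (2 \<pi> n)\<^sup>-\<^sup>(\<^sup>d\<^sup>-\<^sup>1\<^sup>)\<^sup>/\<^sup>2 det(M)\<^sup>-\<^sup>1\<^sup>/\<^sup>2 / (1 - (d - 1) x)\<close>, where \<open>1 - (d - 1) x\<close> is the value of
  \<open>- x\<^sub>d \<partial>(1/F)/\<partial>x\<^sub>d\<close> and \<open>M = q\<^sup>-\<^sup>1 (I + J)\<close>, with \<open>q = (1 - (d - 1) x) / x\<close> and \<open>J\<close> the all-ones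
  matrix, is the Hessian of size \<open>d - 1\<close>, so that \<open>det(M) = d q\<^sup>-\<^sup>(\<^sup>d\<^sup>-\<^sup>1\<^sup>)\<close>.
  The formula is also found in print with the base \<open>2 \<pi> (1 - (d - 1) x) / x\<^sup>(\<^sup>d\<^sup>-\<^sup>1\<^sup>)\<^sup>/\<^sup>2\<close> in place of
  \<open>(1 - (d - 1) x) / (2 \<pi> x)\<close>. This is a misprint: for \<open>c = 0\<close>, where \<open>x = 1 / d\<close>, Stirling's
  formula for the diagonal coefficient \<open>(d n)! / (n!)\<^sup>d\<close> gives the constant used here.
  The half-integer power is the principal one; the eigenvalues of \<open>M\<close> have nonnegative real part
  at a minimal point.
\<close>

definition diag_contribution :: "nat \<Rightarrow> complex \<Rightarrow> nat \<Rightarrow> complex" where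
  "diag_contribution d x n =
     x powi (- int (d * n)) / of_real (real n powr ((real d - 1) / 2))
     * ((1 - (of_nat d - 1) * x) / (2 * of_real pi * x)) powr of_real ((real d - 1) / 2)
     * (1 / (of_real (sqrt (real d)) * (1 - (of_nat d - 1) * x)))"

end

theory Submission
  imports Defs "HOL-Complex_Analysis.Complex_Analysis" "HOL-Probability.Probability"
    "HOL-Real_Asymp.Real_Asymp" "HOL-Computational_Algebra.Fundamental_Theorem_Algebra"
begin

text \<open>
  The coefficients are \<open>\<delta>\<^sub>n = \<Sum>\<^sub>k (- c)\<^sup>k (d n - d k + k)! / (k! (n - k)!\<^sup>d)\<close>. By the multiplication formula for the
  Gamma function, \<open>(d j)! / (d\<^sup>d\<^sup>j j!\<^sup>d)\<close> is the \<open>j\<close>-th moment of \<open>exp (- Y)\<close>, where \<open>exp (- Y)\<close> is a product of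
  \<open>d - 1\<close> independent Beta variables. Hence \<open>\<delta>\<^sub>n\<close> is the mean of the one-variable Taylor coefficient of
  order \<open>d n\<close> of \<open>1 / (1 - s x + c x\<^sup>d)\<close> at the random parameter \<open>s = d exp (- Y / d)\<close>.

  For fixed \<open>s\<close> this coefficient is a sum of residues. The minimal roots \<open>x\<close> at \<open>s = d\<close> satisfy
  \<open>Re (1 / x) > d - 1\<close>, which makes their modulus increase strictly when \<open>s\<close> decreases. So the integrand
  is concentrated near \<open>Y = 0\<close>, and each minimal root contributes a value of the Laplace transform of
  \<open>Y\<close> in the right half plane, at \<open>n x / (1 - (d - 1) x)\<close>, where it behaves like a constant times a power.

  The inequality degenerates to \<open>Re (1 / x) = d - 1\<close> only for \<open>d = 2\<close>, \<open>c > 1\<close>. There the generating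
  function of \<open>\<delta>\<close> is \<open>((1 - u t) (1 - u' t))\<^sup>-\<^sup>1\<^sup>/\<^sup>2\<close>, so \<open>\<delta>\<^sub>n\<close> is a convolution of two sequences of
  Beta moments, and it is again evaluated by an integral.
\<close>

text \<open>The multinomial weight in \<open>\<delta> n\<close> is a binomial coefficient times
  \<open>(d j)! / j!^d\<close> with \<open>j = n - k\<close>. The binomial coefficient belongs to
  the one-variable series, and the other factor is \<open>d^(d j)\<close> times a moment, so it can
  be hidden in the power \<open>s^(d j)\<close>. This replaces a saddle point analysis in
  \<open>d - 1\<close> dimensions by one contour integral per \<open>s\<close>. The price is
  uniformity: while \<open>s\<close> runs through \<open>[0, d]\<close>, no root may enter the
  closed disc of radius \<rho> before \<open>s = d\<close>, and this shapes the study of the roots.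
  The Laplace argument comes from differentiating a root along \<open>s = d exp (- Y / d)\<close>:
  at \<open>Y = 0\<close> the slope of \<open>d log x\<close> is \<open>x / (1 - (d - 1) x)\<close>,
  whose real part is positive exactly when \<open>Re (1 / x) > d - 1\<close>. The excluded
  \<open>c\<close> is, for \<open>d \<ge> 2\<close>, the value for which
  \<open>1 - d x + c x^d\<close> has the double root \<open>1 / (d - 1)\<close> and this slope is
  infinite; for \<open>d = 1\<close> it is the value for which there is no root at all.\<close>

no_notation fps_nth (infixl "$" 75)

section \<open>The diagonal coefficients\<close>

lemma power_series_zero_coeff:
  fixes c :: "nat \<Rightarrow> complex"
  assumes "r > 0" and *: "\<And>t. cmod t < r \<Longrightarrow> (\<lambda>m. c m * t ^ m) sums 0"
  shows "c m = 0"
proof (rule ccontr)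
  assume nz: "c m \<noteq> 0"
  have c0: "c 0 = 0"
    using *[of 0] \<open>r > 0\<close> sums_unique2[OF powser_sums_zero[of c] *[of 0]] by simp
  then have "m > 0" using nz by (cases m) auto
  have sm: "(\<lambda>n. c n * (x - 0) ^ n) sums 0" if "norm (x - 0) < r" for x
    using * that by simp
  obtain s where s: "0 < s" "\<And>z::complex. z \<in> cball 0 s - {0} \<Longrightarrow> (0::complex) \<noteq> 0"
    by (rule powser_0_nonzero[where f = "\<lambda>_. 0", OF \<open>r > 0\<close> sm _ nz \<open>m > 0\<close>]) auto
  from s(2)[of "of_real s"] s(1) show False by auto
qed

text \<open>Coordinates are eliminated one at a time: grouping by the exponent of one coordinate
  gives a one-variable series in it, whose coefficients must all vanish. The induction hypothesis
  fixes the exponents in \<open>I\<close> to those of \<open>\<gamma>\<close> and still sums over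
  the others, so \<open>I = UNIV\<close> leaves a single coefficient.\<close>

lemma multi_power_series_zero_coeff:
  fixes b :: "('d::finite \<Rightarrow> nat) \<Rightarrow> complex"
  assumes r: "r > 0"
    and b: "\<And>x :: complex ^ 'd. (\<And>i. cmod (x $ i) < r) \<Longrightarrow>
              ((\<lambda>\<alpha>. b \<alpha> * (\<Prod>i\<in>UNIV. (x $ i) ^ \<alpha> i)) has_sum 0) UNIV"
  shows "b \<alpha> = 0"
proof -
  have "\<forall>\<gamma> :: 'd \<Rightarrow> nat. \<forall>x :: complex ^ 'd. (\<forall>i. cmod (x $ i) < r) \<longrightarrow>
          ((\<lambda>\<alpha>. b \<alpha> * (\<Prod>i\<in>-I. (x $ i) ^ \<alpha> i)) has_sum 0) {\<alpha>. \<forall>i\<in>I. \<alpha> i = \<gamma> i}" for I :: "'d set"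
    using finite[of I]
  proof (induction I rule: finite_induct)
    case empty
    then show ?case using b by auto
  next
    case (insert j I)
    show ?case
    proof (intro allI impI)
      fix \<gamma> :: "'d \<Rightarrow> nat" and x :: "complex ^ 'd" assume x: "\<forall>i. cmod (x $ i) < r"
      define A where "A = {\<alpha>. \<forall>i\<in>I. \<alpha> i = \<gamma> i}"
      define B where "B m = {\<alpha>\<in>A. \<alpha> j = m}" for m
      define h where "h \<alpha> = b \<alpha> * (\<Prod>i\<in>-(insert j I). (x $ i) ^ \<alpha> i)" for \<alpha>
      have sumA: "((\<lambda>\<alpha>. h \<alpha> * t ^ \<alpha> j) has_sum 0) A" if "cmod t < r" for t
      proof -
        define y where "y = (\<chi> i. if i = j then t else x $ i)"
        have "\<forall>i. cmod (y $ i) < r" using x that by (auto simp: y_def)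
        with insert.IH have "((\<lambda>\<alpha>. b \<alpha> * (\<Prod>i\<in>-I. (y $ i) ^ \<alpha> i)) has_sum 0) A"
          by (auto simp: A_def)
        moreover have "b \<alpha> * (\<Prod>i\<in>-I. (y $ i) ^ \<alpha> i) = h \<alpha> * t ^ \<alpha> j" for \<alpha>
        proof -
          have "-I = insert j (-(insert j I))" using insert.hyps by auto
          moreover have "prod f (insert j (-(insert j I))) = f j * prod f (-(insert j I))" for f :: "'d \<Rightarrow> complex"
            by (rule prod.insert) auto
          ultimately have "(\<Prod>i\<in>-I. (y $ i) ^ \<alpha> i) = (y $ j) ^ \<alpha> j * (\<Prod>i\<in>-(insert j I). (y $ i) ^ \<alpha> i)"
            by simp
          also have "(\<Prod>i\<in>-(insert j I). (y $ i) ^ \<alpha> i) = (\<Prod>i\<in>-(insert j I). (x $ i) ^ \<alpha> i)"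
            by (intro prod.cong) (auto simp: y_def)
          finally show ?thesis by (simp add: h_def y_def)
        qed
        ultimately show ?thesis by simp
      qed
      \<comment> \<open>\<open>A\<close> is the disjoint union of the slices \<open>B m\<close> on
        which the exponent of coordinate \<open>j\<close> equals \<open>m\<close>.\<close>
      have bij: "bij_betw snd (Sigma UNIV B) A"
        by (rule bij_betwI[where g = "\<lambda>\<alpha>. (\<alpha> j, \<alpha>)"]) (auto simp: B_def)
      have sumS: "((\<lambda>(m, \<alpha>). h \<alpha> * t ^ \<alpha> j) has_sum 0) (Sigma UNIV B)" if "cmod t < r" for t
        using sumA[OF that] has_sum_reindex_bij_betw[OF bij, of "\<lambda>\<alpha>. h \<alpha> * t ^ \<alpha> j" 0]
        by (simp add: case_prod_unfold)
      \<comment> \<open>Any nonzero point of the disc would do: on a slice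
        \<open>t0 ^ \<alpha> j\<close> is the constant \<open>t0 ^ m\<close>, which can be divided
        out to make \<open>h\<close> itself summable there.\<close>
      define t0 :: complex where "t0 = of_real (r / 2)"
      have t0: "t0 \<noteq> 0" "cmod t0 < r" using r by (auto simp: t0_def)
      have hB: "h summable_on B m" for m
      proof -
        have "(\<lambda>\<alpha>. h \<alpha> * t0 ^ \<alpha> j) summable_on B m"
          by (rule summable_on_subset_banach[OF has_sum_imp_summable[OF sumA[OF t0(2)]]]) (auto simp: B_def)
        moreover have "(\<lambda>\<alpha>. h \<alpha> * t0 ^ \<alpha> j) summable_on B m \<longleftrightarrow> (\<lambda>\<alpha>. h \<alpha> * t0 ^ m) summable_on B m"
          by (rule summable_on_cong) (simp add: B_def)
        ultimately have "(\<lambda>\<alpha>. h \<alpha> * t0 ^ m) summable_on B m" by blast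
        then have "(\<lambda>\<alpha>. h \<alpha> * t0 ^ m * inverse (t0 ^ m)) summable_on B m"
          by (rule summable_on_cmult_left)
        moreover have "h \<alpha> * t0 ^ m * inverse (t0 ^ m) = h \<alpha>" for \<alpha>
          using t0 by (simp add: field_simps)
        ultimately show ?thesis by simp
      qed
      define c where "c m = infsum h (B m)" for m
      have hc: "(h has_sum c m) (B m)" for m
        unfolding c_def by (rule has_sum_infsum[OF hB])
      have "(\<lambda>m. c m * t ^ m) sums 0" if "cmod t < r" for t
      proof -
        have "((\<lambda>m. c m * t ^ m) has_sum 0) UNIV"
        proof (rule has_sum_SigmaD[OF sumS[OF that]])
          fix m
          have "((\<lambda>\<alpha>. h \<alpha> * t ^ m) has_sum c m * t ^ m) (B m)"
            by (rule has_sum_cmult_left[OF hc])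
          moreover have "((\<lambda>\<alpha>. h \<alpha> * t ^ m) has_sum c m * t ^ m) (B m) \<longleftrightarrow>
              ((\<lambda>y. case (m, y) of (m, \<alpha>) \<Rightarrow> h \<alpha> * t ^ \<alpha> j) has_sum c m * t ^ m) (B m)"
            by (rule has_sum_cong) (simp add: B_def)
          ultimately show "((\<lambda>y. case (m, y) of (m, \<alpha>) \<Rightarrow> h \<alpha> * t ^ \<alpha> j) has_sum c m * t ^ m) (B m)"
            by blast
        qed
        then show ?thesis by (rule has_sum_imp_sums)
      qed
      then have "c (\<gamma> j) = 0" by (rule power_series_zero_coeff[OF r])
      moreover have "B (\<gamma> j) = {\<alpha>. \<forall>i\<in>insert j I. \<alpha> i = \<gamma> i}"
        by (auto simp: B_def A_def)
      ultimately show "((\<lambda>\<alpha>. b \<alpha> * (\<Prod>i\<in>-(insert j I). (x $ i) ^ \<alpha> i)) has_sum 0)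
          {\<alpha>. \<forall>i\<in>insert j I. \<alpha> i = \<gamma> i}"
        using hc[of "\<gamma> j"] unfolding h_def by simp
    qed
  qed
  from this[of UNIV] have "(\<forall>i. cmod ((0 :: complex ^ 'd) $ i) < r) \<longrightarrow>
      ((\<lambda>\<alpha>. b \<alpha> * (\<Prod>i\<in>-UNIV. ((0 :: complex ^ 'd) $ i) ^ \<alpha> i)) has_sum 0) {\<beta>. \<forall>i\<in>UNIV. \<beta> i = \<alpha> i}"
    by blast
  with r have "(b has_sum 0) {\<beta>. \<forall>i. \<beta> i = \<alpha> i}" by simp
  moreover have "{\<beta>. \<forall>i. \<beta> i = \<alpha> i} = {\<alpha>}" by auto
  ultimately have "(b has_sum 0) {\<alpha>}" by simp
  moreover have "(b has_sum b \<alpha>) {\<alpha>}" by (rule has_sum_finiteI) simp_all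
  ultimately show ?thesis using has_sum_unique by blast
qed

section \<open>The recurrence for the coefficients and its solution by counting words\<close>

definition shift_coeff :: "('d \<Rightarrow> nat) \<Rightarrow> (('d \<Rightarrow> nat) \<Rightarrow> complex) \<Rightarrow> ('d \<Rightarrow> nat) \<Rightarrow> complex" where
  "shift_coeff \<gamma> a \<beta> = (if \<forall>i. \<gamma> i \<le> \<beta> i then a (\<lambda>i. \<beta> i - \<gamma> i) else 0)"

lemma shift_coeff_eq_0: "\<not> \<gamma> i \<le> \<beta> i \<Longrightarrow> shift_coeff \<gamma> a \<beta> = 0"
  unfolding shift_coeff_def by (rule if_not_P) blast

text \<open>Multiplication by a monomial translates the exponents injectively. Outside the range of
  the translation the guard in \<open>shift_coeff\<close> gives 0, where truncated subtraction alone
  would pick up a wrong coefficient.\<close>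

lemma has_sum_shift_coeff:
  fixes x :: "complex ^ 'd::finite"
  assumes "((\<lambda>\<alpha>. a \<alpha> * (\<Prod>i\<in>UNIV. (x $ i) ^ \<alpha> i)) has_sum S) UNIV"
  shows "((\<lambda>\<beta>. shift_coeff \<gamma> a \<beta> * (\<Prod>i\<in>UNIV. (x $ i) ^ \<beta> i)) has_sum
           (\<Prod>i\<in>UNIV. (x $ i) ^ \<gamma> i) * S) UNIV"
proof -
  define p where "p = (\<Prod>i\<in>UNIV. (x $ i) ^ \<gamma> i)"
  define f where "f \<beta> = shift_coeff \<gamma> a \<beta> * (\<Prod>i\<in>UNIV. (x $ i) ^ \<beta> i)" for \<beta>
  define h where "h \<alpha> i = \<alpha> i + \<gamma> i" for \<alpha> :: "'d \<Rightarrow> nat" and i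
  have inj: "inj_on h UNIV" by (rule inj_onI) (auto simp: h_def fun_eq_iff)
  have "((\<lambda>\<alpha>. p * (a \<alpha> * (\<Prod>i\<in>UNIV. (x $ i) ^ \<alpha> i))) has_sum p * S) UNIV"
    by (rule has_sum_cmult_right[OF assms])
  moreover have "p * (a \<alpha> * (\<Prod>i\<in>UNIV. (x $ i) ^ \<alpha> i)) = (f \<circ> h) \<alpha>" for \<alpha>
    by (simp add: f_def h_def p_def shift_coeff_def power_add prod.distrib mult_ac)
  ultimately have "((f \<circ> h) has_sum p * S) UNIV" by (simp add: o_def)
  then have "(f has_sum p * S) (range h)" using has_sum_reindex[OF inj, of f] by simp
  moreover have "(f has_sum p * S) (range h) \<longleftrightarrow> (f has_sum p * S) UNIV"
  proof (rule has_sum_cong_neutral)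
    fix \<beta> assume "\<beta> \<in> UNIV - range h"
    have "\<not> (\<forall>i. \<gamma> i \<le> \<beta> i)"
    proof
      assume "\<forall>i. \<gamma> i \<le> \<beta> i"
      then have "\<beta> = h (\<lambda>i. \<beta> i - \<gamma> i)" by (simp add: h_def fun_eq_iff)
      with \<open>\<beta> \<in> UNIV - range h\<close> show False by blast
    qed
    then obtain i where "\<not> \<gamma> i \<le> \<beta> i" by blast
    then show "f \<beta> = 0" by (simp add: f_def shift_coeff_eq_0)
  qed auto
  ultimately have "(f has_sum p * S) UNIV" by blast
  then show ?thesis unfolding f_def p_def .
qed

definition unit_exponent :: "'d \<Rightarrow> 'd \<Rightarrow> nat" where
  "unit_exponent i j = (if j = i then 1 else 0)"

lemma has_sum_sumI:
  fixes f :: "'i \<Rightarrow> 'a \<Rightarrow> complex"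
  assumes "finite I" "\<And>i. i \<in> I \<Longrightarrow> (f i has_sum S i) A"
  shows "((\<lambda>x. \<Sum>i\<in>I. f i x) has_sum (\<Sum>i\<in>I. S i)) A"
  using assms by (induction I rule: finite_induct) (auto intro!: has_sum_add)

text \<open>Comparison of coefficients in \<open>(1 - e_1 + c e_d) * F_sym c = 1\<close>: the defect
  \<open>b\<close> is the coefficient family of a series with sum 0 near the origin.\<close>

lemma F_sym_coeff_recurrence:
  fixes a :: "('d::finite \<Rightarrow> nat) \<Rightarrow> complex"
  assumes "has_power_series_at_origin (F_sym c :: complex ^ 'd \<Rightarrow> complex) a"
  shows "a \<beta> = (if \<beta> = (\<lambda>_. 0) then 1 else 0) + (\<Sum>i\<in>UNIV. shift_coeff (unit_exponent i) a \<beta>)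
              - of_real c * shift_coeff (\<lambda>_. 1) a \<beta>"
proof -
  define b where "b \<beta> = a \<beta> - (\<Sum>i\<in>UNIV. shift_coeff (unit_exponent i) a \<beta>)
      + of_real c * shift_coeff (\<lambda>_. 1) a \<beta> - (if \<beta> = (\<lambda>_. 0) then 1 else 0)" for \<beta>
  obtain r0 where "r0 > 0" and r0: "\<And>x :: complex ^ 'd. (\<And>i. cmod (x $ i) < r0) \<Longrightarrow>
      ((\<lambda>\<alpha>. a \<alpha> * (\<Prod>i\<in>UNIV. (x $ i) ^ \<alpha> i)) has_sum F_sym c x) UNIV"
    using assms unfolding has_power_series_at_origin_def by blast
  have "isCont (\<lambda>x :: complex ^ 'd. 1 - (\<Sum>i\<in>UNIV. x $ i) + of_real c * (\<Prod>i\<in>UNIV. x $ i)) 0"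
    by (intro continuous_intros)
  then have "\<exists>e>0. \<forall>x :: complex ^ 'd. dist 0 x < e \<longrightarrow>
       1 - (\<Sum>i\<in>UNIV. x $ i) + of_real c * (\<Prod>i\<in>UNIV. x $ i) \<noteq> 0"
    by (rule continuous_at_avoid) (simp add: zero_power)
  then obtain e where "e > 0" and e: "\<And>x :: complex ^ 'd. norm x < e \<Longrightarrow>
       1 - (\<Sum>i\<in>UNIV. x $ i) + of_real c * (\<Prod>i\<in>UNIV. x $ i) \<noteq> 0"
    by (auto simp: dist_norm)
  \<comment> \<open>The norm of \<open>x\<close> is at most the sum of its coordinate moduli, so
    this polydisc lies in the ball where the denominator of \<open>F_sym\<close> does not
    vanish.\<close>
  define r where "r = min r0 (e / CARD('d))"
  have "r > 0" using \<open>r0 > 0\<close> \<open>e > 0\<close> by (simp add: r_def)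
  have "b \<beta> = 0" for \<beta>
  proof (rule multi_power_series_zero_coeff[OF \<open>r > 0\<close>])
    fix x :: "complex ^ 'd" assume x: "\<And>i. cmod (x $ i) < r"
    have F: "((\<lambda>\<alpha>. a \<alpha> * (\<Prod>i\<in>UNIV. (x $ i) ^ \<alpha> i)) has_sum F_sym c x) UNIV"
      using r0 x by (simp add: r_def)
    have "norm x \<le> (\<Sum>i\<in>UNIV. cmod (x $ i))" unfolding norm_vec_def by (rule L2_set_le_sum) simp
    also have "\<dots> < (\<Sum>i\<in>(UNIV::'d set). r)" by (rule sum_strict_mono) (use x in auto)
    also have "\<dots> \<le> e" by (simp add: r_def min_def field_simps)
    finally have nz: "1 - (\<Sum>i\<in>UNIV. x $ i) + of_real c * (\<Prod>i\<in>UNIV. x $ i) \<noteq> 0" by (rule e)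
    have e1: "(\<Prod>j\<in>UNIV. (x $ j) ^ unit_exponent i j) = x $ i" for i
    proof -
      have "(\<Prod>j\<in>UNIV. (x $ j) ^ unit_exponent i j) = (\<Prod>j\<in>UNIV. if j = i then x $ j else 1)"
        by (rule prod.cong) (auto simp: unit_exponent_def)
      then show ?thesis by simp
    qed
    have one: "((\<lambda>\<alpha>. (if \<alpha> = (\<lambda>_. 0) then 1 else 0) * (\<Prod>i\<in>UNIV. (x $ i) ^ \<alpha> i)) has_sum 1) UNIV"
      by (rule has_sum_finite_neutralI[where B = "{\<lambda>_. 0}"]) auto
    have "((\<lambda>\<alpha>. a \<alpha> * (\<Prod>i\<in>UNIV. (x $ i) ^ \<alpha> i)
           - (\<Sum>i\<in>UNIV. shift_coeff (unit_exponent i) a \<alpha> * (\<Prod>i\<in>UNIV. (x $ i) ^ \<alpha> i))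
           + of_real c * (shift_coeff (\<lambda>_. 1) a \<alpha> * (\<Prod>i\<in>UNIV. (x $ i) ^ \<alpha> i))
           - (if \<alpha> = (\<lambda>_. 0) then 1 else 0) * (\<Prod>i\<in>UNIV. (x $ i) ^ \<alpha> i)) has_sum
           F_sym c x - (\<Sum>i\<in>UNIV. x $ i * F_sym c x) + of_real c * ((\<Prod>i\<in>UNIV. x $ i) * F_sym c x) - 1) UNIV"
      using has_sum_shift_coeff[OF F, of "unit_exponent _"] has_sum_shift_coeff[OF F, of "\<lambda>_. 1"]
      unfolding diff_conv_add_uminus
      by (intro has_sum_uminusI has_sum_add has_sum_cmult_right has_sum_sumI F one) (auto simp: e1)
    moreover have "F_sym c x - (\<Sum>i\<in>UNIV. x $ i * F_sym c x)
        + of_real c * ((\<Prod>i\<in>UNIV. x $ i) * F_sym c x) - 1 = 0"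
      using nz by (simp add: F_sym_def sum_divide_distrib[symmetric] diff_divide_distrib[symmetric] add_divide_distrib[symmetric])
    moreover have "a \<alpha> * (\<Prod>i\<in>UNIV. (x $ i) ^ \<alpha> i)
           - (\<Sum>i\<in>UNIV. shift_coeff (unit_exponent i) a \<alpha> * (\<Prod>i\<in>UNIV. (x $ i) ^ \<alpha> i))
           + of_real c * (shift_coeff (\<lambda>_. 1) a \<alpha> * (\<Prod>i\<in>UNIV. (x $ i) ^ \<alpha> i))
           - (if \<alpha> = (\<lambda>_. 0) then 1 else 0) * (\<Prod>i\<in>UNIV. (x $ i) ^ \<alpha> i)
         = b \<alpha> * (\<Prod>i\<in>UNIV. (x $ i) ^ \<alpha> i)" for \<alpha>
      by (simp add: b_def algebra_simps sum_distrib_right)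
    ultimately show "((\<lambda>\<alpha>. b \<alpha> * (\<Prod>i\<in>UNIV. (x $ i) ^ \<alpha> i)) has_sum 0) UNIV" by simp
  qed
  from this[of \<beta>] show ?thesis by (simp add: b_def algebra_simps)
qed

text \<open>The number of words with \<open>k\<close> letters \<open>- c e\<^sub>d\<close> and \<open>\<beta> i - k\<close> letters \<open>x\<^sub>i\<close>, weighted by \<open>(- c)\<^sup>k\<close>.\<close>

definition word_weight :: "complex \<Rightarrow> ('d::finite \<Rightarrow> nat) \<Rightarrow> nat \<Rightarrow> complex" where
  "word_weight c \<beta> k = (if \<forall>i. k \<le> \<beta> i then
     (- c) ^ k * fact ((\<Sum>i\<in>UNIV. \<beta> i - k) + k) / (fact k * (\<Prod>i\<in>UNIV. fact (\<beta> i - k))) else 0)"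

lemma word_weight_eq_0: "\<beta> i < k \<Longrightarrow> word_weight c \<beta> k = 0"
  unfolding word_weight_def by (rule if_not_P) (metis leD)

text \<open>Words are classified by their last letter: dropping an \<open>x_i\<close> keeps
  \<open>k\<close>, dropping a letter \<open>e_d\<close> lowers \<open>k\<close> and every exponent
  by one.\<close>

lemma word_weight_recurrence:
  fixes \<beta> :: "'d::finite \<Rightarrow> nat"
  assumes "\<beta> \<noteq> (\<lambda>_. 0)"
  shows "word_weight c \<beta> k = (\<Sum>i\<in>UNIV. shift_coeff (unit_exponent i) (\<lambda>\<beta>. word_weight c \<beta> k) \<beta>)
     - c * (if k = 0 then 0 else shift_coeff (\<lambda>_. 1) (\<lambda>\<beta>. word_weight c \<beta> (k - 1)) \<beta>)"
proof (cases "\<forall>i. k \<le> \<beta> i")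
  case False
  then obtain i0 where i0: "\<beta> i0 < k" using not_le by blast
  have "shift_coeff (unit_exponent i) (\<lambda>\<beta>. word_weight c \<beta> k) \<beta> = 0" for i
    unfolding shift_coeff_def using i0 by (simp add: word_weight_eq_0[of _ i0])
  moreover have "shift_coeff (\<lambda>_. 1) (\<lambda>\<beta>. word_weight c \<beta> (k - 1)) \<beta> = 0" if "k \<noteq> 0"
  proof (cases "\<forall>i. 1 \<le> \<beta> i")
    case T: True
    then have "\<beta> i0 - 1 < k - 1" using i0 diff_less_mono[of "\<beta> i0" k 1] by auto
    then show ?thesis unfolding shift_coeff_def by (simp add: word_weight_eq_0[of _ i0])
  next
    case F: False
    then obtain i where "\<not> 1 \<le> \<beta> i" by blast
    then show ?thesis by (rule shift_coeff_eq_0[of "\<lambda>_. 1"])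
  qed
  ultimately show ?thesis using i0 by (simp add: word_weight_eq_0[of _ i0])
next
  case True
  define s where "s = (\<Sum>i\<in>UNIV. \<beta> i - k)"
  define p where "p = (\<Prod>i\<in>UNIV. fact (\<beta> i - k) :: complex)"
  have p: "p \<noteq> 0" by (simp add: p_def)
  obtain i0 where i0: "\<beta> i0 \<noteq> 0" using assms by auto
  have "s + k \<noteq> 0"
  proof
    assume "s + k = 0"
    then have "k = 0" "\<beta> i0 - k = 0" by (auto simp: s_def)
    then show False using i0 by simp
  qed
  then have fs: "fact (s + k) = of_nat (s + k) * (fact (s + k - 1) :: complex)"
    using fact_reduce[of "s + k", where ?'a = complex] by simp
  \<comment> \<open>\<open>g\<close> is the weight with \<open>fact (s + k)\<close> lowered to
    \<open>fact (s + k - 1)\<close>. The terms on the right are the shares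
    \<open>g * (\<beta> i - k)\<close> and \<open>g * k\<close>, which add up to
    \<open>g * (s + k)\<close>.\<close>
  define g where "g = (- c) ^ k * fact (s + k - 1) / (fact k * p)"
  have 1: "shift_coeff (unit_exponent i) (\<lambda>\<beta>. word_weight c \<beta> k) \<beta> = g * of_nat (\<beta> i - k)" for i
  proof (cases "\<beta> i = k")
    case T: True
    have "shift_coeff (unit_exponent i) (\<lambda>\<beta>. word_weight c \<beta> k) \<beta> = 0"
      using i0 T by (auto simp: shift_coeff_def word_weight_def unit_exponent_def not_le intro!: exI[of _ i])
    then show ?thesis using T by simp
  next
    case F: False
    then have ik: "k < \<beta> i" using True by (simp add: order.not_eq_order_implies_strict)
    define \<beta>' where "\<beta>' j = \<beta> j - unit_exponent i j" for j
    have b': "\<beta>' = \<beta>(i := \<beta> i - 1)" by (auto simp: \<beta>'_def unit_exponent_def)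
    have "(\<Sum>j\<in>UNIV. \<beta>' j - k) = s - 1" and "(\<Prod>j\<in>UNIV. fact (\<beta>' j - k) :: complex) * of_nat (\<beta> i - k) = p"
    proof -
      have U: "UNIV = insert i (-{i})" by auto
      have "(\<Sum>j\<in>UNIV. \<beta>' j - k) = (\<beta> i - 1 - k) + (\<Sum>j\<in>-{i}. \<beta> j - k)"
        by (subst U, subst sum.insert) (auto simp: b' intro!: sum.cong)
      moreover have "s = (\<beta> i - k) + (\<Sum>j\<in>-{i}. \<beta> j - k)"
        unfolding s_def by (subst U, subst sum.insert) auto
      ultimately show "(\<Sum>j\<in>UNIV. \<beta>' j - k) = s - 1" using ik by simp
      have "(\<Prod>j\<in>UNIV. fact (\<beta>' j - k) :: complex) = fact (\<beta> i - 1 - k) * (\<Prod>j\<in>-{i}. fact (\<beta> j - k))"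
        by (subst U, subst prod.insert) (auto simp: b' intro!: prod.cong)
      moreover have "p = fact (\<beta> i - k) * (\<Prod>j\<in>-{i}. fact (\<beta> j - k))"
        unfolding p_def by (subst U, subst prod.insert) auto
      moreover have "(fact (\<beta> i - k) :: complex) = of_nat (\<beta> i - k) * fact (\<beta> i - 1 - k)"
        using ik fact_reduce[of "\<beta> i - k", where ?'a = complex] by simp
      ultimately show "(\<Prod>j\<in>UNIV. fact (\<beta>' j - k) :: complex) * of_nat (\<beta> i - k) = p" by simp
    qed
    note sums = this
    define p' where "p' = (\<Prod>j\<in>UNIV. fact (\<beta>' j - k) :: complex)"
    have "s \<ge> 1"
      using ik member_le_sum[of i UNIV "\<lambda>i. \<beta> i - k"] by (simp add: s_def)
    then have "s - 1 + k = s + k - 1" by simp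
    moreover have "\<forall>j. k \<le> \<beta>' j" using True ik by (auto simp: b')
    moreover have "\<forall>j. unit_exponent i j \<le> \<beta> j" using ik by (auto simp: unit_exponent_def)
    ultimately have "shift_coeff (unit_exponent i) (\<lambda>\<beta>. word_weight c \<beta> k) \<beta>
        = (- c) ^ k * fact (s + k - 1) / (fact k * p')"
      by (simp add: shift_coeff_def word_weight_def \<beta>'_def[symmetric] sums(1) p'_def)
    moreover have "p = p' * of_nat (\<beta> i - k)" using sums(2) by (simp add: p'_def)
    moreover have "of_nat (\<beta> i - k) \<noteq> (0 :: complex)" using ik by simp
    ultimately show ?thesis unfolding g_def by simp
  qed
  have 2: "- c * (if k = 0 then 0 else shift_coeff (\<lambda>_. 1) (\<lambda>\<beta>. word_weight c \<beta> (k - 1)) \<beta>) = g * of_nat k"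
  proof (cases "k = 0")
    case False
    have ge1: "\<forall>i. 1 \<le> \<beta> i"
    proof
      fix i have "k \<le> \<beta> i" using True by blast
      then show "1 \<le> \<beta> i" using False by simp
    qed
    have c1: "\<forall>i. k - 1 \<le> \<beta> i - 1" using True by (simp add: diff_le_mono)
    have e: "\<beta> i - 1 - (k - 1) = \<beta> i - k" for i using False by simp
    have f: "(fact k :: complex) = of_nat k * fact (k - 1)" using False by (simp add: fact_reduce)
    have pw: "(- c) ^ k = - c * (- c) ^ (k - 1)" using False by (cases k) auto
    have "shift_coeff (\<lambda>_. 1) (\<lambda>\<beta>. word_weight c \<beta> (k - 1)) \<beta>
        = (- c) ^ (k - 1) * fact (s + (k - 1)) / (fact (k - 1) * p)"
      using ge1 c1 unfolding shift_coeff_def word_weight_def e s_def p_def by simp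
    then show ?thesis using False p unfolding g_def f pw by (simp add: field_simps)
  qed simp
  have "word_weight c \<beta> k = (- c) ^ k * fact (s + k) / (fact k * p)"
    using True by (simp add: word_weight_def s_def p_def)
  also have "\<dots> = g * of_nat s + g * of_nat k"
    unfolding fs g_def by (simp add: algebra_simps add_divide_distrib)
  also have "g * of_nat s = (\<Sum>i\<in>UNIV. g * of_nat (\<beta> i - k))"
    by (simp add: s_def sum_distrib_left)
  finally show ?thesis unfolding 1 2[symmetric] by simp
qed

text \<open>The recurrence determines the coefficients by induction on the total degree. The cutoff
  \<open>N\<close> stays fixed during the induction, so that all sums over \<open>k\<close> have the
  same range.\<close>

lemma F_sym_coeff_eq:
  fixes a :: "('d::finite \<Rightarrow> nat) \<Rightarrow> complex"
  assumes "has_power_series_at_origin (F_sym c :: complex ^ 'd \<Rightarrow> complex) a"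
    and "(\<Sum>i\<in>UNIV. \<beta> i) \<le> N"
  shows "a \<beta> = (\<Sum>k\<le>N. word_weight c \<beta> k)"
  using assms(2)
proof (induction "\<Sum>i\<in>UNIV. \<beta> i" arbitrary: \<beta> rule: less_induct)
  case less
  show ?case
  proof (cases "\<beta> = (\<lambda>_. 0)")
    case True
    have "a \<beta> = 1"
      using True by (subst F_sym_coeff_recurrence[OF assms(1)])
        (auto simp: shift_coeff_def unit_exponent_def split: if_splits)
    moreover have "(\<Sum>k\<le>N. word_weight (of_real c) \<beta> k) = (\<Sum>k\<in>{0}. word_weight (of_real c) \<beta> k)"
      by (rule sum.mono_neutral_right) (auto simp: True word_weight_def)
    ultimately show ?thesis by (simp add: True word_weight_def)
  next
    case False
    have 0: "word_weight (of_real c) \<beta> k = 0" if "k > N" for k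
    proof -
      have "\<beta> i < k" for i
        using that less.prems member_le_sum[of i UNIV \<beta>] by simp
      then show ?thesis by (rule word_weight_eq_0)
    qed
    have 1: "shift_coeff \<gamma> a \<beta> = (\<Sum>k\<le>N. shift_coeff \<gamma> (\<lambda>\<beta>. word_weight (of_real c) \<beta> k) \<beta>)"
      if "\<gamma> i0 \<noteq> 0" for \<gamma> :: "'d \<Rightarrow> nat" and i0
    proof (cases "\<forall>i. \<gamma> i \<le> \<beta> i")
      case True
      have "(\<Sum>i\<in>UNIV. \<beta> i - \<gamma> i) < (\<Sum>i\<in>UNIV. \<beta> i)"
      proof (rule sum_strict_mono_ex1)
        have "\<gamma> i0 \<le> \<beta> i0" using True by blast
        then show "\<exists>i\<in>UNIV. \<beta> i - \<gamma> i < \<beta> i" using that by (intro bexI[of _ i0]) auto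
      qed auto
      then have "a (\<lambda>i. \<beta> i - \<gamma> i) = (\<Sum>k\<le>N. word_weight (of_real c) (\<lambda>i. \<beta> i - \<gamma> i) k)"
        using less by simp
      then show ?thesis using True by (simp add: shift_coeff_def)
    next
      case False
      then obtain i where "\<not> \<gamma> i \<le> \<beta> i" by blast
      then have "shift_coeff \<gamma> f \<beta> = 0" for f by (rule shift_coeff_eq_0)
      then show ?thesis by simp
    qed
    \<comment> \<open>Shifting the index \<open>k\<close> by one loses the top term
      \<open>k = N\<close>. It vanishes because the lowered exponents are all smaller than
      \<open>N\<close>.\<close>
    have 3: "shift_coeff (\<lambda>_. 1) (\<lambda>\<beta>. word_weight (of_real c) \<beta> N) \<beta> = 0"
    proof (cases "\<forall>i. 1 \<le> \<beta> i")
      case True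
      have "\<beta> i - 1 < N" for i
      proof -
        have "1 \<le> \<beta> i" "\<beta> i \<le> N" using True less.prems member_le_sum[of i UNIV \<beta>] by auto
        then show ?thesis by linarith
      qed
      then show ?thesis unfolding shift_coeff_def by (simp add: word_weight_eq_0[where i = undefined])
    next
      case F: False
      then obtain i where "\<not> 1 \<le> \<beta> i" by blast
      then show ?thesis by (rule shift_coeff_eq_0[of "\<lambda>_. 1"])
    qed
    have 2: "(\<Sum>k\<le>N. shift_coeff (\<lambda>_. 1) (\<lambda>\<beta>. word_weight (of_real c) \<beta> k) \<beta>)
        = (\<Sum>k\<le>N. if k = 0 then 0 else shift_coeff (\<lambda>_. 1) (\<lambda>\<beta>. word_weight (of_real c) \<beta> (k - 1)) \<beta>)"
      (is "sum ?f {..N} = sum ?g {..N}")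
    proof -
      have "sum ?g {..Suc N'} = sum ?f {..N'}" for N'
        by (subst sum.atMost_Suc_shift) simp
      moreover have "sum ?f {..Suc N'} = sum ?f {..N'} + ?f (Suc N')" for N' by simp
      ultimately show ?thesis using 3 by (cases N) auto
    qed
    have "a \<beta> = (\<Sum>i\<in>UNIV. \<Sum>k\<le>N. shift_coeff (unit_exponent i) (\<lambda>\<beta>. word_weight (of_real c) \<beta> k) \<beta>)
        - of_real c * (\<Sum>k\<le>N. if k = 0 then 0 else shift_coeff (\<lambda>_. 1) (\<lambda>\<beta>. word_weight (of_real c) \<beta> (k - 1)) \<beta>)"
    proof -
      have "shift_coeff (unit_exponent i) a \<beta> = (\<Sum>k\<le>N. shift_coeff (unit_exponent i) (\<lambda>\<beta>. word_weight (of_real c) \<beta> k) \<beta>)" for i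
        by (rule 1[of _ i]) (simp add: unit_exponent_def)
      moreover have "shift_coeff (\<lambda>_. 1) a \<beta> = (\<Sum>k\<le>N. shift_coeff (\<lambda>_. 1) (\<lambda>\<beta>. word_weight (of_real c) \<beta> k) \<beta>)"
        by (rule 1) simp
      ultimately show ?thesis
        using False unfolding 2[symmetric] by (subst F_sym_coeff_recurrence[OF assms(1)]) simp
    qed
    also have "\<dots> = (\<Sum>k\<le>N. word_weight (of_real c) \<beta> k)"
      unfolding word_weight_recurrence[OF False]
      by (subst sum.swap) (simp add: sum_subtractf sum_distrib_left)
    finally show ?thesis .
  qed
qed

lemma F_sym_diagonal_coeff:
  fixes a :: "('d::finite \<Rightarrow> nat) \<Rightarrow> complex"
  assumes "has_power_series_at_origin (F_sym c :: complex ^ 'd \<Rightarrow> complex) a"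
  shows "a (\<lambda>_. n) = (\<Sum>k\<le>n. (- of_real c) ^ k * fact (CARD('d) * (n - k) + k)
                              / (fact k * fact (n - k) ^ CARD('d)))"
proof -
  have "a (\<lambda>_. n) = (\<Sum>k\<le>CARD('d) * n. word_weight (of_real c) (\<lambda>_::'d. n) k)"
    by (rule F_sym_coeff_eq[OF assms]) simp
  also have "\<dots> = (\<Sum>k\<le>n. word_weight (of_real c) (\<lambda>_::'d. n) k)"
    by (rule sum.mono_neutral_right) (auto simp: word_weight_def)
  finally show ?thesis by (simp add: word_weight_def)
qed

section \<open>The one-variable coefficients and their residues\<close>

text \<open>The coefficient of \<open>x ^ m\<close> in \<open>1 / (1 - s * x + c * x ^ d)\<close>:
  \<open>k\<close> letters \<open>- c * x ^ d\<close> are mixed with \<open>m - d * k\<close>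
  letters \<open>s * x\<close>.\<close>

definition line_coeff :: "nat \<Rightarrow> complex \<Rightarrow> complex \<Rightarrow> nat \<Rightarrow> complex" where
  "line_coeff d c s m = (\<Sum>k | d * k \<le> m. (- c) ^ k * of_nat (m - d * k + k choose k) * s ^ (m - d * k))"

text \<open>Again a classification by the last letter, which here amounts to Pascal's rule for the
  binomial coefficients.\<close>

lemma line_coeff_recurrence:
  assumes d: "d \<ge> 1"
  shows "line_coeff d c s m = (if m = 0 then 1 else 0) + (if m \<ge> 1 then s * line_coeff d c s (m - 1) else 0)
           - (if m \<ge> d then c * line_coeff d c s (m - d) else 0)"
proof -
  \<comment> \<open>The summand is extended by zero, so that the sums for \<open>m\<close>,
    \<open>m - 1\<close> and \<open>m - d\<close> can all run over one range of
    \<open>k\<close>.\<close>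
  define t where "t m k = (if d * k \<le> m then (- c) ^ k * of_nat (m - d * k + k choose k) * s ^ (m - d * k) else 0)"
    for m k
  have sum_t: "line_coeff d c s m = (\<Sum>k\<le>N. t m k)" if "m \<le> N" for m N
  proof -
    have "{k. d * k \<le> m} = {k\<in>{..N}. d * k \<le> m}"
    proof -
      have "k \<le> N" if "d * k \<le> m" for k
      proof -
        have "k \<le> d * k" using d by (cases d) auto
        then show ?thesis using that \<open>m \<le> N\<close> by linarith
      qed
      then show ?thesis by auto
    qed
    then show ?thesis unfolding line_coeff_def t_def by (simp only: sum.inter_filter[symmetric] finite_atMost)
  qed
  have step: "t m k = (if m = 0 \<and> k = 0 then 1 else 0) + (if m \<ge> 1 then s * t (m - 1) k else 0)
      - (if m \<ge> d \<and> k \<ge> 1 then c * t (m - d) (k - 1) else 0)" for k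
  proof (cases "d * k \<le> m")
    case False
    have "d * (k - 1) = d * k - d" by (simp add: diff_mult_distrib2)
    then show ?thesis using False d by (auto simp: t_def)
  next
    case True
    then obtain j where j: "m = d * k + j" using le_Suc_ex by blast
    show ?thesis
    proof (cases k)
      case 0
      then show ?thesis using j d by (cases j) (auto simp: t_def)
    next
      case (Suc k')
      have m: "m = d + d * k' + j" using j Suc by simp
      show ?thesis
      proof (cases j)
        case 0
        then show ?thesis using m Suc d by (simp add: t_def)
      next
        case (Suc j')
        have "t m k = (- c) ^ k * of_nat (j' + k + 1 choose k) * s ^ (j' + 1)"
          using j Suc by (simp add: t_def)
        also have "j' + k + 1 choose k = (j' + k choose k) + (j' + k choose k')"
          using \<open>k = Suc k'\<close> by simp
        also have "(- c) ^ k * of_nat \<dots> * s ^ (j' + 1) =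
            s * ((- c) ^ k * of_nat (j' + k choose k) * s ^ j') - c * ((- c) ^ k' * of_nat (j' + k choose k') * s ^ (j' + 1))"
          using \<open>k = Suc k'\<close> by (simp add: algebra_simps)
        also have "(- c) ^ k * of_nat (j' + k choose k) * s ^ j' = t (m - 1) k"
          using j Suc by (simp add: t_def)
        also have "(- c) ^ k' * of_nat (j' + k choose k') * s ^ (j' + 1) = t (m - d) (k - 1)"
          using m Suc \<open>k = Suc k'\<close> by (simp add: t_def)
        finally show ?thesis using m Suc \<open>k = Suc k'\<close> d by simp
      qed
    qed
  qed
  have 1: "(\<Sum>k\<le>m. if m = 0 \<and> k = 0 then 1 else (0::complex)) = (if m = 0 then 1 else 0)"
    by simp
  have 2: "(\<Sum>k\<le>m. if m \<ge> 1 then s * t (m - 1) k else 0) = (if m \<ge> 1 then s * line_coeff d c s (m - 1) else 0)"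
    using sum_t[of "m - 1" m] by (simp add: sum_distrib_left)
  have 3: "(\<Sum>k\<le>m. if m \<ge> d \<and> k \<ge> 1 then c * t (m - d) (k - 1) else 0) = (if m \<ge> d then c * line_coeff d c s (m - d) else 0)"
  proof (cases "m \<ge> d")
    case True
    then obtain m' where m': "m = Suc m'" using d by (cases m) auto
    have "(\<Sum>k\<le>m. if m \<ge> d \<and> k \<ge> 1 then c * t (m - d) (k - 1) else 0) = (\<Sum>k\<le>m'. c * t (m - d) k)"
      using True unfolding m' by (subst sum.atMost_Suc_shift) simp
    also have "\<dots> = c * line_coeff d c s (m - d)"
      using d sum_t[of "m - d" m'] by (simp add: m' sum_distrib_left)
    finally show ?thesis using True by simp
  qed simp
  have "line_coeff d c s m = (\<Sum>k\<le>m. t m k)" by (rule sum_t) simp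
  also have "\<dots> = (\<Sum>k\<le>m. (if m = 0 \<and> k = 0 then 1 else 0)) + (\<Sum>k\<le>m. (if m \<ge> 1 then s * t (m - 1) k else 0))
      - (\<Sum>k\<le>m. (if m \<ge> d \<and> k \<ge> 1 then c * t (m - d) (k - 1) else 0))"
    by (subst step) (simp only: sum.distrib sum_subtractf)
  finally show ?thesis unfolding 1 2 3 .
qed

definition line_fps :: "nat \<Rightarrow> complex \<Rightarrow> complex \<Rightarrow> complex fps" where
  "line_fps d c s = 1 - fps_const s * fps_X + fps_const c * fps_X ^ d"

lemma inverse_line_fps:
  assumes d: "d \<ge> 1"
  shows "inverse (line_fps d c s) = Abs_fps (line_coeff d c s)"
proof -
  have "line_fps d c s * Abs_fps (line_coeff d c s) = 1"
  proof (rule fps_ext)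
    fix m
    have "line_fps d c s * Abs_fps (line_coeff d c s) = Abs_fps (line_coeff d c s)
        - fps_const s * (fps_X * Abs_fps (line_coeff d c s)) + fps_const c * (fps_X ^ d * Abs_fps (line_coeff d c s))"
      unfolding line_fps_def by (simp only: ring_distribs mult_1 mult.assoc)
    then have "fps_nth (line_fps d c s * Abs_fps (line_coeff d c s)) m = line_coeff d c s m
        - (if m = 0 then 0 else s * line_coeff d c s (m - 1)) + (if m < d then 0 else c * line_coeff d c s (m - d))"
      by (simp add: fps_X_power_mult_nth)
    also have "\<dots> = fps_nth 1 m"
      using d by (subst line_coeff_recurrence[OF d]) auto
    finally show "fps_nth (line_fps d c s * Abs_fps (line_coeff d c s)) m = fps_nth 1 m" .
  qed
  then show ?thesis by (rule fps_inverse_unique)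
qed

text \<open>Brings the coefficient into the form in which it appears as the residue of
  \<open>1 / (x ^ Suc m * P x)\<close> at the origin.\<close>

lemma line_coeff_eq_deriv:
  assumes d: "d \<ge> 1"
  shows "(deriv ^^ m) (\<lambda>x. inverse (1 - s * x + c * x ^ d)) 0 / fact m = line_coeff d c s m"
proof -
  have 1: "(\<lambda>x. 1 - s * x + c * x ^ d) has_fps_expansion line_fps d c s"
    unfolding line_fps_def by (intro fps_expansion_intros)
  have "fps_nth (line_fps d c s) 0 \<noteq> 0" using d by (simp add: line_fps_def)
  then have "(\<lambda>x. inverse (1 - s * x + c * x ^ d)) has_fps_expansion Abs_fps (line_coeff d c s)"
    unfolding inverse_line_fps[OF d, symmetric] by (rule has_fps_expansion_inverse[OF 1])
  from fps_nth_fps_expansion[OF this, of m] show ?thesis by simp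
qed

lemma line_coeff_mult:
  assumes "d \<ge> 1"
  shows "line_coeff d c s (d * n) = (\<Sum>k\<le>n. (- c) ^ k * of_nat (d * (n - k) + k choose k) * s ^ (d * (n - k)))"
proof -
  have "{k. d * k \<le> d * n} = {..n}" using assms by auto
  then show ?thesis by (simp add: line_coeff_def diff_mult_distrib2)
qed

section \<open>The one-variable denominator and its residues\<close>

definition line_poly :: "nat \<Rightarrow> complex \<Rightarrow> complex \<Rightarrow> complex \<Rightarrow> complex" where
  "line_poly d c s x = 1 - s * x + c * x ^ d"

lemma line_poly_0 [simp]: "d \<ge> 1 \<Longrightarrow> line_poly d c s 0 = 1"
  by (simp add: line_poly_def)

lemma finite_line_poly_roots: "d \<ge> 1 \<Longrightarrow> finite {x. line_poly d c s x = 0}"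
proof -
  assume d: "d \<ge> 1"
  define p where "p = 1 - monom s 1 + monom c d"
  have p: "poly p x = line_poly d c s x" for x
    by (simp add: p_def poly_monom line_poly_def)
  have "p \<noteq> 0" using p[of 0] d by auto
  then show ?thesis using poly_roots_finite[of p] by (simp add: p)
qed

lemma line_poly_deriv:
  "(line_poly d c s has_field_derivative (- s + of_nat d * c * x ^ (d - 1))) (at x within A)"
  unfolding line_poly_def by (auto intro!: derivative_eq_intros)

text \<open>The root equation \<open>c * x ^ d = s * x - 1\<close> eliminates \<open>c\<close>, so
  the residue at a simple root depends on \<open>s\<close> and \<open>x\<close> only.\<close>

lemma line_poly_root_deriv:
  assumes "line_poly d c s x = 0" "d \<ge> 1"
  shows "x * (- s + of_nat d * c * x ^ (d - 1)) = (of_nat d - 1) * s * x - of_nat d"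
proof -
  have "x * x ^ (d - 1) = x ^ d" using assms(2) by (simp add: power_eq_if)
  then have "x * (- s + of_nat d * c * x ^ (d - 1)) = - s * x + of_nat d * (c * x ^ d)"
    by (simp add: algebra_simps)
  also have "c * x ^ d = s * x - 1" using assms(1) by (simp add: line_poly_def algebra_simps)
  finally show ?thesis by (simp add: algebra_simps)
qed

text \<open>Residue theorem for \<open>1 / (x ^ Suc m * P x)\<close> on the circle of radius
  \<open>r\<close>: the pole at 0 yields the coefficient, the simple roots in \<open>Z\<close> yield
  the sum, and the integral itself is the error. The error bound depends on \<open>s\<close> only
  through \<open>\<mu>\<close> and \<open>r\<close>, so it is uniform wherever these can be chosen
  uniformly.\<close>

lemma line_coeff_residue_estimate:
  assumes d: "d \<ge> 1" and r: "r > 0" and \<mu>: "\<mu> > 0"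
    and Z: "\<And>x. cmod x < r \<Longrightarrow> line_poly d c s x = 0 \<longleftrightarrow> x \<in> Z"
    and Zr: "\<And>x. x \<in> Z \<Longrightarrow> cmod x < r"
    and simple: "\<And>x. x \<in> Z \<Longrightarrow> (of_nat d - 1) * s * x \<noteq> of_nat d"
    and lower: "\<And>x. cmod x = r \<Longrightarrow> cmod (line_poly d c s x) \<ge> \<mu>"
  shows "cmod (line_coeff d c s m - (\<Sum>x\<in>Z. 1 / (x ^ m * (of_nat d - (of_nat d - 1) * s * x)))) \<le> 1 / (\<mu> * r ^ m)"
proof -
  define P where "P = line_poly d c s"
  define R where "R = {x. P x = 0}"
  define f where "f x = 1 / (x ^ Suc m * P x)" for x
  have finR: "finite R" unfolding R_def P_def by (rule finite_line_poly_roots[OF d])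
  have ZR: "Z \<subseteq> R" using Z Zr by (auto simp: R_def P_def)
  have P0: "P 0 = 1" using d by (simp add: P_def)
  have holP: "P holomorphic_on A" for A
    unfolding P_def line_poly_def by (intro holomorphic_intros)
  have nz: "P x \<noteq> 0" if "cmod x = r" for x using lower[OF that] \<mu> by (auto simp: P_def)
  have holf: "f holomorphic_on UNIV - insert 0 R"
    unfolding f_def by (intro holomorphic_intros holP) (auto simp: R_def)
  have sub: "path_image (circlepath 0 r) \<subseteq> UNIV - insert 0 R"
    using r nz by (auto simp: R_def sphere_def path_image_circlepath)
  have "contour_integral (circlepath 0 r) f
      = 2 * pi * \<i> * (\<Sum>p\<in>insert 0 R. winding_number (circlepath 0 r) p * residue f p)"
    by (rule Residue_theorem[of UNIV]) (use finR holf sub in auto)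
  also have "(\<Sum>p\<in>insert 0 R. winding_number (circlepath 0 r) p * residue f p)
      = (\<Sum>p\<in>insert 0 Z. residue f p)"
  proof (rule sum.mono_neutral_cong_right)
    show "\<forall>p\<in>insert 0 R - insert 0 Z. winding_number (circlepath 0 r) p * residue f p = 0"
    proof
      fix p assume p: "p \<in> insert 0 R - insert 0 Z"
      then have "P p = 0" "p \<notin> Z" by (auto simp: R_def)
      then have "\<not> cmod p < r" using Z[of p] by (auto simp: P_def)
      moreover have "cmod p \<noteq> r" using nz \<open>P p = 0\<close> by auto
      ultimately have "winding_number (circlepath 0 r) p = 0"
        by (intro winding_number_zero_outside[where s = "cball 0 r"])
          (use r in \<open>auto simp: sphere_def path_image_circlepath\<close>)
      then show "winding_number (circlepath 0 r) p * residue f p = 0" by simp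
    qed
    show "winding_number (circlepath 0 r) p * residue f p = residue f p" if "p \<in> insert 0 Z" for p
      using that Zr r by (subst winding_number_circlepath) auto
  qed (use finR ZR in auto)
  also have "\<dots> = residue f 0 + (\<Sum>p\<in>Z. residue f p)"
    using ZR finR P0 by (subst sum.insert) (auto simp: R_def intro: finite_subset)
  also have "residue f 0 = line_coeff d c s m"
  proof -
    have "residue f 0 = residue (\<lambda>x. inverse (P x) / (x - 0) ^ Suc m) 0"
      unfolding f_def by (rule arg_cong2[where f = residue]) (auto simp: field_simps)
    also have "\<dots> = (deriv ^^ m) (\<lambda>x. inverse (P x)) 0 / fact m"
      by (rule residue_holomorphic_over_power[of "UNIV - R"])
        (use finR P0 in \<open>auto intro!: holomorphic_intros holP finite_imp_closed open_Diff simp: R_def\<close>)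
    also have "\<dots> = line_coeff d c s m"
      unfolding P_def line_poly_def by (rule line_coeff_eq_deriv[OF d])
    finally show ?thesis .
  qed
  also have "(\<Sum>p\<in>Z. residue f p) = - (\<Sum>x\<in>Z. 1 / (x ^ m * (of_nat d - (of_nat d - 1) * s * x)))"
    unfolding sum_negf[symmetric]
  proof (rule sum.cong[OF refl])
    fix x assume x: "x \<in> Z"
    have Px: "P x = 0" using x ZR by (auto simp: R_def)
    then have x0: "x \<noteq> 0" using P0 by auto
    define D where "D = - s + of_nat d * c * x ^ (d - 1)"
    have xD: "x * D = (of_nat d - 1) * s * x - of_nat d"
      unfolding D_def using Px by (intro line_poly_root_deriv d) (simp add: P_def)
    have derP: "(P has_field_derivative D) (at x)"
      unfolding P_def D_def by (rule line_poly_deriv)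
    have "D \<noteq> 0" using xD simple[OF x] by auto
    have "residue (\<lambda>w. (1 / w ^ Suc m) / P w) x = (1 / x ^ Suc m) / D"
      by (rule residue_simple_pole_deriv[of _ "UNIV - {0}"])
        (use x0 Px derP \<open>D \<noteq> 0\<close> holP in \<open>auto intro!: holomorphic_intros connected_open_delete connected_UNIV\<close>)
    moreover have "f = (\<lambda>w. (1 / w ^ Suc m) / P w)" by (auto simp: f_def)
    ultimately have "residue f x = 1 / (x ^ m * (x * D))" by (simp add: mult_ac)
    also have "\<dots> = - (1 / (x ^ m * (of_nat d - (of_nat d - 1) * s * x)))"
      unfolding xD by (simp add: minus_divide_right algebra_simps)
    finally show "residue f x = - (1 / (x ^ m * (of_nat d - (of_nat d - 1) * s * x)))" .
  qed
  finally have int: "contour_integral (circlepath 0 r) f = 2 * pi * \<i> *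
     (line_coeff d c s m - (\<Sum>x\<in>Z. 1 / (x ^ m * (of_nat d - (of_nat d - 1) * s * x))))" by simp
  have "f contour_integrable_on circlepath 0 r"
    using finR by (intro contour_integrable_holomorphic_simple[OF holf _ _ sub])
      (auto intro!: open_Diff finite_imp_closed)
  then have "(f has_contour_integral contour_integral (circlepath 0 r) f) (circlepath 0 r)"
    by (rule has_contour_integral_integral)
  then have "cmod (contour_integral (circlepath 0 r) f) \<le> 1 / (\<mu> * r ^ Suc m) * (2 * pi * r)"
  proof (rule has_contour_integral_bound_circlepath)
    fix x assume x: "cmod (x - 0) = r"
    have "cmod (f x) = 1 / (r ^ Suc m * cmod (P x))" using x by (simp add: f_def norm_divide norm_mult norm_power)
    also have "\<dots> \<le> 1 / (r ^ Suc m * \<mu>)"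
      using lower[of x] x r \<mu> by (intro divide_left_mono mult_left_mono mult_pos_pos) (auto simp: P_def)
    finally show "cmod (f x) \<le> 1 / (\<mu> * r ^ Suc m)" by (simp add: mult.commute)
  qed (use r \<mu> in auto)
  also have "\<dots> = 2 * pi * (1 / (\<mu> * r ^ m))" using r by simp
  finally have "2 * pi * cmod (line_coeff d c s m - (\<Sum>x\<in>Z. 1 / (x ^ m * (of_nat d - (of_nat d - 1) * s * x))))
      \<le> 2 * pi * (1 / (\<mu> * r ^ m))"
    unfolding int by (simp add: norm_mult)
  then show ?thesis by (subst (asm) mult_le_cancel_left_pos) auto
qed

section \<open>Laplace transforms of Beta laws\<close>

definition laplace :: "real measure \<Rightarrow> complex \<Rightarrow> complex" where
  "laplace M \<zeta> = (LINT y|M. exp (- \<zeta> * of_real y))"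

definition nonneg_law :: "real measure \<Rightarrow> bool" where
  "nonneg_law M \<longleftrightarrow> prob_space M \<and> sets M = sets borel \<and> (AE y in M. y \<ge> 0)"

lemma nonneg_law_integrable:
  assumes "nonneg_law M" "f \<in> borel_measurable borel" "\<And>y. y \<ge> 0 \<Longrightarrow> norm (f y) \<le> B"
  shows "integrable M (f :: real \<Rightarrow> 'b :: {banach, second_countable_topology})"
proof -
  interpret prob_space M using assms(1) by (simp add: nonneg_law_def)
  show ?thesis
  proof (rule integrable_const_bound)
    have "AE y in M. y \<ge> 0" using assms(1) by (simp add: nonneg_law_def)
    then show "AE y in M. norm (f y) \<le> B" by (rule eventually_mono) (rule assms(3))
    show "f \<in> borel_measurable M"
      using assms(1,2) by (simp add: nonneg_law_def cong: measurable_cong_sets)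
  qed
qed

lemma laplace_integrable:
  assumes "nonneg_law M" "Re \<zeta> \<ge> 0"
  shows "integrable M (\<lambda>y. exp (- \<zeta> * of_real y))"
  by (rule nonneg_law_integrable[OF assms(1), of _ 1]) (use assms(2) in auto)

lemma norm_integral_le_AE:
  fixes f :: "'a \<Rightarrow> 'b :: {banach, second_countable_topology}"
  assumes "integrable M f" "integrable M g" "AE x in M. norm (f x) \<le> g x"
  shows "norm (integral\<^sup>L M f) \<le> integral\<^sup>L M g"
proof -
  have "norm (integral\<^sup>L M f) \<le> (LINT x|M. norm (f x))" by (rule integral_norm_bound)
  also have "\<dots> \<le> integral\<^sup>L M g" using assms by (intro integral_mono_AE) auto
  finally show ?thesis .
qed

text \<open>Mean value inequality on the convex half-plane \<open>Re z \<le> m\<close>, where the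
  derivative of \<open>exp\<close> has modulus at most \<open>exp m\<close>.\<close>

lemma exp_diff_bound:
  assumes "Re u \<le> m" "Re v \<le> m"
  shows "cmod (exp u - exp v) \<le> exp m * cmod (u - v)"
proof -
  have "convex {z. Re z \<le> m}" by (rule convex_halfspace_Re_le)
  moreover have "(exp has_field_derivative exp z) (at z within {z. Re z \<le> m})" for z :: complex
    by (auto intro!: derivative_eq_intros)
  ultimately show ?thesis
    using field_differentiable_bound[of "{z. Re z \<le> m}" exp exp "exp m" u v] assms by auto
qed

text \<open>\<open>M\<close> is the law of \<open>- ln V\<close> with \<open>V\<close> of Beta type
  \<open>(a, 1 - a)\<close>, so \<open>laplace M \<zeta>\<close> is the mean of
  \<open>V powr \<zeta>\<close>. The equation is the one satisfied by
  \<open>Gamma (\<zeta> + a) / (Gamma a * Gamma (\<zeta> + 1))\<close>; it is obtained by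
  integration by parts.\<close>

lemma beta_law_exists:
  fixes a :: real
  assumes a: "0 < a" "a < 1"
  obtains M where "nonneg_law M"
    "\<And>\<zeta>. Re \<zeta> \<ge> 0 \<Longrightarrow> (\<zeta> + 1) * laplace M (\<zeta> + 1) = (\<zeta> + of_real a) * laplace M \<zeta>"
proof -
  define B where "B = Beta a (1 - a)"
  define w where "w v = indicator {0<..<1} v * (v powr (a - 1) * (1 - v) powr (- a)) / B" for v :: real
  have B: "B > 0" using a by (simp add: B_def Beta_def Gamma_real_pos)
  have w_nonneg: "w v \<ge> 0" for v using B by (simp add: w_def)
  have w_meas [measurable]: "w \<in> borel_measurable borel" unfolding w_def by measurable
  have "((\<lambda>v. v powr (a - 1) * (1 - v) powr (- a)) has_integral B) {0..1}"
    using has_integral_Beta_real[of a "1 - a"] a by (simp add: B_def)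
  then have "((\<lambda>v. v powr (a - 1) * (1 - v) powr (- a)) has_integral B) {0<..<1}"
    by (simp add: has_integral_Icc_iff_Ioo)
  then have "((\<lambda>v. v powr (a - 1) * (1 - v) powr (- a) / B) has_integral B / B) {0<..<1}"
    by (rule has_integral_divide)
  then have "((\<lambda>v. if v \<in> {0<..<1} then v powr (a - 1) * (1 - v) powr (- a) / B else 0) has_integral 1) UNIV"
    using B by (subst has_integral_restrict_UNIV) simp
  moreover have "(\<lambda>v. if v \<in> {0<..<1} then v powr (a - 1) * (1 - v) powr (- a) / B else 0) = w"
    by (auto simp: w_def fun_eq_iff)
  ultimately have w_int: "(w has_integral 1) UNIV" by simp
  have nn1: "(\<integral>\<^sup>+ v. ennreal (w v) \<partial>lborel) = 1"
    using nn_integral_has_integral_lborel[OF w_meas w_nonneg w_int] by simp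
  then have w_integrable: "integrable lborel w"
    by (intro integrableI_nonneg) (auto simp: w_nonneg)
  define N where "N = density lborel (\<lambda>v. ennreal (w v))"
  have N_space: "prob_space N"
    by (rule prob_spaceI) (simp add: N_def emeasure_density nn1)
  interpret N: prob_space N by (rule N_space)
  have sets_N [measurable_cong]: "sets N = sets borel" by (simp add: N_def)
  define M where "M = distr N borel (\<lambda>v. - ln v)"
  have pM: "prob_space M" unfolding M_def by (rule N.prob_space_distr) measurable
  have "AE y in M. y \<ge> 0"
  proof -
    have "AE v in N. - ln v \<ge> 0"
      unfolding N_def by (subst AE_density) (auto simp: w_def indicator_def)
    then show ?thesis unfolding M_def by (subst AE_distr_iff) auto
  qed
  moreover have "sets M = sets borel" by (simp add: M_def)
  ultimately have law: "nonneg_law M" using pM unfolding nonneg_law_def by blast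
  define e where "e \<zeta> v = of_real (w v) * of_real v powr \<zeta>" for \<zeta> :: complex and v :: real
  have e_eq: "of_real (w v) * exp (\<zeta> * of_real (ln v)) = e \<zeta> v" for \<zeta> v
    by (auto simp: e_def w_def powr_def Ln_of_real indicator_def)
  have lap: "laplace M \<zeta> = (LINT v|lborel. e \<zeta> v)" for \<zeta>
  proof -
    have "laplace M \<zeta> = (LINT v|N. exp (\<zeta> * of_real (ln v)))"
      unfolding laplace_def M_def by (subst integral_distr) auto
    also have "\<dots> = (LINT v|lborel. w v *\<^sub>R exp (\<zeta> * of_real (ln v)))"
      unfolding N_def by (subst integral_density) (auto simp: w_nonneg)
    also have "\<dots> = (LINT v|lborel. e \<zeta> v)"
      by (rule Bochner_Integration.integral_cong) (auto simp: scaleR_conv_of_real e_eq)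
    finally show ?thesis .
  qed
  have e_int: "integrable lborel (e \<zeta>)" if "Re \<zeta> \<ge> 0" for \<zeta>
  proof (rule Bochner_Integration.integrable_bound[OF w_integrable])
    have "(\<lambda>v. of_real (w v) * exp (\<zeta> * of_real (ln v))) \<in> borel_measurable lborel" by measurable
    then show "e \<zeta> \<in> borel_measurable lborel" by (simp add: e_eq)
    show "AE v in lborel. norm (e \<zeta> v) \<le> norm (w v)"
    proof (rule AE_I2)
      fix v :: real
      show "norm (e \<zeta> v) \<le> norm (w v)"
      proof (cases "v \<in> {0<..<1}")
        case True
        then have "norm (exp (\<zeta> * of_real (ln v))) \<le> 1"
          using that by (auto simp: mult_nonneg_nonpos)
        then show ?thesis using w_nonneg[of v]
          by (subst e_eq[symmetric]) (simp add: norm_mult mult_left_le del: norm_exp_eq_Re)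
      qed (auto simp: e_def w_def)
    qed
  qed
  have "(\<zeta> + 1) * laplace M (\<zeta> + 1) = (\<zeta> + of_real a) * laplace M \<zeta>" if \<zeta>: "Re \<zeta> \<ge> 0" for \<zeta>
  proof -
    define h where "h v = (\<zeta> + of_real a) * e \<zeta> v - (\<zeta> + 1) * e (\<zeta> + 1) v" for v
    have int_h: "integrable lborel h"
      unfolding h_def using \<zeta> by (intro Bochner_Integration.integrable_diff integrable_mult_right e_int) auto
    have "(h has_integral (LINT v|lborel. h v)) UNIV"
      by (rule has_integral_integral_lborel[OF int_h])
    moreover have "(h has_integral 0) UNIV"
    proof -
      \<comment> \<open>A primitive of \<open>h\<close> that vanishes at both ends of the unit
        interval, thanks to \<open>a > 0\<close> at 0 and \<open>a < 1\<close> at 1.\<close>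
      define G where "G v = of_real v powr (\<zeta> + of_real a) * of_real ((1 - v) powr (1 - a)) / of_real B" for v :: real
      have powr_deriv: "((\<lambda>v::real. (of_real v :: complex) powr (\<zeta> + of_real a)) has_vector_derivative
              (\<zeta> + of_real a) * of_real v powr (\<zeta> + of_real a - 1)) (at v)" if v: "v > 0" for v
      proof -
        have "((\<lambda>z. z powr (\<zeta> + of_real a)) has_field_derivative
           (\<zeta> + of_real a) * of_real v powr (\<zeta> + of_real a - 1)) (at (of_real v))"
          using v by (intro has_field_derivative_powr) (auto simp: complex_nonpos_Reals_iff)
        from has_vector_derivative_real_field[OF this] show ?thesis .
      qed
      have "(h has_integral (G 1 - G 0)) {0..1}"
      proof (rule fundamental_theorem_of_calculus_interior)
        \<comment> \<open>At \<open>v = 0\<close> the power is only known to be continuous, by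
          \<open>Re (\<zeta> + a) > 0\<close>; hence the form of the fundamental theorem with
          derivatives in the open interval.\<close>
        have cw: "continuous (at v within {0..1}) (\<lambda>v::real. (of_real v :: complex) powr (\<zeta> + of_real a))" if v: "v \<in> {0..1}" for v
        proof (cases "v = 0")
          case True
          have "((\<lambda>v::real. of_real v powr (\<zeta> + of_real a)) \<longlongrightarrow> 0) (at 0 within {0..1})"
            by (rule tendsto_powr_complex_0) (use \<zeta> a in \<open>auto intro!: tendsto_eq_intros\<close>)
          then show ?thesis using True by (simp add: continuous_within)
        next
          case False
          then have "v > 0" using v by auto
          show ?thesis
            by (rule continuous_at_imp_continuous_at_within, rule has_vector_derivative_continuous[OF powr_deriv[OF \<open>v > 0\<close>]])
        qed
        have c1: "continuous_on {0..1} (\<lambda>v::real. (of_real v :: complex) powr (\<zeta> + of_real a))"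
          unfolding continuous_on_eq_continuous_within by (rule ballI) (rule cw)
        have c2: "continuous_on {0..1} (\<lambda>v. (1 - v) powr (1 - a))"
          by (rule continuous_on_powr') (use a in \<open>auto intro!: continuous_intros\<close>)
        show "continuous_on {0..1} G"
          unfolding G_def
          by (rule continuous_on_divide[OF continuous_on_mult[OF c1 continuous_on_of_real[OF c2]] continuous_on_const])
            (use B in simp)
        fix v :: real assume v: "v \<in> {0<..<1}"
        have "v > 0" using v by simp
        note 1 = powr_deriv[OF this]
        have "((\<lambda>v. (1 - v) powr (1 - a)) has_real_derivative - (1 - a) * (1 - v) powr (- a)) (at v)"
        proof -
          have "((\<lambda>v. 1 - v) has_real_derivative - 1) (at v)" by (auto intro!: derivative_eq_intros)
          then show ?thesis
            using v by (intro DERIV_cong[OF DERIV_fun_powr]) (auto simp: algebra_simps)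
        qed
        then have 2: "((\<lambda>v. of_real ((1 - v) powr (1 - a)) :: complex) has_vector_derivative
            of_real (- (1 - a) * (1 - v) powr (- a))) (at v)"
          by (intro has_vector_derivative_of_real) (simp add: has_real_derivative_iff_has_vector_derivative)
        define V :: complex where "V = of_real v powr \<zeta>"
        define W where "W = v powr (a - 1) * (1 - v) powr (- a)"
        have v0: "(of_real v :: complex) \<noteq> 0" using v by auto
        have p1: "of_real v powr (\<zeta> + of_real a) = V * of_real (v powr (a - 1)) * of_real v"
          using v v0 by (simp add: V_def powr_add powr_of_real[symmetric] powr_diff)
        have p2: "of_real v powr (\<zeta> + of_real a - 1) = V * of_real (v powr (a - 1))"
          using v v0 p1 by (simp add: powr_diff)
        have p3: "(1 - v) powr (1 - a) = (1 - v) powr (- a) * (1 - v)"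
          using v by (simp add: powr_diff powr_minus field_simps)
        have "(G has_vector_derivative
           ((\<zeta> + of_real a) * of_real v powr (\<zeta> + of_real a - 1) * of_real ((1 - v) powr (1 - a))
           + of_real v powr (\<zeta> + of_real a) * of_real (- (1 - a) * (1 - v) powr (- a))) / of_real B) (at v)"
          unfolding G_def
          by (rule has_vector_derivative_divide, rule has_vector_derivative_eq_rhs[OF has_vector_derivative_mult[OF 1 2]])
            (simp add: algebra_simps)
        also have "((\<zeta> + of_real a) * of_real v powr (\<zeta> + of_real a - 1) * of_real ((1 - v) powr (1 - a))
           + of_real v powr (\<zeta> + of_real a) * of_real (- (1 - a) * (1 - v) powr (- a))) / of_real B = h v"
        proof -
          have "h v = of_real (w v) * V * ((\<zeta> + of_real a) - (\<zeta> + 1) * of_real v)"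
            using v v0 by (simp add: h_def e_def V_def powr_add algebra_simps)
          moreover have "w v = W / B" using v by (simp add: w_def W_def)
          ultimately have hv: "h v = of_real W * V * ((\<zeta> + of_real a) - (\<zeta> + 1) * of_real v) / of_real B" by simp
          show ?thesis unfolding hv p1 p2 p3 W_def
            by (rule arg_cong[where f = "\<lambda>z. z / of_real B"]) (simp add: algebra_simps)
        qed
        finally show "(G has_vector_derivative h v) (at v)" .
      qed auto
      moreover have "G 1 = 0" "G 0 = 0" using a by (auto simp: G_def)
      ultimately have "(h has_integral 0) {0..1}" by simp
      moreover have "h v = 0" if "v \<notin> {0..1}" for v
        using that by (auto simp: h_def e_def w_def)
      then have "(\<lambda>v. if v \<in> {0..1} then h v else 0) = h" by auto
      ultimately show ?thesis using has_integral_restrict_UNIV[of "{0..1}" h 0] by simp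
    qed
    ultimately have "(LINT v|lborel. h v) = 0" by (rule has_integral_unique)
    moreover have "(LINT v|lborel. h v) = (\<zeta> + of_real a) * laplace M \<zeta> - (\<zeta> + 1) * laplace M (\<zeta> + 1)"
      unfolding h_def lap using \<zeta> by (subst Bochner_Integration.integral_diff) (auto intro!: e_int integrable_mult_right)
    ultimately show ?thesis by simp
  qed
  with law show ?thesis by (rule that)
qed

section \<open>Asymptotics of the Laplace transforms in the right half-plane\<close>

lemma second_order_bound:
  assumes f: "f holomorphic_on S" "open S" "z0 \<in> S"
  obtains C \<eta> where "C \<ge> 0" "\<eta> > 0" "cball z0 \<eta> \<subseteq> S"
    "\<And>z. z \<in> cball z0 \<eta> \<Longrightarrow> cmod (f z - f z0 - deriv f z0 * (z - z0)) \<le> C * cmod (z - z0) ^ 2"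
proof -
  obtain \<eta> where \<eta>: "\<eta> > 0" "cball z0 \<eta> \<subseteq> S" using f(2,3) open_contains_cball by blast
  define F where "F i = (deriv ^^ i) f" for i
  have hol: "F i holomorphic_on S" for i
    unfolding F_def using f by (rule_tac holomorphic_higher_deriv) auto
  have "compact (F 2 ` cball z0 \<eta>)"
    by (intro compact_continuous_image holomorphic_on_imp_continuous_on holomorphic_on_subset[OF hol] \<eta>) auto
  then have "bounded (F 2 ` cball z0 \<eta>)" by (rule compact_imp_bounded)
  then obtain C where C: "\<And>z. z \<in> cball z0 \<eta> \<Longrightarrow> cmod (F 2 z) \<le> C"
    unfolding bounded_iff by blast
  have "0 \<le> C" using C[of z0] \<eta>(1) norm_ge_zero[of "F 2 z0"] by (simp add: order_trans del: norm_ge_zero)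
  show ?thesis
  proof (rule that[OF \<open>0 \<le> C\<close> \<eta>])
    fix z assume z: "z \<in> cball z0 \<eta>"
    have "cmod (F 0 z - (\<Sum>i\<le>1. F i z0 * (z - z0) ^ i / fact i)) \<le> C * cmod (z - z0) ^ Suc 1 / fact 1"
    proof (rule complex_Taylor[OF convex_cball[of z0 \<eta>]])
      fix i x assume x: "x \<in> cball z0 \<eta>"
      have "(F i has_field_derivative deriv (F i) x) (at x)"
        using hol x \<eta>(2) f(2) by (meson holomorphic_derivI subsetD)
      then show "(F i has_field_derivative F (Suc i) x) (at x within cball z0 \<eta>)"
        by (simp add: F_def has_field_derivative_at_within)
    next
      show "cmod (F (Suc 1) x) \<le> C" if "x \<in> cball z0 \<eta>" for x
        using C[OF that] by (simp add: numeral_2_eq_2)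
    qed (use z \<eta> in auto)
    then show "cmod (f z - f z0 - deriv f z0 * (z - z0)) \<le> C * cmod (z - z0) ^ 2"
      by (simp add: F_def numeral_2_eq_2 algebra_simps)
  qed
qed

text \<open>The bound holds uniformly in all directions of the open right half-plane, because the
  transform is evaluated at nonreal multiples of \<open>n\<close>. Written with the power multiplied
  in, the relation is stable under products of transforms.\<close>

definition laplace_asymp :: "(complex \<Rightarrow> complex) \<Rightarrow> real \<Rightarrow> real \<Rightarrow> bool" where
  "laplace_asymp L \<beta> K \<longleftrightarrow> (\<exists>C R. \<forall>\<zeta>. Re \<zeta> > 0 \<longrightarrow> cmod \<zeta> \<ge> R \<longrightarrow>
      cmod (L \<zeta> * \<zeta> powr of_real \<beta> - of_real K) \<le> C / cmod \<zeta>)"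

lemma laplace_asymp_mult:
  assumes "laplace_asymp L1 \<beta>1 K1" "laplace_asymp L2 \<beta>2 K2"
    and L: "\<And>\<zeta>. Re \<zeta> > 0 \<Longrightarrow> L \<zeta> = L1 \<zeta> * L2 \<zeta>"
  shows "laplace_asymp L (\<beta>1 + \<beta>2) (K1 * K2)"
proof -
  obtain C1 R1 where 1: "\<And>\<zeta>. Re \<zeta> > 0 \<Longrightarrow> cmod \<zeta> \<ge> R1 \<Longrightarrow>
      cmod (L1 \<zeta> * \<zeta> powr of_real \<beta>1 - of_real K1) \<le> C1 / cmod \<zeta>"
    using assms(1) unfolding laplace_asymp_def by blast
  obtain C2 R2 where 2: "\<And>\<zeta>. Re \<zeta> > 0 \<Longrightarrow> cmod \<zeta> \<ge> R2 \<Longrightarrow>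
      cmod (L2 \<zeta> * \<zeta> powr of_real \<beta>2 - of_real K2) \<le> C2 / cmod \<zeta>"
    using assms(2) unfolding laplace_asymp_def by blast
  define R where "R = max 1 (max R1 R2)"
  define C where "C = \<bar>C1\<bar> * (\<bar>K2\<bar> + \<bar>C2\<bar>) + \<bar>K1\<bar> * \<bar>C2\<bar>"
  show ?thesis unfolding laplace_asymp_def
  proof (rule exI[of _ C], rule exI[of _ R], intro allI impI)
    fix \<zeta> :: complex assume \<zeta>: "Re \<zeta> > 0" "R \<le> cmod \<zeta>"
    define n where "n = cmod \<zeta>"
    have n: "n \<ge> 1" "n \<ge> R1" "n \<ge> R2" using \<zeta>(2) by (auto simp: R_def n_def)
    define u where "u = L1 \<zeta> * \<zeta> powr of_real \<beta>1 - of_real K1"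
    define v where "v = L2 \<zeta> * \<zeta> powr of_real \<beta>2 - of_real K2"
    have u: "cmod u \<le> \<bar>C1\<bar> / n" and v: "cmod v \<le> \<bar>C2\<bar> / n"
      using 1[OF \<zeta>(1)] 2[OF \<zeta>(1)] n unfolding u_def v_def n_def
      by (auto intro: order_trans simp: divide_right_mono)
    have v': "cmod v \<le> \<bar>C2\<bar>"
    proof -
      have "\<bar>C2\<bar> / n \<le> \<bar>C2\<bar> / 1" using n by (intro divide_left_mono) auto
      then show ?thesis using v by simp
    qed
    have "L \<zeta> * \<zeta> powr of_real (\<beta>1 + \<beta>2) - of_real (K1 * K2) = u * (of_real K2 + v) + of_real K1 * v"
      using L[OF \<zeta>(1)] by (simp add: u_def v_def powr_add algebra_simps)
    also have "cmod \<dots> \<le> cmod u * (\<bar>K2\<bar> + cmod v) + \<bar>K1\<bar> * cmod v"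
      by (rule norm_triangle_le) (auto simp: norm_mult intro!: add_mono mult_left_mono norm_triangle_le)
    also have "\<dots> \<le> \<bar>C1\<bar> / n * (\<bar>K2\<bar> + \<bar>C2\<bar>) + \<bar>K1\<bar> * (\<bar>C2\<bar> / n)"
      using n by (intro add_mono mult_mono mult_left_mono u v v') auto
    also have "\<dots> = C / n" by (simp add: C_def add_divide_distrib)
    finally show "cmod (L \<zeta> * \<zeta> powr of_real (\<beta>1 + \<beta>2) - of_real (K1 * K2)) \<le> C / cmod \<zeta>"
      by (simp add: n_def)
  qed
qed

text \<open>Both arguments are below \<open>pi / 2\<close> in modulus, so their sum stays within the
  principal branch.\<close>

lemma Ln_add_right_half_plane:
  assumes "Re u > 0" "Re v > 0"
  shows "Ln (u * v) = Ln u + Ln v"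
proof -
  have "u \<noteq> 0" "v \<noteq> 0" using assms by auto
  moreover have "\<bar>Im (Ln u)\<bar> < pi / 2" "\<bar>Im (Ln v)\<bar> < pi / 2"
    using assms Re_Ln_pos_lt_imp[of u] Re_Ln_pos_lt[of u] Re_Ln_pos_lt[of v] by (auto simp: calculation)
  ultimately show ?thesis by (subst Ln_times) auto
qed

lemma powr_mult_right_half_plane:
  fixes u v :: complex
  assumes "Re u > 0" "Re v > 0"
  shows "(u * v) powr s = u powr s * v powr s"
  using assms by (auto simp: powr_def Ln_add_right_half_plane exp_add[symmetric] algebra_simps)

text \<open>The normalised transform \<open>r(\<zeta>) = L(\<zeta>) \<zeta>\<^sup>1\<^sup>-\<^sup>a\<close> satisfies \<open>r(\<zeta> + 1) = r(\<zeta>) (1 + O(|\<zeta>|\<^sup>-\<^sup>2))\<close>;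
  telescoping along \<open>\<zeta> + k\<close> reduces the asymptotics to the limit \<open>k \<rightarrow> \<infinity>\<close>, where Gauss' formula applies.\<close>

lemma laplace_asymp_beta:
  fixes a :: real
  assumes a: "0 < a" "a < 1" and M: "nonneg_law M"
    and FE: "\<And>\<zeta>. Re \<zeta> \<ge> 0 \<Longrightarrow> (\<zeta> + 1) * laplace M (\<zeta> + 1) = (\<zeta> + of_real a) * laplace M \<zeta>"
  shows "laplace M (of_nat k) = of_real (pochhammer a k / fact k)"
    and "laplace_asymp (laplace M) (1 - a) (1 / Gamma a)"
proof -
  interpret prob_space M using M by (simp add: nonneg_law_def)
  define L where "L = laplace M"
  have FE': "L (\<zeta> + 1) = (\<zeta> + of_real a) / (\<zeta> + 1) * L \<zeta>" if "Re \<zeta> \<ge> 0" for \<zeta>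
  proof -
    have "\<zeta> + 1 \<noteq> 0" using that by (auto simp: complex_eq_iff)
    then show ?thesis using FE[OF that] by (simp add: L_def field_simps)
  qed
  define pr where "pr k = pochhammer a k / fact k" for k
  have pr: "L (of_nat k) = of_real (pr k)" for k
  proof (induction k)
    case 0
    have "L 0 = 1" by (simp add: L_def laplace_def prob_space)
    then show ?case by (simp add: pr_def)
  next
    case (Suc k)
    have "L (of_nat k + 1) = (of_nat k + of_real a) / (of_nat k + 1) * L (of_nat k)"
      by (rule FE') simp
    then show ?case using Suc by (simp add: pr_def pochhammer_Suc field_simps add.commute)
  qed
  then show "laplace M (of_nat k) = of_real (pochhammer a k / fact k)" for k
    by (simp add: L_def pr_def)
  have pr_pos: "pr k > 0" for k using a by (simp add: pr_def pochhammer_pos)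
  have pr_Suc: "pr (Suc k) = (of_nat k + a) / (of_nat k + 1) * pr k" for k
    by (simp add: pr_def pochhammer_Suc field_simps)
  \<comment> \<open>The transform at a complex shift is compared with the real moments:
    \<open>\<bar>exp (- \<zeta> y) - 1\<bar> \<le> \<bar>\<zeta>\<bar> y\<close> in the half-plane,
    and \<open>y \<le> exp y - 1\<close> turns the remaining mean into a difference of consecutive
    moments.\<close>
  have pr_diff: "cmod (L (\<zeta> + of_nat (Suc k)) - of_real (pr (Suc k))) \<le> cmod \<zeta> * (pr k - pr (Suc k))"
    if \<zeta>: "Re \<zeta> \<ge> 0" for \<zeta> k
  proof -
    have reL: "(LINT y|M. exp (- of_nat j * y)) = pr j" for j :: nat
    proof -
      have "complex_of_real (LINT y|M. exp (- of_nat j * y)) = (LINT y|M. of_real (exp (- of_nat j * y)))"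
        by (rule integral_complex_of_real[symmetric])
      also have "\<dots> = L (of_nat j)" by (simp add: L_def laplace_def exp_of_real[symmetric])
      also have "\<dots> = of_real (pr j)" by (rule pr)
      finally show ?thesis by (simp only: of_real_eq_iff)
    qed
    have int: "integrable M (\<lambda>y. exp (- of_nat j * y) :: real)" for j :: nat
      by (rule nonneg_law_integrable[OF M, of _ 1]) auto
    have "L (\<zeta> + of_nat (Suc k)) - L (of_nat (Suc k))
        = (LINT y|M. exp (- (\<zeta> + of_nat (Suc k)) * of_real y) - exp (- of_nat (Suc k) * of_real y))"
      unfolding L_def laplace_def using \<zeta>
      by (intro Bochner_Integration.integral_diff[symmetric] laplace_integrable[OF M]) auto
    also have "cmod \<dots> \<le> (LINT y|M. cmod \<zeta> * (exp (- of_nat k * y) - exp (- of_nat (Suc k) * y)))"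
    proof (rule norm_integral_le_AE)
      show "integrable M (\<lambda>y. exp (- (\<zeta> + of_nat (Suc k)) * of_real y) - exp (- of_nat (Suc k) * complex_of_real y))"
        using \<zeta> by (intro Bochner_Integration.integrable_diff laplace_integrable[OF M]) auto
      show "integrable M (\<lambda>y. cmod \<zeta> * (exp (- of_nat k * y) - exp (- of_nat (Suc k) * y)))"
        by (intro integrable_mult_right Bochner_Integration.integrable_diff int)
      have "AE y in M. y \<ge> 0" using M by (simp add: nonneg_law_def)
      then show "AE y in M. cmod (exp (- (\<zeta> + of_nat (Suc k)) * of_real y) - exp (- of_nat (Suc k) * complex_of_real y))
          \<le> cmod \<zeta> * (exp (- of_nat k * y) - exp (- of_nat (Suc k) * y))"
      proof (rule eventually_mono)
        fix y :: real assume y: "y \<ge> 0"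
        have "cmod (exp (- (\<zeta> + of_nat (Suc k)) * of_real y) - exp (- of_nat (Suc k) * complex_of_real y))
           \<le> exp (- of_nat (Suc k) * y) * cmod (- (\<zeta> + of_nat (Suc k)) * of_real y - - of_nat (Suc k) * complex_of_real y)"
          using y \<zeta> by (intro exp_diff_bound) (auto simp: algebra_simps)
        also have "- (\<zeta> + of_nat (Suc k)) * of_real y - - of_nat (Suc k) * complex_of_real y = - \<zeta> * of_real y"
          by (simp add: algebra_simps)
        also have "exp (- of_nat (Suc k) * y) * cmod (- \<zeta> * of_real y) = cmod \<zeta> * (exp (- of_nat (Suc k) * y) * y)"
          using y by (simp add: norm_mult)
        also have "\<dots> \<le> cmod \<zeta> * (exp (- of_nat (Suc k) * y) * (exp y - 1))"
        proof (intro mult_left_mono)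
          show "y \<le> exp y - 1" using exp_ge_add_one_self[of y] by linarith
        qed auto
        also have "exp (- of_nat (Suc k) * y) * (exp y - 1) = exp (- of_nat k * y) - exp (- of_nat (Suc k) * y)"
          by (simp add: algebra_simps exp_add[symmetric])
        finally show "cmod (exp (- (\<zeta> + of_nat (Suc k)) * of_real y) - exp (- of_nat (Suc k) * complex_of_real y))
           \<le> cmod \<zeta> * (exp (- of_nat k * y) - exp (- of_nat (Suc k) * y))" .
      qed
    qed
    also have "\<dots> = cmod \<zeta> * (pr k - pr (Suc k))"
      by (simp only: integral_mult_right_zero Bochner_Integration.integral_diff[OF int int] reL)
    finally show ?thesis by (simp only: pr)
  qed
  define r where "r \<zeta> = L \<zeta> * \<zeta> powr of_real (1 - a)" for \<zeta>
  define K where "K = 1 / Gamma a"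
  have K: "K > 0" using a by (simp add: K_def Gamma_real_pos)
  have lim: "(\<lambda>k. r (\<zeta> + of_nat k)) \<longlonglongrightarrow> of_real K" if \<zeta>: "Re \<zeta> > 0" for \<zeta>
  proof (rule LIMSEQ_imp_Suc)
    \<comment> \<open>The relative error vanishes because consecutive moments differ only by the
      fraction \<open>(1 - a) / (k + a)\<close>.\<close>
    have "(\<lambda>k. L (\<zeta> + of_nat (Suc k)) / of_real (pr (Suc k)) - 1) \<longlonglongrightarrow> 0"
    proof (rule Lim_null_comparison)
      have "(\<lambda>k. (1 - a) / (of_nat k + a)) \<longlonglongrightarrow> 0" by real_asymp
      then show "(\<lambda>k. cmod \<zeta> * ((1 - a) / (of_nat k + a))) \<longlonglongrightarrow> 0" by (rule tendsto_mult_right_zero)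
      show "\<forall>\<^sub>F k in sequentially. norm (L (\<zeta> + of_nat (Suc k)) / of_real (pr (Suc k)) - 1)
          \<le> cmod \<zeta> * ((1 - a) / (of_nat k + a))"
      proof (rule always_eventually, rule allI)
        fix k
        define m where "m = pr (Suc k)"
        have m: "m > 0" unfolding m_def by (rule pr_pos)
        have "pr k = (of_nat k + 1) / (of_nat k + a) * m"
        proof -
          define A where "A = real k + a"
          define B where "B = real k + 1"
          have "A \<noteq> 0" "B \<noteq> 0" using a by (auto simp: A_def B_def)
          then show ?thesis unfolding m_def pr_Suc A_def[symmetric] B_def[symmetric] by simp
        qed
        then have d: "pr k - m = (1 - a) / (of_nat k + a) * m"
          using a by (simp add: field_simps add_pos_nonneg)
        have "L (\<zeta> + of_nat (Suc k)) / of_real m - 1 = (L (\<zeta> + of_nat (Suc k)) - of_real m) / of_real m"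
          using m by (simp add: diff_divide_distrib)
        then have "norm (L (\<zeta> + of_nat (Suc k)) / of_real m - 1) = cmod (L (\<zeta> + of_nat (Suc k)) - of_real m) / m"
          using m by (simp add: norm_divide)
        also have "\<dots> \<le> cmod \<zeta> * (pr k - m) / m"
          using pr_diff[of \<zeta> k] \<zeta> m unfolding m_def by (intro divide_right_mono) auto
        also have "\<dots> = cmod \<zeta> * ((1 - a) / (of_nat k + a))" unfolding d using m by simp
        finally show "norm (L (\<zeta> + of_nat (Suc k)) / of_real (pr (Suc k)) - 1) \<le> cmod \<zeta> * ((1 - a) / (of_nat k + a))"
          by (simp add: m_def)
      qed
    qed
    then have 1: "(\<lambda>k. L (\<zeta> + of_nat (Suc k)) / of_real (pr (Suc k))) \<longlonglongrightarrow> 1"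
      by (rule LIM_zero_cancel)
    have 2: "(\<lambda>k. pr (Suc k) * of_nat (Suc k) powr (1 - a)) \<longlonglongrightarrow> K"
    proof -
      have "(\<lambda>n. (of_nat (Suc n) / (a + of_nat (Suc n))) / Gamma_series a (Suc n)) \<longlonglongrightarrow> 1 / Gamma a"
      proof (rule tendsto_divide)
        show "(\<lambda>n. of_nat (Suc n) / (a + of_nat (Suc n))) \<longlonglongrightarrow> 1" by real_asymp
        show "(\<lambda>n. Gamma_series a (Suc n)) \<longlonglongrightarrow> Gamma a" by (rule LIMSEQ_Suc[OF Gamma_series_LIMSEQ])
        show "Gamma a \<noteq> 0" using less_imp_neq[OF Gamma_real_pos[OF a(1)]] by (rule not_sym)
      qed
      moreover have "(of_nat (Suc n) / (a + of_nat (Suc n))) / Gamma_series a (Suc n)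
          = pr (Suc n) * of_nat (Suc n) powr (1 - a)" for n
      proof -
        define N where "N = Suc n"
        have N: "real N > 0" by (simp add: N_def)
        have p: "pochhammer a N > 0" using a by (simp add: pochhammer_pos)
        have "Gamma_series a N = fact N * real N powr a / (pochhammer a N * (a + real N))"
          using N by (simp add: Gamma_series_def powr_def pochhammer_Suc)
        moreover have "real N powr (1 - a) = real N / real N powr a" using N by (simp add: powr_diff)
        moreover have "real N powr a > 0" "a + real N > 0" using N a by auto
        moreover have "(x / y) / (f * u / (q * y)) = q / f * (x / u)"
          if "y \<noteq> 0" "f \<noteq> 0" "u \<noteq> 0" "q \<noteq> 0" for x y f u q :: real
          using that by (simp add: field_simps)
        ultimately show ?thesis using p unfolding N_def[symmetric] pr_def by simp
      qed
      ultimately show ?thesis by (simp add: K_def)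
    qed
    have 3: "(\<lambda>k. (1 + \<zeta> / of_nat (Suc k)) powr of_real (1 - a)) \<longlonglongrightarrow> 1 powr of_real (1 - a)"
    proof (rule tendsto_powr_complex)
      have "(\<lambda>k. 1 + \<zeta> / of_nat (Suc k)) \<longlonglongrightarrow> 1 + 0"
        by (intro tendsto_add tendsto_const LIMSEQ_Suc[OF lim_const_over_n])
      then show "(\<lambda>k. 1 + \<zeta> / of_nat (Suc k)) \<longlonglongrightarrow> 1" by simp
    qed (auto simp: complex_nonpos_Reals_iff)
    have "r (\<zeta> + of_nat (Suc k)) = L (\<zeta> + of_nat (Suc k)) / of_real (pr (Suc k))
         * of_real (pr (Suc k) * of_nat (Suc k) powr (1 - a)) * (1 + \<zeta> / of_nat (Suc k)) powr of_real (1 - a)" for k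
    proof -
      define N where "N = Suc k"
      have "\<zeta> + of_nat N = of_real (real N) * (1 + \<zeta> / of_nat N)"
        by (simp add: N_def field_simps del: of_nat_Suc)
      then have "(\<zeta> + of_nat N) powr of_real (1 - a) = of_real (real N) powr of_real (1 - a) * (1 + \<zeta> / of_nat N) powr of_real (1 - a)"
        by (simp only:) (rule powr_times_real_left; simp)
      also have "of_real (real N) powr (of_real (1 - a) :: complex) = of_real (real N powr (1 - a))"
        by (rule powr_of_real) simp
      finally show ?thesis unfolding r_def N_def[symmetric] using pr_pos[of N] by simp
    qed
    then show "(\<lambda>k. r (\<zeta> + of_nat (Suc k))) \<longlonglongrightarrow> of_real K"
      using tendsto_mult[OF tendsto_mult[OF 1 tendsto_of_real[OF 2]] 3] by simp
  qed
  \<comment> \<open>\<open>h (1 / \<zeta>)\<close> is the quotient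
    \<open>r (\<zeta> + 1) / r \<zeta>\<close>. Its derivative at 0 is \<open>a - a = 0\<close>, so
    each step changes \<open>r\<close> only to second order, and such changes are summable.\<close>
  define h where "h z = (1 + of_real a * z) * (1 + z) powr of_real (- a)" for z :: complex
  have h_deriv: "(h has_field_derivative 0) (at 0)"
    unfolding h_def by (auto intro!: derivative_eq_intros simp: complex_nonpos_Reals_iff)
  have h_hol: "h holomorphic_on ball 0 1"
  proof -
    have "1 + z \<notin> \<real>\<^sub>\<le>\<^sub>0" if "z \<in> ball 0 1" for z :: complex
    proof
      assume "1 + z \<in> \<real>\<^sub>\<le>\<^sub>0"
      then have "Re z \<le> -1" by (auto simp: complex_nonpos_Reals_iff)
      then show False using that abs_Re_le_cmod[of z] by auto
    qed
    then show ?thesis unfolding h_def by (intro holomorphic_intros) auto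
  qed
  obtain C0 \<eta> where C0: "C0 \<ge> 0" "\<eta> > 0" "cball 0 \<eta> \<subseteq> ball (0 :: complex) 1"
    "\<And>z. z \<in> cball 0 \<eta> \<Longrightarrow> cmod (h z - h 0 - deriv h 0 * (z - 0)) \<le> C0 * cmod (z - 0) ^ 2"
    by (rule second_order_bound[OF h_hol open_ball, of 0]) auto
  have h_bound: "cmod (h z - 1) \<le> C0 * cmod z ^ 2" if "cmod z \<le> \<eta>" for z
    using C0(4)[of z] that DERIV_imp_deriv[OF h_deriv] by (simp add: h_def)
  have r_step: "cmod (r (\<zeta> + 1) - r \<zeta>) \<le> cmod (r \<zeta>) * (C0 / cmod \<zeta> ^ 2)"
    if \<zeta>: "Re \<zeta> > 0" "cmod \<zeta> \<ge> 1 / \<eta>" for \<zeta>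
  proof -
    have \<zeta>0: "\<zeta> \<noteq> 0" "\<zeta> + 1 \<noteq> 0" using \<zeta>(1) by (auto simp: complex_eq_iff)
    define z where "z = 1 / \<zeta>"
    have "Re z > 0" using \<zeta>(1) by (simp add: z_def Re_divide zero_less_divide_iff sum_power2_gt_zero_iff)
    then have z1: "Re (1 + z) > 0" "1 + z \<noteq> 0" by (auto simp: complex_eq_iff)
    have e: "\<zeta> + 1 = \<zeta> * (1 + z)" "\<zeta> + of_real a = \<zeta> * (1 + of_real a * z)"
      using \<zeta>0 by (auto simp: z_def field_simps)
    have "(1 + z) powr of_real (1 - a) = (1 + z) * (1 + z) powr of_real (- a)"
      using z1 by (simp add: powr_diff powr_minus field_simps)
    then have "r (\<zeta> + 1) = L \<zeta> * \<zeta> powr of_real (1 - a) * h z"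
      using \<zeta>(1) \<zeta>0 z1 unfolding r_def
      by (subst FE') (auto simp: e powr_mult_right_half_plane h_def)
    then have "r (\<zeta> + 1) - r \<zeta> = r \<zeta> * (h z - 1)" by (simp add: r_def algebra_simps)
    moreover have "cmod z \<le> \<eta>" using \<zeta>(2) \<zeta>0 C0(2) by (simp add: z_def norm_divide field_simps)
    then have "cmod (h z - 1) \<le> C0 / cmod \<zeta> ^ 2"
      using h_bound[of z] by (simp add: z_def norm_divide power_divide)
    ultimately show ?thesis by (simp only: norm_mult) (intro mult_left_mono norm_ge_zero)
  qed
  \<comment> \<open>The bound 2 gives \<open>n - 1 \<ge> n / 2\<close> for the telescoped fractions,
    \<open>1 / \<eta>\<close> admits the expansion of \<open>h\<close>, and \<open>8 * C0\<close>
    limits the total drift to half of the supremum \<open>S\<close>.\<close>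
  define R where "R = max 2 (max (1 / \<eta>) (8 * C0))"
  show "laplace_asymp (laplace M) (1 - a) (1 / Gamma a)"
    unfolding laplace_asymp_def
  proof (rule exI[of _ "8 * C0 * K"], rule exI[of _ R], intro allI impI)
    fix \<zeta> :: complex assume \<zeta>: "Re \<zeta> > 0" "R \<le> cmod \<zeta>"
    define n where "n = cmod \<zeta>"
    have n: "n \<ge> 2" "n \<ge> 1 / \<eta>" "n \<ge> 8 * C0" using \<zeta>(2) by (auto simp: R_def n_def)
    define \<rho> where "\<rho> k = r (\<zeta> + of_nat k)" for k
    have \<rho>_lim: "\<rho> \<longlonglongrightarrow> of_real K" unfolding \<rho>_def[abs_def] by (rule lim[OF \<zeta>(1)])
    have "Bseq \<rho>" using \<rho>_lim by (intro convergent_imp_Bseq convergentI)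
    then have bdd: "bdd_above (range (\<lambda>k. cmod (\<rho> k)))"
      unfolding Bseq_def by (auto simp: bdd_above_def)
    \<comment> \<open>The step bound is relative to the current value, so it is expressed through
      the supremum, which is finite by convergence. The resulting inequality
      \<open>S \<le> K + S / 2\<close> then removes \<open>S\<close>.\<close>
    define S where "S = (SUP k. cmod (\<rho> k))"
    have S: "cmod (\<rho> k) \<le> S" for k unfolding S_def by (rule cSUP_upper[OF _ bdd]) simp
    have S0: "S \<ge> 0" using S[of 0] norm_ge_zero order_trans by blast
    \<comment> \<open>For \<open>Re \<zeta> > 0\<close> the modulus of \<open>\<zeta> + k\<close> is
      at least \<open>(n + k) / sqrt 2\<close>, and \<open>1 / (n + k)^2\<close> is dominated by a
      telescoping difference.\<close>
    have rho_step: "cmod (\<rho> (Suc k) - \<rho> k) \<le> 2 * C0 * S * (1 / (n + real k - 1) - 1 / (n + real k))" for k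
    proof -
      have sq: "cmod (\<zeta> + of_nat k) ^ 2 \<ge> n ^ 2 + real k ^ 2"
      proof -
        have "cmod (\<zeta> + of_nat k) ^ 2 = n ^ 2 + real k ^ 2 + 2 * (real k * Re \<zeta>)"
          unfolding n_def cmod_power2 by (simp add: power2_eq_square algebra_simps)
        then show ?thesis using \<zeta>(1) by simp
      qed
      have "(n + real k) ^ 2 \<le> 2 * (n ^ 2 + real k ^ 2)"
        using sum_squares_bound[of n "real k"] by (simp add: power2_eq_square algebra_simps)
      also have "\<dots> \<le> 2 * cmod (\<zeta> + of_nat k) ^ 2" using sq by (rule mult_left_mono) simp
      finally have sq': "(n + real k) ^ 2 \<le> 2 * cmod (\<zeta> + of_nat k) ^ 2" .
      have "n ^ 2 \<le> n ^ 2 + real k ^ 2" by simp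
      then have "n ^ 2 \<le> cmod (\<zeta> + of_nat k) ^ 2" using sq by (rule order_trans)
      then have nk: "n \<le> cmod (\<zeta> + of_nat k)" by (rule power2_le_imp_le) simp
      have pos: "cmod (\<zeta> + of_nat k) ^ 2 > 0" using nk n by (intro zero_less_power) linarith
      have "cmod (\<rho> (Suc k) - \<rho> k) \<le> cmod (\<rho> k) * (C0 / cmod (\<zeta> + of_nat k) ^ 2)"
        using r_step[of "\<zeta> + of_nat k"] \<zeta>(1) nk n by (simp add: \<rho>_def add.assoc add.commute[of 1])
      also have "\<dots> \<le> S * (2 * C0 / (n + real k) ^ 2)"
      proof (intro mult_mono S S0)
        show "C0 / cmod (\<zeta> + of_nat k) ^ 2 \<le> 2 * C0 / (n + real k) ^ 2"
        proof -
          have "C0 * (n + real k) ^ 2 \<le> C0 * (2 * cmod (\<zeta> + of_nat k) ^ 2)" by (rule mult_left_mono[OF sq' C0(1)])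
          moreover have "(n + real k) ^ 2 > 0" using n by (intro zero_less_power) linarith
          ultimately show ?thesis using pos by (simp add: divide_le_eq pos_le_divide_eq mult_ac)
        qed
      qed (use C0 in auto)
      also have "\<dots> = 2 * C0 * S * (1 / (n + real k) ^ 2)" by simp
      also have "\<dots> \<le> 2 * C0 * S * (1 / (n + real k - 1) - 1 / (n + real k))"
      proof (intro mult_left_mono)
        have "1 / (n + real k - 1) - 1 / (n + real k) = 1 / ((n + real k - 1) * (n + real k))"
          using n by (simp add: field_simps)
        also have "\<dots> \<ge> 1 / (n + real k) ^ 2"
          using n unfolding power2_eq_square by (intro divide_left_mono mult_right_mono mult_pos_pos) auto
        finally show "1 / (n + real k) ^ 2 \<le> 1 / (n + real k - 1) - 1 / (n + real k)" .
      qed (use C0 S0 in auto)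
      finally show ?thesis .
    qed
    have tele: "cmod (\<rho> m - \<rho> j) \<le> 2 * C0 * S * (1 / (n + real j - 1) - 1 / (n + real m - 1))" if "j \<le> m" for j m
      using that
    proof (induction m rule: dec_induct)
      case (step m)
      have "cmod (\<rho> (Suc m) - \<rho> j) \<le> cmod (\<rho> (Suc m) - \<rho> m) + cmod (\<rho> m - \<rho> j)"
        using norm_triangle_ineq[of "\<rho> (Suc m) - \<rho> m" "\<rho> m - \<rho> j"] by simp
      also have "\<dots> \<le> 2 * C0 * S * (1 / (n + real m - 1) - 1 / (n + real m))
          + 2 * C0 * S * (1 / (n + real j - 1) - 1 / (n + real m - 1))"
        by (intro add_mono step.IH rho_step)
      also have "\<dots> = 2 * C0 * S * (1 / (n + real j - 1) - 1 / (n + real (Suc m) - 1))"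
        by (simp add: algebra_simps)
      finally show ?case .
    qed simp
    have dist: "cmod (of_real K - \<rho> j) \<le> 4 * C0 * S / n" for j
    proof (rule Lim_bounded)
      show "(\<lambda>m. cmod (\<rho> m - \<rho> j)) \<longlonglongrightarrow> cmod (of_real K - \<rho> j)"
        by (intro tendsto_norm tendsto_diff \<rho>_lim tendsto_const)
      show "\<forall>m\<ge>j. cmod (\<rho> m - \<rho> j) \<le> 4 * C0 * S / n"
      proof (intro allI impI)
        fix m assume "j \<le> m"
        have "cmod (\<rho> m - \<rho> j) \<le> 2 * C0 * S * (1 / (n + real j - 1) - 1 / (n + real m - 1))"
          by (rule tele[OF \<open>j \<le> m\<close>])
        also have "\<dots> \<le> 2 * C0 * S * (2 / n)"
        proof (intro mult_left_mono)
          have "1 / (n + real j - 1) \<le> 1 / (n / 2)" using n by (intro divide_left_mono) auto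
          moreover have "1 / (n + real m - 1) \<ge> 0" using n by simp
          ultimately show "1 / (n + real j - 1) - 1 / (n + real m - 1) \<le> 2 / n" by (simp only: divide_divide_eq_right)
        qed (use C0 S0 in auto)
        finally show "cmod (\<rho> m - \<rho> j) \<le> 4 * C0 * S / n" by simp
      qed
    qed
    have "S \<le> K + S / 2"
      unfolding S_def
    proof (rule cSUP_least)
      fix k
      have "cmod (\<rho> k) \<le> cmod (of_real K) + cmod (of_real K - \<rho> k)"
        by (metis norm_minus_commute norm_triangle_sub)
      also have "\<dots> \<le> K + 4 * C0 * S / n" using dist[of k] K by simp
      also have "4 * C0 * S / n \<le> S / 2"
        using n S0 mult_right_mono[OF n(3) S0] by (simp add: field_simps)
      finally show "cmod (\<rho> k) \<le> K + (SUP k. cmod (\<rho> k)) / 2" by (simp add: S_def)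
    qed simp
    then have "S \<le> 2 * K" by simp
    have "cmod (\<rho> 0 - of_real K) \<le> 4 * C0 * S / n" using dist[of 0] by (simp add: norm_minus_commute)
    also have "\<dots> \<le> 4 * C0 * (2 * K) / n"
      using \<open>S \<le> 2 * K\<close> C0 n by (intro divide_right_mono mult_left_mono) auto
    finally show "cmod (laplace M \<zeta> * \<zeta> powr of_real (1 - a) - of_real (1 / Gamma a)) \<le> 8 * C0 * K / cmod \<zeta>"
      by (simp add: \<rho>_def r_def L_def K_def n_def)
  qed
qed

section \<open>Products of Beta moments and the constant of the multinomial law\<close>

lemma nonneg_law_convolution:
  assumes M: "nonneg_law M" and N: "nonneg_law N"
  obtains Q where "nonneg_law Q" "\<And>\<zeta>. Re \<zeta> \<ge> 0 \<Longrightarrow> laplace Q \<zeta> = laplace M \<zeta> * laplace N \<zeta>"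
proof -
  interpret M: prob_space M using M by (simp add: nonneg_law_def)
  interpret N: prob_space N using N by (simp add: nonneg_law_def)
  interpret P: pair_prob_space M N ..
  have sets_M [measurable_cong]: "sets M = sets borel" and sets_N [measurable_cong]: "sets N = sets borel"
    using M N by (auto simp: nonneg_law_def)
  define Q where "Q = distr (M \<Otimes>\<^sub>M N) borel (\<lambda>(x, y). x + y :: real)"
  have pQ: "prob_space Q" unfolding Q_def by (rule P.prob_space_distr) measurable
  have AE_M: "AE x in M. x \<ge> 0" and AE_N: "AE y in N. y \<ge> 0" using M N by (auto simp: nonneg_law_def)
  have "AE p in M \<Otimes>\<^sub>M N. 0 \<le> fst p + snd p"
  proof (rule P.AE_pair_measure)
    show "{p \<in> space (M \<Otimes>\<^sub>M N). 0 \<le> fst p + snd p} \<in> sets (M \<Otimes>\<^sub>M N)" by measurable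
    show "AE x in M. AE y in N. 0 \<le> fst (x, y) + snd (x, y)"
      using AE_M
    proof (rule eventually_mono)
      fix x :: real assume "x \<ge> 0"
      then show "AE y in N. 0 \<le> fst (x, y) + snd (x, y)"
        by (intro eventually_mono[OF AE_N]) auto
    qed
  qed
  then have "AE y in Q. y \<ge> 0"
    unfolding Q_def by (subst AE_distr_iff) (auto simp: case_prod_unfold)
  moreover have "sets Q = sets borel" by (simp add: Q_def)
  ultimately have law: "nonneg_law Q" using pQ unfolding nonneg_law_def by blast
  have "laplace Q \<zeta> = laplace M \<zeta> * laplace N \<zeta>" if \<zeta>: "Re \<zeta> \<ge> 0" for \<zeta>
  proof -
    define e where "e y = exp (- \<zeta> * complex_of_real y)" for y
    have [measurable]: "e \<in> borel_measurable borel" unfolding e_def by measurable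
    have e1: "cmod (e y) \<le> 1" if "y \<ge> 0" for y using \<zeta> that by (simp add: e_def)
    have "laplace Q \<zeta> = (LINT p|(M \<Otimes>\<^sub>M N). e (fst p + snd p))"
      unfolding laplace_def Q_def e_def by (subst integral_distr) (auto simp: case_prod_unfold)
    also have "\<dots> = (LINT x|M. LINT y|N. e (x + y))"
    proof -
      have "integrable (M \<Otimes>\<^sub>M N) (\<lambda>p. e (fst p + snd p))"
      proof (rule P.integrable_const_bound)
        show "AE p in M \<Otimes>\<^sub>M N. norm (e (fst p + snd p)) \<le> 1"
          using \<open>AE p in M \<Otimes>\<^sub>M N. 0 \<le> fst p + snd p\<close> by (rule eventually_mono) (rule e1)
      qed measurable
      from P.integral_fst'[OF this] show ?thesis by simp
    qed
    also have "\<dots> = (LINT x|M. e x * laplace N \<zeta>)"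
    proof (rule Bochner_Integration.integral_cong[OF refl])
      fix x
      have "(LINT y|N. e (x + y)) = (LINT y|N. e x * e y)"
        by (simp add: e_def algebra_simps exp_add exp_diff exp_minus divide_inverse)
      also have "\<dots> = e x * laplace N \<zeta>" by (simp add: laplace_def e_def)
      finally show "(LINT y|N. e (x + y)) = e x * laplace N \<zeta>" .
    qed
    also have "\<dots> = laplace M \<zeta> * laplace N \<zeta>" by (simp add: laplace_def e_def)
    finally show ?thesis .
  qed
  with law show ?thesis by (rule that)
qed

text \<open>Induction by convolution, starting from the point mass at 0: moments and constants
  multiply, and the exponents add.\<close>

lemma beta_product_law_exists:
  assumes "finite A" "\<And>i. i \<in> A \<Longrightarrow> 0 < f i \<and> f i < (1 :: real)"
  shows "\<exists>M. nonneg_law M \<and> (\<forall>k. laplace M (of_nat k) = of_real (\<Prod>i\<in>A. pochhammer (f i) k / fact k)) \<and>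
    laplace_asymp (laplace M) (\<Sum>i\<in>A. 1 - f i) (\<Prod>i\<in>A. 1 / Gamma (f i))"
  using assms
proof (induction A rule: finite_induct)
  case empty
  define M where "M = return borel (0 :: real)"
  have "nonneg_law M" unfolding nonneg_law_def M_def by (auto simp: prob_space_return AE_return)
  moreover have L: "laplace M \<zeta> = 1" for \<zeta>
    unfolding laplace_def M_def by (subst integral_return) auto
  moreover have "laplace_asymp (laplace M) 0 1"
    unfolding laplace_asymp_def L by (rule exI[of _ 0], rule exI[of _ 0]) auto
  moreover have "\<forall>k. laplace M (of_nat k) = of_real 1" by (simp add: L)
  ultimately show ?case unfolding sum.empty prod.empty by blast
next
  case (insert j A)
  then obtain M where M: "nonneg_law M" "\<And>k. laplace M (of_nat k) = of_real (\<Prod>i\<in>A. pochhammer (f i) k / fact k)"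
    "laplace_asymp (laplace M) (\<Sum>i\<in>A. 1 - f i) (\<Prod>i\<in>A. 1 / Gamma (f i))"
    by blast
  have fj: "0 < f j" "f j < 1" using insert.prems by auto
  obtain N where N: "nonneg_law N"
    "\<And>\<zeta>. Re \<zeta> \<ge> 0 \<Longrightarrow> (\<zeta> + 1) * laplace N (\<zeta> + 1) = (\<zeta> + of_real (f j)) * laplace N \<zeta>"
    using beta_law_exists[OF fj] by blast
  obtain Q where Q: "nonneg_law Q" "\<And>\<zeta>. Re \<zeta> \<ge> 0 \<Longrightarrow> laplace Q \<zeta> = laplace N \<zeta> * laplace M \<zeta>"
    using nonneg_law_convolution[OF N(1) M(1)] by blast
  have "laplace Q (of_nat k) = of_real (\<Prod>i\<in>insert j A. pochhammer (f i) k / fact k)" for k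
    using insert.hyps by (simp add: Q(2) M(2) laplace_asymp_beta(1)[OF fj N])
  moreover have QL: "laplace Q \<zeta> = laplace N \<zeta> * laplace M \<zeta>" if "Re \<zeta> > 0" for \<zeta>
    using Q(2)[of \<zeta>] that by simp
  have "laplace_asymp (laplace Q) ((1 - f j) + (\<Sum>i\<in>A. 1 - f i)) (1 / Gamma (f j) * (\<Prod>i\<in>A. 1 / Gamma (f i)))"
    by (rule laplace_asymp_mult[OF laplace_asymp_beta(2)[OF fj N] M(3) QL])
  ultimately show ?case using Q(1) insert.hyps by (intro exI[of _ Q]) auto
qed

text \<open>The polynomial \<open>(z^d - 1) / (z - 1)\<close> is evaluated at 1 in two ways: as the
  product over the nontrivial roots of unity and as a geometric sum.\<close>

lemma prod_one_minus_roots_unity: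
  assumes d: "d \<ge> 1"
  shows "(\<Prod>z\<in>{z :: complex. z ^ d = 1} - {1}. 1 - z) = of_nat d"
proof -
  define p :: "complex poly" where "p = monom 1 d - 1"
  have poly_p: "poly p z = z ^ d - 1" for z by (simp add: p_def poly_monom)
  have deg: "degree p = d" "lead_coeff p = 1"
  proof -
    have "degree (- 1 + monom 1 d :: complex poly) = d"
      using d by (subst degree_add_eq_right) (auto simp: degree_monom_eq)
    then show dg: "degree p = d" by (simp add: p_def)
    show "lead_coeff p = 1" unfolding dg using d by (simp add: p_def)
  qed
  have "rsquarefree p"
    unfolding rsquarefree_roots
  proof (intro allI notI)
    fix z assume z: "poly p z = 0 \<and> poly (pderiv p) z = 0"
    then have "z ^ d = 1" "of_nat d * z ^ (d - 1) = 0"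
      by (auto simp: poly_p p_def pderiv_diff pderiv_monom poly_monom)
    then show False using d by (auto simp: power_0_left)
  qed
  then have "p = (\<Prod>z\<in>{z. z ^ d = 1}. [:- z, 1:])"
    using complex_poly_decompose_rsquarefree[of p] deg by (simp add: poly_p)
  also have "\<dots> = [:- 1, 1:] * (\<Prod>z\<in>{z. z ^ d = 1} - {1}. [:- z, 1:])"
    using d by (subst prod.remove[of _ 1]) (auto intro!: finite_roots_unity)
  finally have 1: "p = [:- 1, 1:] * (\<Prod>z\<in>{z. z ^ d = 1} - {1}. [:- z, 1:])" .
  have "poly p = poly ([:- 1, 1:] * (\<Sum>j<d. monom 1 j))"
    by (auto simp: poly_p poly_sum poly_monom power_diff_1_eq algebra_simps)
  then have "p = [:- 1, 1:] * (\<Sum>j<d. monom 1 j)" by (simp only: poly_eq_poly_eq_iff)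
  with 1 have "[:- 1, 1:] * (\<Prod>z\<in>{z. z ^ d = 1} - {1}. [:- z, 1:]) = [:- 1, 1:] * (\<Sum>j<d. monom (1 :: complex) j)"
    by simp
  then have "(\<Prod>z\<in>{z. z ^ d = 1} - {1}. [:- z, 1:]) = (\<Sum>j<d. monom (1 :: complex) j)"
    by (subst (asm) mult_left_cancel) auto
  then have "poly (\<Prod>z\<in>{z. z ^ d = 1} - {1}. [:- z, 1:]) 1 = poly (\<Sum>j<d. monom (1 :: complex) j) 1"
    by simp
  then show ?thesis by (simp add: poly_prod poly_sum poly_monom)
qed

text \<open>\<open>2 * sin (pi * k / d)\<close> is the distance from 1 to the \<open>k\<close>-th
  root of unity.\<close>

lemma prod_sin_multiples:
  assumes d: "d \<ge> 1"
  shows "(\<Prod>k\<in>{1..<d}. 2 * sin (pi * real k / real d)) = real d"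
proof -
  define z where "z k = cis (2 * pi * real k / real d)" for k :: nat
  have bij: "bij_betw z {..<d} {z. z ^ d = 1}"
    unfolding z_def[abs_def] by (rule Complex.bij_betw_roots_unity) (use d in simp)
  have "bij_betw z ({..<d} - {0}) ({z. z ^ d = 1} - {z 0})"
    using d by (intro bij_betw_DiffI[OF bij]) (auto simp: z_def bij_betw_def)
  moreover have "{..<d} - {0} = {1..<d}" by auto
  ultimately have bij': "bij_betw z {1..<d} ({z. z ^ d = 1} - {1})" by (simp add: z_def)
  have "cmod (1 - z k) = 2 * sin (pi * real k / real d)" if "k \<in> {1..<d}" for k
  proof -
    define t where "t = pi * real k / real d"
    have t: "0 \<le> t" "t \<le> pi" using that by (auto simp: t_def field_simps)
    have "2 * pi * real k / real d = 2 * t" by (simp add: t_def)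
    then have "cmod (1 - z k) ^ 2 = (1 - cos (2 * t)) ^ 2 + sin (2 * t) ^ 2"
      by (simp add: z_def cmod_power2)
    also have "\<dots> = 2 - 2 * cos (2 * t)"
      using sin_cos_squared_add[of "2 * t"] by (simp add: power2_eq_square algebra_simps)
    also have "\<dots> = (2 * sin t) ^ 2"
      by (simp add: cos_double_sin power_mult_distrib)
    finally have "cmod (1 - z k) = 2 * sin t"
      using sin_ge_zero[OF t] by (subst (asm) power2_eq_iff_nonneg) auto
    then show ?thesis by (simp add: t_def)
  qed
  then have "(\<Prod>k\<in>{1..<d}. 2 * sin (pi * real k / real d)) = (\<Prod>k\<in>{1..<d}. cmod (1 - z k))"
    by simp
  also have "\<dots> = cmod (\<Prod>w\<in>{z. z ^ d = 1} - {1}. 1 - w)"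
    unfolding prod_norm[symmetric] by (rule prod.reindex_bij_betw[OF bij'])
  also have "\<dots> = real d" by (simp add: prod_one_minus_roots_unity[OF d])
  finally show ?thesis .
qed

text \<open>Pairing \<open>k\<close> with \<open>d - k\<close> expresses the square of the product
  through the reflection formula, hence through the product of sines; positivity selects the root.
  This is where the factor \<open>2 * pi\<close> of the asymptotic formula comes from.\<close>

lemma prod_inverse_Gamma_multiples:
  assumes d: "d \<ge> 1"
  shows "(\<Prod>k\<in>{1..<d}. 1 / Gamma (real k / real d)) = sqrt d / (2 * pi) powr ((real d - 1) / 2)"
proof -
  define P where "P = (\<Prod>k\<in>{1..<d}. 1 / Gamma (real k / real d))"
  have "P > 0" unfolding P_def by (intro prod_pos) (auto intro!: Gamma_real_pos divide_pos_pos)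
  have refl: "Gamma x * Gamma (1 - x) = pi / sin (pi * x)" for x :: real
  proof -
    have "complex_of_real (Gamma x * Gamma (1 - x)) = of_real (pi / sin (pi * x))"
      using Gamma_reflection_complex[of "of_real x"]
      by (simp add: Gamma_complex_of_real[symmetric] sin_of_real[symmetric])
    then show ?thesis by (simp only: of_real_eq_iff)
  qed
  have "P = (\<Prod>k\<in>{1..<d}. 1 / Gamma (1 - real k / real d))"
    unfolding P_def
    by (rule prod.reindex_bij_witness[of _ "\<lambda>k. d - k" "\<lambda>k. d - k"]) (auto simp: of_nat_diff field_simps)
  then have "P ^ 2 = (\<Prod>k\<in>{1..<d}. 1 / Gamma (real k / real d)) * (\<Prod>k\<in>{1..<d}. 1 / Gamma (1 - real k / real d))"
    by (simp add: P_def power2_eq_square)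
  also have "\<dots> = (\<Prod>k\<in>{1..<d}. (2 * sin (pi * real k / real d)) / (2 * pi))"
    unfolding prod.distrib[symmetric]
    by (rule prod.cong) (use refl in \<open>auto simp: mult.commute\<close>)
  also have "\<dots> = real d / (2 * pi) ^ (d - 1)"
    by (simp only: prod_dividef prod_sin_multiples[OF d] prod_constant card_atLeastLessThan)
  also have "\<dots> = (sqrt d / (2 * pi) powr ((real d - 1) / 2)) ^ 2"
  proof -
    have "((2 * pi) powr ((real d - 1) / 2)) ^ 2 = (2 * pi) powr (real d - 1)"
      by (simp only: power2_eq_square powr_add[symmetric] field_sum_of_halves)
    also have "\<dots> = (2 * pi) ^ (d - 1)"
      using d by (subst powr_realpow[symmetric]) (auto simp: of_nat_diff)
    finally show ?thesis by (simp add: power_divide)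
  qed
  finally show ?thesis
    using \<open>P > 0\<close> by (subst (asm) power2_eq_iff_nonneg) (auto simp: P_def)
qed

text \<open>Passing from \<open>k\<close> to \<open>k + 1\<close> appends the factors
  \<open>d * (i / d + k)\<close> for \<open>i = 1, ..., d\<close>; those with \<open>i = d\<close>
  build up one \<open>fact k\<close>.\<close>

lemma fact_mult_eq_prod_pochhammer:
  assumes d: "d \<ge> 1"
  shows "fact (d * k) / fact k ^ d = real d ^ (d * k) * (\<Prod>i\<in>{1..<d}. pochhammer (real i / real d) k / fact k)"
proof -
  have "fact (d * k) = real d ^ (d * k) * (\<Prod>i\<in>{1..d}. pochhammer (real i / real d) k)"
  proof (induction k)
    case (Suc k)
    have "fact (d * k + n) = (fact (d * k) * (\<Prod>i\<in>{1..n}. real (d * k) + real i) :: real)" for n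
      by (induction n) (simp_all add: algebra_simps)
    from this[of d] have "fact (d * Suc k) = fact (d * k) * (\<Prod>i\<in>{1..d}. real (d * k) + real i)"
      by (simp add: add.commute)
    also have "(\<Prod>i\<in>{1..d}. real (d * k) + real i) = (\<Prod>i\<in>{1..d}. real d * (real i / real d + real k))"
      using d by (intro prod.cong) (auto simp: field_simps)
    also have "\<dots> = real d ^ d * (\<Prod>i\<in>{1..d}. real i / real d + real k)"
      by (simp add: prod.distrib)
    finally show ?case
      by (simp add: Suc pochhammer_Suc prod.distrib power_add mult_ac)
  qed simp
  also have "{1..d} = insert d {1..<d}" using d by auto
  also have "(\<Prod>i\<in>\<dots>. pochhammer (real i / real d) k) = fact k * (\<Prod>i\<in>{1..<d}. pochhammer (real i / real d) k)"
    using d by (simp add: pochhammer_fact)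
  finally have "fact (d * k) = real d ^ (d * k) * (fact k * (\<Prod>i\<in>{1..<d}. pochhammer (real i / real d) k))" .
  moreover have "(fact k :: real) ^ d = fact k * fact k ^ (d - 1)" using d by (cases d) auto
  ultimately show ?thesis by (simp add: prod_dividef)
qed

text \<open>The moments factor as \<open>\<Prod>\<^sub>i (i/d)\<^sub>k / k!\<close> over \<open>0 < i < d\<close>, which are moments of Beta laws.\<close>

lemma multinomial_law_exists:
  assumes d: "d \<ge> 1"
  obtains M where "nonneg_law M"
    "\<And>k. laplace M (of_nat k) = of_real (fact (d * k) / (real d ^ (d * k) * fact k ^ d))"
    "laplace_asymp (laplace M) ((real d - 1) / 2) (sqrt d / (2 * pi) powr ((real d - 1) / 2))"
proof -
  have f: "0 < real i / real d \<and> real i / real d < 1" if "i \<in> {1..<d}" for i using that by auto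
  have s: "(\<Sum>i\<in>{1..<d}. 1 - real i / real d) = (real d - 1) / 2"
  proof -
    have "(\<Sum>i\<in>{1..<n}. real i) = real n * (real n - 1) / 2" if "n \<ge> 1" for n
      using that by (induction n rule: dec_induct) (auto simp: field_simps)
    from this[OF d] have "(\<Sum>i\<in>{1..<d}. real i / real d) = (real d - 1) / 2"
      using d by (simp add: sum_divide_distrib[symmetric])
    moreover have "(\<Sum>i\<in>{1..<d}. 1 - real i / real d) = (\<Sum>i\<in>{1..<d}. 1) - (\<Sum>i\<in>{1..<d}. real i / real d)"
      by (rule sum_subtractf)
    ultimately show ?thesis using d by (simp add: of_nat_diff field_simps)
  qed
  obtain M where M: "nonneg_law M"
    "\<And>k. laplace M (of_nat k) = of_real (\<Prod>i\<in>{1..<d}. pochhammer (real i / real d) k / fact k)"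
    "laplace_asymp (laplace M) (\<Sum>i\<in>{1..<d}. 1 - real i / real d) (\<Prod>i\<in>{1..<d}. 1 / Gamma (real i / real d))"
    using beta_product_law_exists[of "{1..<d}" "\<lambda>i. real i / real d"] f by auto
  have "laplace M (of_nat k) = of_real (fact (d * k) / (real d ^ (d * k) * fact k ^ d))" for k
  proof -
    have "(\<Prod>i\<in>{1..<d}. pochhammer (real i / real d) k / fact k) = (fact (d * k) / fact k ^ d) / real d ^ (d * k)"
      unfolding fact_mult_eq_prod_pochhammer[OF d] using d by simp
    then show ?thesis unfolding M(2) by (simp add: mult.commute)
  qed
  then show ?thesis
    using that[OF M(1)] M(3) unfolding s prod_inverse_Gamma_multiples[OF d] by blast
qed

section \<open>The roots of minimal modulus\<close>

text \<open>With \<open>w = 1 / x\<close> minimal modulus becomes maximal modulus, and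
  \<open>c\<close> is isolated in an equation \<open>w ^ (d - 1) * (s - w) = c\<close> that is easy
  to compare for different \<open>s\<close>.\<close>

lemma line_poly_root_reciprocal:
  assumes "d \<ge> 1" "x \<noteq> 0"
  shows "line_poly d c s x = 0 \<longleftrightarrow> (1 / x) ^ (d - 1) * (s - 1 / x) = c"
proof -
  have xd: "x ^ d = x ^ (d - 1) * x" using assms(1) by (cases d) auto
  have e: "s - 1 / x = (s * x - 1) / x" using assms(2) by (simp add: diff_divide_distrib)
  have "(1 / x) ^ (d - 1) * (s - 1 / x) = (1 / x) ^ (d - 1) * ((s * x - 1) / x)" by (simp only: e)
  also have "\<dots> = (s * x - 1) / x ^ d" unfolding xd by (simp add: power_one_over)
  finally have "(1 / x) ^ (d - 1) * (s - 1 / x) = (s * x - 1) / x ^ d" .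
  moreover have "x ^ d \<noteq> 0" using assms(2) by simp
  ultimately have "(1 / x) ^ (d - 1) * (s - 1 / x) = c \<longleftrightarrow> s * x - 1 = c * x ^ d"
    by (simp add: divide_eq_eq)
  moreover have "line_poly d c s x = 0 \<longleftrightarrow> s * x - 1 = c * x ^ d"
    unfolding line_poly_def by (auto simp: algebra_simps)
  ultimately show ?thesis by blast
qed

text \<open>In polar form this is
  \<open>\<bar>sin (n t)\<bar> \<le> n \<bar>sin t\<bar>\<close>.\<close>

lemma abs_Im_power_le: "\<bar>Im (w ^ n)\<bar> \<le> real n * cmod w ^ (n - 1) * \<bar>Im w\<bar>"
proof (induction n)
  case (Suc n)
  have "\<bar>Im (w ^ Suc n)\<bar> \<le> \<bar>Re w\<bar> * \<bar>Im (w ^ n)\<bar> + \<bar>Im w\<bar> * \<bar>Re (w ^ n)\<bar>"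
    using abs_triangle_ineq[of "Re w * Im (w ^ n)" "Im w * Re (w ^ n)"] by (simp add: abs_mult)
  also have "\<dots> \<le> cmod w * (real n * cmod w ^ (n - 1) * \<bar>Im w\<bar>) + \<bar>Im w\<bar> * cmod w ^ n"
    using Suc abs_Re_le_cmod[of "w ^ n"] by (intro add_mono mult_mono) (auto simp: abs_Re_le_cmod norm_power)
  also have "cmod w * (real n * cmod w ^ (n - 1) * \<bar>Im w\<bar>) = real n * cmod w ^ n * \<bar>Im w\<bar>"
    by (cases n) auto
  finally show ?case by (simp add: algebra_simps)
qed simp

text \<open>\<open>W ^ (d - 1) * (d - W)\<close> takes exactly the critical value of
  \<open>c\<close> at \<open>W = d - 1\<close> and falls without bound beyond that point, so the
  intermediate value theorem applies.\<close>

lemma real_root_small_c: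
  assumes d: "d \<ge> 2" and c: "c < (real d - 1) ^ (d - 1)"
  obtains W where "W > real d - 1" "W ^ (d - 1) * (real d - W) = c"
proof -
  define f where "f W = W ^ (d - 1) * (real d - W)" for W :: real
  \<comment> \<open>Chosen so that \<open>d - B = - \<bar>c\<bar> - 1\<close> while the power of
    \<open>B\<close> is at least 1, which pushes the value at \<open>B\<close> below
    \<open>c\<close>.\<close>
  define B where "B = real d + \<bar>c\<bar> + 1"
  have "1 \<le> B ^ (d - 1)" using d by (intro one_le_power) (auto simp: B_def)
  then have "f B \<le> 1 * (real d - B)"
    unfolding f_def by (intro mult_right_mono_neg) (auto simp: B_def)
  then have fB: "f B \<le> c" by (simp add: B_def)
  have fd: "f (real d - 1) = (real d - 1) ^ (d - 1)" by (simp add: f_def)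
  have "\<exists>W. real d - 1 \<le> W \<and> W \<le> B \<and> f W = c"
    by (rule IVT2) (use fB fd c in \<open>auto simp: f_def B_def intro!: continuous_intros\<close>)
  then obtain W where W: "real d - 1 \<le> W" "f W = c" by blast
  then have "W \<noteq> real d - 1" using fd c by auto
  with W have "real d - 1 < W" by simp
  then show ?thesis using W(2) unfolding f_def by (rule that)
qed

lemma decreasing_past_vertex:
  assumes d: "d \<ge> 2" and "real d - 1 < W" "W < u"
  shows "u ^ (d - 1) * (real d - u) < W ^ (d - 1) * (real d - W)"
proof (rule DERIV_neg_imp_decreasing[OF assms(3)])
  fix v assume v: "W \<le> v" "v \<le> u"
  have "((\<lambda>v. v ^ (d - 1) * (real d - v)) has_real_derivative
      (real (d - 1) * v ^ (d - 1 - 1)) * (real d - v) + v ^ (d - 1) * (- 1)) (at v)"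
    by (auto intro!: derivative_eq_intros)
  moreover have "(real (d - 1) * v ^ (d - 1 - 1)) * (real d - v) + v ^ (d - 1) * (- 1)
      = real d * v ^ (d - 2) * (real d - 1 - v)"
  proof -
    have "v ^ (d - 1) = v * v ^ (d - 2)" using d by (simp add: power_eq_if numeral_2_eq_2)
    moreover have "d - 1 - 1 = d - 2" by simp
    ultimately show ?thesis using d by (simp add: of_nat_diff algebra_simps)
  qed
  moreover have "real d * v ^ (d - 2) * (real d - 1 - v) < 0"
    using d assms v by (intro mult_pos_neg mult_pos_pos zero_less_power) auto
  ultimately show "\<exists>y. ((\<lambda>v. v ^ (d - 1) * (real d - v)) has_real_derivative y) (at v) \<and> y < 0" by auto
qed

text \<open>For \<open>c \<le> 0\<close> taking moduli and the triangle inequality suffice. For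
  \<open>c > 0\<close> the nonreal and the nonpositive roots satisfy
  \<open>\<bar>w\<bar>^d \<le> c (d - 1) < W^d\<close>, and the positive ones are controlled by
  monotonicity beyond \<open>d - 1\<close>.\<close>

lemma dominant_root_small_c:
  fixes c :: real and w :: complex
  assumes d: "d \<ge> 2" and W: "W > real d - 1" "W ^ (d - 1) * (real d - W) = c"
    and s: "0 \<le> s" "s \<le> real d" and w: "w ^ (d - 1) * (of_real s - w) = of_real c"
    and "w \<noteq> 0"
  shows "cmod w \<le> W" and "cmod w = W \<Longrightarrow> s = real d \<and> w = of_real W"
proof -
  define n where "n = d - 1"
  have n: "n \<ge> 1" "d = Suc n" "real d = real n + 1" using d by (auto simp: n_def)
  have W0: "W > 0" "W \<ge> 1" using W(1) d by auto
  have R: "cmod w > 0" using \<open>w \<noteq> 0\<close> by simp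
  have key: "cmod w < W \<or> (s = real d \<and> w = of_real W)"
  proof (cases "c \<le> 0")
    case True
    have "W \<ge> real d"
    proof (rule ccontr)
      assume "\<not> W \<ge> real d"
      then have "W ^ (d - 1) * (real d - W) > 0" using W0 by simp
      then show False using W True by simp
    qed
    have "cmod (w ^ n * (of_real s - w)) = - c" using w True by (simp add: n_def)
    then have e: "cmod w ^ n * cmod (w - of_real s) = - c" by (simp add: norm_mult norm_power norm_minus_commute)
    have e2: "W ^ n * (W - real d) = - c" using W(2) by (simp add: n_def algebra_simps)
    show ?thesis
    proof (rule ccontr)
      assume neg: "\<not> ?thesis"
      then have ge: "cmod w \<ge> W" by simp
      have tri: "cmod w - s \<le> cmod (w - of_real s)"
        using norm_triangle_ineq2[of w "of_real s"] s by simp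
      have "W ^ n * (W - real d) \<le> W ^ n * (cmod w - s)" using ge s W0 by (intro mult_left_mono) auto
      also have "\<dots> \<le> cmod w ^ n * (cmod w - s)"
        using ge s W0 \<open>W \<ge> real d\<close> by (intro mult_right_mono power_mono) auto
      also have "\<dots> \<le> cmod w ^ n * cmod (w - of_real s)" using tri by (intro mult_left_mono) auto
      also have "\<dots> = W ^ n * (W - real d)" using e e2 by simp
      \<comment> \<open>The chain starts and ends with the same value, so every link is an equality:
        the first forces \<open>s = d\<close> and \<open>cmod w = W\<close>, the last makes the
        triangle inequality sharp, so that \<open>w\<close> is a positive real.\<close>
      finally have eqs: "W ^ n * (W - real d) = W ^ n * (cmod w - s)"
         "cmod w ^ n * (cmod w - s) = cmod w ^ n * cmod (w - of_real s)"
        using \<open>W ^ n * (W - real d) \<le> W ^ n * (cmod w - s)\<close>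
          \<open>W ^ n * (cmod w - s) \<le> cmod w ^ n * (cmod w - s)\<close>
          \<open>cmod w ^ n * (cmod w - s) \<le> cmod w ^ n * cmod (w - of_real s)\<close> e e2 by linarith+
      from eqs(1) W0 have "W - real d = cmod w - s" by simp
      then have sd: "s = real d" "cmod w = W" using ge s by linarith+
      from eqs(2) R have "cmod w - s = cmod (w - of_real s)" by simp
      then have "cmod (w - of_real s) ^ 2 = (cmod w - s) ^ 2" by simp
      then have "s * Re w = s * cmod w"
      proof -
        have "cmod (w - of_real s) ^ 2 = cmod w ^ 2 - 2 * (s * Re w) + s ^ 2"
          unfolding cmod_power2 by (simp add: power2_eq_square algebra_simps)
        moreover have "(cmod w - s) ^ 2 = cmod w ^ 2 - 2 * (s * cmod w) + s ^ 2"
          by (simp add: power2_eq_square algebra_simps)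
        ultimately show ?thesis using \<open>cmod (w - of_real s) ^ 2 = (cmod w - s) ^ 2\<close> by linarith
      qed
      then have "Re w = cmod w" using sd(1) d by simp
      then have "Im w = 0" using cmod_power2[of w] by simp
      then have "w = of_real W" using \<open>Re w = cmod w\<close> sd by (simp add: complex_eq_iff)
      then show False using neg sd by simp
    qed
  next
    case False
    then have c: "c > 0" by simp
    have "W < real d"
    proof (rule ccontr)
      assume "\<not> W < real d"
      then have "W ^ (d - 1) * (real d - W) \<le> 0" using W0 by (intro mult_nonneg_nonpos) auto
      then show False using W c by simp
    qed
    have Wn: "W ^ d > c * real n"
    proof -
      have "c * real n = W ^ n * (real d - W) * real n" using W(2) by (simp add: n_def)
      also have "\<dots> < W ^ n * W"
      proof -
        have "(real d - W) * real n < 1 * W"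
        proof -
          have "(real d - W) * real n \<le> 1 * real n" using W(1) by (intro mult_right_mono) auto
          then show ?thesis using W(1) n(3) by linarith
        qed
        then show ?thesis using W0 by (simp add: mult.assoc)
      qed
      finally show ?thesis using n(2) by (simp add: mult.commute)
    qed
    have small: "cmod w < W" if "cmod w ^ d \<le> c * real n"
      by (rule power_less_imp_less_base[of _ d]) (use that Wn W0 in linarith)+
    show ?thesis
    proof (cases "Im w = 0")
      case False
      \<comment> \<open>Multiplying by the conjugate makes the coefficient of \<open>s - w\<close>
        real, so that taking imaginary parts eliminates \<open>s\<close>.\<close>
      have "w ^ n * cnj (w ^ n) * (of_real s - w) = of_real c * cnj (w ^ n)"
      proof -
        have "w ^ n * cnj (w ^ n) * (of_real s - w) = (w ^ n * (of_real s - w)) * cnj (w ^ n)" by (simp only: mult_ac)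
        then show ?thesis using w by (simp add: n_def)
      qed
      then have "of_real (cmod (w ^ n) ^ 2) * (of_real s - w) = of_real c * cnj (w ^ n)"
        by (simp only: complex_norm_square)
      from arg_cong[OF this, of Im] have "cmod (w ^ n) ^ 2 * Im w = c * Im (w ^ n)"
        by (simp del: complex_cnj_power)
      then have "\<bar>cmod (w ^ n) ^ 2 * Im w\<bar> = \<bar>c * Im (w ^ n)\<bar>" by (rule arg_cong)
      then have "cmod (w ^ n) ^ 2 * \<bar>Im w\<bar> = c * \<bar>Im (w ^ n)\<bar>"
        using c by (simp only: abs_mult abs_power2 abs_of_pos)
      also have "\<dots> \<le> c * (real n * cmod w ^ (n - 1) * \<bar>Im w\<bar>)"
        using abs_Im_power_le[of w n] c by (intro mult_left_mono) auto
      finally have "cmod w ^ (2 * n) * \<bar>Im w\<bar> \<le> (c * real n * cmod w ^ (n - 1)) * \<bar>Im w\<bar>"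
        by (simp add: norm_power power_mult[symmetric] mult_ac)
      then have "cmod w ^ (2 * n) \<le> c * real n * cmod w ^ (n - 1)"
        using False by (simp add: mult_le_cancel_right)
      moreover have "cmod w ^ (2 * n) = cmod w ^ d * cmod w ^ (n - 1)"
      proof -
        have "2 * n = d + (n - 1)" using n(1,2) by simp
        then show ?thesis by (simp only: power_add)
      qed
      ultimately have "cmod w ^ d \<le> c * real n" using R by (simp add: mult_le_cancel_right)
      then show ?thesis using small by simp
    next
      case True
      define u where "u = Re w"
      have wu: "w = of_real u" using True by (simp add: u_def complex_eq_iff)
      have "of_real (u ^ n * (s - u)) = (of_real c :: complex)" using w by (simp add: wu n_def)
      then have u: "u ^ n * (s - u) = c" by (simp only: of_real_eq_iff)
      show ?thesis
      proof (cases "u > 0")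
        case True
        show ?thesis
        proof (cases "u < W")
          case False
          have "c \<le> u ^ n * (real d - u)" using u s True by (auto intro!: mult_left_mono)
          moreover have "u ^ n * (real d - u) < c" if "W < u"
            using decreasing_past_vertex[OF d W(1) that] W(2) by (simp add: n_def)
          ultimately have "u = W" using False by linarith
          then have "u ^ n * (s - u) = u ^ n * (real d - u)" using u W(2) by (simp add: n_def)
          then have "s = real d" using True by simp
          then show ?thesis using \<open>u = W\<close> wu by simp
        qed (use True wu in simp)
      next
        case False
        have "\<bar>u ^ n * (s - u)\<bar> = c" using u c by simp
        moreover have "\<bar>s - u\<bar> = s + \<bar>u\<bar>" using False s by simp
        ultimately have "\<bar>u\<bar> ^ n * (s + \<bar>u\<bar>) = c" by (simp add: abs_mult power_abs)
        moreover have "\<bar>u\<bar> ^ n * \<bar>u\<bar> \<le> \<bar>u\<bar> ^ n * (s + \<bar>u\<bar>)" using s by (intro mult_left_mono) auto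
        ultimately have "\<bar>u\<bar> ^ n * \<bar>u\<bar> \<le> c * 1" by simp
        also have "\<dots> \<le> c * real n" using n c by (intro mult_left_mono) auto
        finally show ?thesis using small n(2) wu by (simp add: mult.commute)
      qed
    qed
  qed
  then show "cmod w \<le> W" using W0 by auto
  show "s = real d \<and> w = of_real W" if "cmod w = W" using key that by auto
qed

section \<open>Motion of the roots with the parameter \<open>s\<close>\<close>

definition line_param :: "nat \<Rightarrow> complex \<Rightarrow> complex \<Rightarrow> complex" where
  "line_param d c x = 1 / x + c * x ^ (d - 1)"

text \<open>The equation is linear in \<open>s\<close>. A branch of roots is therefore a local
  inverse of the explicit map \<open>line_param\<close>.\<close>

lemma line_poly_eq_0_iff_param:
  assumes "d \<ge> 1" "x \<noteq> 0"
  shows "line_poly d c s x = 0 \<longleftrightarrow> line_param d c x = s"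
proof -
  have xd: "x ^ d = x ^ (d - 1) * x" using assms(1) by (cases d) auto
  have "line_poly d c s x = x * (line_param d c x - s)"
    using assms(2) unfolding line_poly_def line_param_def xd by (simp add: algebra_simps)
  then show ?thesis using assms(2) by simp
qed

lemma line_param_deriv:
  assumes "d \<ge> 2" "x \<noteq> 0"
  shows "(line_param d c has_field_derivative ((of_nat d - 1) * line_param d c x - of_nat d / x) / x) (at x)"
proof -
  have "(line_param d c has_field_derivative (- (1 / x ^ 2) + c * (of_nat (d - 1) * x ^ (d - 1 - 1)))) (at x)"
    unfolding line_param_def using assms by (auto intro!: derivative_eq_intros simp: power2_eq_square divide_inverse)
  moreover have "- (1 / x ^ 2) + c * (of_nat (d - 1) * x ^ (d - 1 - 1))
      = ((of_nat d - 1) * line_param d c x - of_nat d / x) / x"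
  proof -
    have p: "x ^ (d - 1) = x * x ^ (d - 1 - 1)" using assms(1) by (cases "d - 1") auto
    have q: "of_nat (d - 1) = (of_nat d - 1 :: complex)" using assms(1) by (simp add: of_nat_diff)
    define y where "y = x ^ (d - 1 - 1)"
    show ?thesis unfolding line_param_def p q y_def[symmetric]
      using assms(2) by (simp add: divide_simps power2_eq_square) (simp add: algebra_simps)
  qed
  ultimately show ?thesis by simp
qed

text \<open>Inverse function theorem for \<open>line_param\<close>; \<open>simple\<close> says that
  its derivative at \<open>x0\<close> is nonzero, that is, \<open>x0\<close> is a simple root. The
  derivative of \<open>g\<close> at \<open>s0\<close> is the velocity of the root.\<close>

lemma line_param_local_inverse:
  assumes d: "d \<ge> 2" and x0: "x0 \<noteq> 0" and s0: "line_param d c x0 = s0"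
    and simple: "(of_nat d - 1) * s0 - of_nat d / x0 \<noteq> 0" and \<epsilon>: "\<epsilon> > 0"
  shows "\<exists>g U. open U \<and> x0 \<in> U \<and> U \<subseteq> ball x0 \<epsilon> \<and> 0 \<notin> U \<and> open (line_param d c ` U) \<and>
    g holomorphic_on (line_param d c ` U) \<and> (\<forall>x\<in>U. g (line_param d c x) = x) \<and>
    (g has_field_derivative x0 / ((of_nat d - 1) * s0 - of_nat d / x0)) (at s0)"
proof -
  define S where "S = line_param d c"
  define D where "D = ((of_nat d - 1) * s0 - of_nat d / x0) / x0"
  have D: "(S has_field_derivative D) (at x0)" "D \<noteq> 0"
    using line_param_deriv[OF d x0, of c] simple x0 by (auto simp: S_def D_def s0)
  define A where "A = ball x0 (min \<epsilon> (cmod x0))"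
  have A: "x0 \<in> A" "open A" "A \<subseteq> ball x0 \<epsilon>" "0 \<notin> A" using x0 \<epsilon> by (auto simp: A_def)
  have hol: "S holomorphic_on A"
    unfolding S_def line_param_def using A(4) by (intro holomorphic_intros) auto
  obtain r where r: "r > 0" "ball x0 r \<subseteq> A" "open (S ` ball x0 r)" "inj_on S (ball x0 r)"
    using has_complex_derivative_locally_invertible[OF hol A(1,2)] D by (auto simp: DERIV_imp_deriv)
  have holr: "S holomorphic_on ball x0 r" using hol r(2) by (rule holomorphic_on_subset)
  obtain g where g: "g holomorphic_on (S ` ball x0 r)"
    "\<And>z. z \<in> ball x0 r \<Longrightarrow> deriv S z * deriv g (S z) = 1"
    "\<And>z. z \<in> ball x0 r \<Longrightarrow> g (S z) = z"
    using holomorphic_has_inverse[OF holr open_ball r(4)] by blast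
  have "D * deriv g s0 = 1" using g(2)[of x0] r(1) DERIV_imp_deriv[OF D(1)] by (simp add: S_def s0)
  then have dg: "deriv g s0 = x0 / ((of_nat d - 1) * s0 - of_nat d / x0)"
    using D(2) x0 simple by (simp add: D_def field_simps)
  have "s0 \<in> S ` ball x0 r" using r(1) s0 by (auto simp: S_def intro!: image_eqI[of _ _ x0])
  then have "(g has_field_derivative x0 / ((of_nat d - 1) * s0 - of_nat d / x0)) (at s0)"
    using holomorphic_derivI[OF g(1) r(3)] dg by metis
  moreover have "x0 \<in> ball x0 r" "ball x0 r \<subseteq> ball x0 \<epsilon>" "0 \<notin> ball x0 r"
    using r(1) subset_trans[OF r(2) A(3)] subsetD[OF r(2), of 0] A(4) by (simp, blast, blast)
  ultimately show ?thesis
    using r(3) g(1,3) unfolding S_def by (intro exI[of _ g] exI[of _ "ball x0 r"]) blast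
qed

text \<open>The map \<open>r \<mapsto> w / (w - r)\<close> sends the disc
  \<open>cmod r \<le> cmod w\<close>, without its boundary point \<open>w\<close>, to the half-plane
  \<open>Re \<ge> 1 / 2\<close>, and the open disc to its interior.\<close>

lemma Re_divide_diff_ge_half:
  assumes "cmod r \<le> cmod w" "w \<noteq> r"
  shows "Re (w / (w - r)) \<ge> 1 / 2" and "cmod r < cmod w \<Longrightarrow> Re (w / (w - r)) > 1 / 2"
proof -
  have pos: "cmod (w - r) ^ 2 > 0" using assms(2) by simp
  have "Re (w / (w - r)) = Re (w * cnj (w - r)) / cmod (w - r) ^ 2"
    by (subst complex_div_cnj) (simp add: Re_divide_of_real)
  also have "Re (w * cnj (w - r)) = (cmod (w - r) ^ 2 + (cmod w ^ 2 - cmod r ^ 2)) / 2"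
    unfolding cmod_power2 by (simp add: power2_eq_square algebra_simps)
  finally have e: "Re (w / (w - r)) = 1 / 2 + (cmod w ^ 2 - cmod r ^ 2) / (2 * cmod (w - r) ^ 2)"
    using pos by (simp add: field_simps)
  have "cmod r ^ 2 \<le> cmod w ^ 2" using assms(1) by (intro power_mono) auto
  then show "Re (w / (w - r)) \<ge> 1 / 2" unfolding e using pos by simp
  show "Re (w / (w - r)) > 1 / 2" if "cmod r < cmod w"
  proof -
    have "cmod r ^ 2 < cmod w ^ 2" using that by (intro power_strict_mono) auto
    then show ?thesis unfolding e using pos by simp
  qed
qed

text \<open>At a root \<open>w\<close> of maximal modulus, every other root \<open>r\<close> satisfies \<open>Re (w / (w - r)) \<ge> 1/2\<close>, so
  \<open>Re (w Q'' w / Q' w) \<ge> d - 1\<close>; for the trinomial \<open>Q\<close> this is a bound on \<open>Re w\<close>. At most two roots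
  can have the same modulus, so the inequality is strict for \<open>d \<ge> 3\<close>.\<close>

lemma max_modulus_root_Re:
  fixes c s :: real and w :: complex
  assumes d: "d \<ge> 3" and c: "c > 0" and s: "s > 0"
    and simple: "\<And>v :: complex. v ^ (d - 1) * (of_real s - v) = of_real c \<Longrightarrow> of_nat d * v \<noteq> (of_nat d - 1) * of_real s"
    and w: "w ^ (d - 1) * (of_real s - w) = of_real c"
    and max: "\<And>v :: complex. v ^ (d - 1) * (of_real s - v) = of_real c \<Longrightarrow> cmod v \<le> cmod w"
  shows "Re (of_nat d * w - (of_nat d - 1) * of_real s) > 0"
proof -
  define Q where "Q = monom 1 d - monom (of_real s) (d - 1) + monom (of_real c :: complex) 0"
  have poly_Q: "poly Q v = of_real c - v ^ (d - 1) * (of_real s - v)" for v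
  proof -
    have "v ^ d = v ^ (d - 1) * v" using d by (cases d) auto
    then show ?thesis by (simp add: Q_def poly_monom algebra_simps)
  qed
  have degQ: "degree Q = d"
  proof (rule antisym)
    show "degree Q \<le> d" unfolding Q_def
      by (intro degree_add_le degree_diff_le) (auto intro: order.trans[OF degree_monom_le])
    show "d \<le> degree Q" using d by (intro le_degree) (simp add: Q_def)
  qed
  have lcQ: "lead_coeff Q = 1" unfolding degQ using d by (simp add: Q_def)
  obtain root where "smult (lead_coeff Q) (\<Prod>i<degree Q. [:- root i, 1:]) = Q"
    by (rule complex_poly_decompose')
  then have "smult 1 (\<Prod>i<d. [:- root i, 1:]) = Q" by (simp only: degQ lcQ[unfolded degQ])
  then have Q: "Q = (\<Prod>i<d. [:- root i, 1:])" by simp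
  have rootQ: "poly Q (root i) = 0" if "i < d" for i
    using that unfolding Q by (auto simp: poly_prod)
  then have root: "root i ^ (d - 1) * (of_real s - root i) = of_real c" if "i < d" for i
    using that poly_Q by simp
  have dQ: "poly (pderiv Q) v = v ^ (d - 2) * (of_nat d * v - (of_nat d - 1) * of_real s)" for v
  proof -
    have "v ^ (d - 1) = v ^ (d - 2) * v" using d by (simp add: power_Suc2[symmetric] Suc_diff_Suc numeral_2_eq_2)
    moreover have "d - 1 - 1 = d - 2" by simp
    ultimately show ?thesis using d by (simp add: Q_def pderiv_add pderiv_diff pderiv_monom poly_monom algebra_simps of_nat_diff)
  qed
  have ddQ: "poly (pderiv (pderiv Q)) v = (of_nat d - 1) * v ^ (d - 3) * (of_nat d * v - (of_nat d - 2) * of_real s)" for v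
  proof -
    have "v ^ (d - 2) = v ^ (d - 3) * v" using d by (simp add: power_Suc2[symmetric] Suc_diff_Suc numeral_2_eq_2 numeral_3_eq_3)
    moreover have "d - 1 - 1 = d - 2" "d - 2 - 1 = d - 3" by simp_all
    ultimately show ?thesis using d by (simp add: Q_def pderiv_add pderiv_diff pderiv_monom poly_monom algebra_simps of_nat_diff)
  qed
  have nz: "v \<noteq> 0" "poly (pderiv Q) v \<noteq> 0" if "v ^ (d - 1) * (of_real s - v) = of_real c" for v
  proof -
    show "v \<noteq> 0" using that c d by (auto simp: power_0_left)
    then show "poly (pderiv Q) v \<noteq> 0" using simple[OF that] by (simp add: dQ)
  qed
  define Q1 where "Q1 i = (\<Prod>j\<in>{..<d} - {i}. [:- root j, 1:])" for i
  have split: "Q = [:- root i, 1:] * Q1 i" if "i < d" for i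
    unfolding Q Q1_def using that by (subst prod.remove[of _ i]) auto
  have pd: "poly (pderiv ([:- a, 1:] * q)) a = poly q a"
      "poly (pderiv (pderiv ([:- a, 1:] * q))) a = 2 * poly (pderiv q) a" for a and q :: "complex poly"
    unfolding pderiv_mult pderiv_add by (simp_all add: pderiv_pCons)
  have d1: "poly (pderiv Q) (root i) = poly (Q1 i) (root i)" if "i < d" for i
    by (subst split[OF that]) (rule pd)
  have d2: "poly (pderiv (pderiv Q)) (root i) = 2 * poly (pderiv (Q1 i)) (root i)" if "i < d" for i
    by (subst split[OF that]) (rule pd)
  have inj: "inj_on root {..<d}"
  proof (rule inj_onI, rule ccontr)
    fix i j assume ij: "i \<in> {..<d}" "j \<in> {..<d}" "root i = root j" "i \<noteq> j"
    then have "poly (Q1 i) (root i) = 0" by (auto simp: Q1_def poly_prod intro!: bexI[of _ j])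
    then show False using d1[of i] nz(2)[OF root[of i]] ij by auto
  qed
  have "poly Q w = 0" using w by (simp add: poly_Q)
  then obtain i0 where i0: "i0 < d" "root i0 = w" unfolding Q by (auto simp: poly_prod)
  define A where "A = {..<d} - {i0}"
  have neq: "w \<noteq> root i" if "i \<in> A" for i
    using inj that i0 by (auto simp: A_def inj_on_def)
  have le: "cmod (root i) \<le> cmod w" if "i \<in> A" for i
    using max root that by (auto simp: A_def)
  \<comment> \<open>Roots of equal modulus also have equal distance from \<open>s\<close>, by the
    equation. They lie on two circles with different real centres, which meet in \<open>w\<close>
    and \<open>cnj w\<close> only, while there are at least three distinct roots.\<close>
  have "\<exists>i\<in>A. cmod (root i) < cmod w"
  proof (rule ccontr)
    assume "\<not> ?thesis"
    then have eq: "cmod (root i) = cmod w" if "i < d" for i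
      using le that i0 by (cases "i = i0") (auto simp: A_def not_less intro: antisym)
    have "root i \<in> {w, cnj w}" if "i < d" for i
    proof -
      have "cmod w ^ (d - 1) * cmod (of_real s - root i) = c"
        using arg_cong[OF root[OF that], of cmod] c eq[OF that] by (simp add: norm_mult norm_power)
      moreover have "cmod w ^ (d - 1) * cmod (of_real s - w) = c"
        using arg_cong[OF w, of cmod] c by (simp add: norm_mult norm_power)
      moreover have "cmod w ^ (d - 1) \<noteq> 0" using nz(1)[OF w] by simp
      ultimately have "cmod (of_real s - root i) = cmod (of_real s - w)" by (metis mult_left_cancel)
      then have 1: "cmod (of_real s - root i) ^ 2 = cmod (of_real s - w) ^ 2" by simp
      have 2: "cmod (root i) ^ 2 = cmod w ^ 2" using eq[OF that] by simp
      have "cmod (of_real s - v) ^ 2 = s ^ 2 - 2 * s * Re v + cmod v ^ 2" for v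
        unfolding cmod_power2 by (simp add: power2_eq_square algebra_simps)
      with 1 2 have "s * Re (root i) = s * Re w" by simp
      then have re: "Re (root i) = Re w" using s by simp
      with 2 have "Im (root i) ^ 2 = Im w ^ 2" by (simp add: cmod_power2)
      then have "Im (root i) = Im w \<or> Im (root i) = - Im w" by (simp add: power2_eq_iff)
      with re show ?thesis by (auto simp: complex_eq_iff)
    qed
    then have "root ` {..<d} \<subseteq> {w, cnj w}" by auto
    then have "card (root ` {..<d}) \<le> card {w, cnj w}" by (intro card_mono) auto
    also have "\<dots> \<le> 2" by (simp add: card_insert_if)
    finally show False using d by (simp add: card_image[OF inj])
  qed
  then obtain i1 where i1: "i1 \<in> A" "cmod (root i1) < cmod w" by blast
  have "finite A" by (simp add: A_def)
  have "(\<Sum>i\<in>A. 1 / 2) < (\<Sum>i\<in>A. Re (w / (w - root i)))"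
    by (rule sum_strict_mono_ex1[OF \<open>finite A\<close>])
      (use i1 Re_divide_diff_ge_half[OF le neq] in auto)
  moreover have "card A = d - 1" using i0 by (simp add: A_def)
  ultimately have sum: "Re (\<Sum>i\<in>A. w / (w - root i)) > (real d - 1) / 2" using d by (simp add: of_nat_diff)
  \<comment> \<open>Logarithmic derivative of the cofactor \<open>Q1 i0\<close>. Since
    \<open>Q'\<close> and \<open>Q''\<close> at \<open>w\<close> are \<open>Q1\<close> and
    \<open>2 * Q1'\<close> there, it equals half of \<open>Q'' / Q'\<close>.\<close>
  have "poly (pderiv (Q1 i0)) w = (\<Sum>i\<in>A. poly (Q1 i0) w * (1 / (w - root i)))"
    unfolding Q1_def A_def[symmetric] pderiv_prod poly_sum
  proof (rule sum.cong[OF refl])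
    fix i assume i: "i \<in> A"
    have "poly (\<Prod>j\<in>A. [:- root j, 1:]) w = (w - root i) * poly (\<Prod>j\<in>A - {i}. [:- root j, 1:]) w"
      using i \<open>finite A\<close> by (subst prod.remove[of _ i]) (auto simp: algebra_simps)
    then show "poly ((\<Prod>j\<in>A - {i}. [:- root j, 1:]) * pderiv [:- root i, 1:]) w
       = poly (\<Prod>j\<in>A. [:- root j, 1:]) w * (1 / (w - root i))"
      using neq[OF i] by (simp add: pderiv_pCons)
  qed
  then have "w * poly (pderiv (pderiv Q)) w = 2 * poly (pderiv Q) w * (\<Sum>i\<in>A. w / (w - root i))"
    using d2[OF i0(1)] d1[OF i0(1)] i0(2) by (simp add: sum_distrib_left mult_ac)
  then have "w * poly (pderiv (pderiv Q)) w / poly (pderiv Q) w = 2 * (\<Sum>i\<in>A. w / (w - root i))"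
    using nz(2)[OF w] by simp
  moreover define D where "D = of_nat d * w - (of_nat d - 1) * of_real s"
  have D0: "D \<noteq> 0" using simple[OF w] by (simp add: D_def)
  \<comment> \<open>For the trinomial the same quotient is explicit. Comparing real parts leaves
    \<open>Re (s / D) > 0\<close>, and \<open>D\<close> has a real part of the same sign.\<close>
  have "w * poly (pderiv (pderiv Q)) w / poly (pderiv Q) w = (of_nat d - 1) * (1 + of_real s / D)"
  proof -
    have pw: "w ^ (d - 2) = w * w ^ (d - 3)" using d by (simp add: power_Suc[symmetric] Suc_diff_Suc numeral_2_eq_2 numeral_3_eq_3)
    have "of_nat d * w - (of_nat d - 2) * of_real s = D + of_real s" by (simp add: D_def algebra_simps)
    then have "w * poly (pderiv (pderiv Q)) w = (of_nat d - 1) * w ^ (d - 2) * (D + of_real s)"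
      unfolding ddQ pw by simp
    moreover have "poly (pderiv Q) w = w ^ (d - 2) * D" by (simp add: dQ D_def)
    ultimately show ?thesis using D0 nz(1)[OF w] by (simp add: field_simps)
  qed
  ultimately have "(of_nat d - 1) * (1 + of_real s / D) = 2 * (\<Sum>i\<in>A. w / (w - root i))" by simp
  from arg_cong[OF this, of Re] have "(real d - 1) * (1 + Re (of_real s / D)) > real d - 1"
    using sum by simp
  moreover have "real d - 1 > 0" using d by simp
  ultimately have "Re (of_real s / D) > 0"
    using mult_less_cancel_left_pos[of "real d - 1" 1 "1 + Re (of_real s / D)"] by simp
  then have "s * Re D / cmod D ^ 2 > 0" by (simp add: Re_divide cmod_power2)
  then have "Re D > 0" using s D0 by (simp add: zero_less_divide_iff zero_less_mult_iff)
  then show ?thesis by (simp add: D_def)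
qed

text \<open>Transfer to \<open>x = 1 / w\<close>. A double root at the parameter \<open>s\<close>
  would force \<open>c = (d - 1)^(d - 1) * (s / d)^d\<close>, which is impossible for
  \<open>s \<le> d\<close> and \<open>c\<close> beyond the critical value.\<close>

lemma min_modulus_root_Re:
  fixes c s :: real and x :: complex
  assumes d: "d \<ge> 3" and c: "c > (real d - 1) ^ (d - 1)" and s: "0 < s" "s \<le> real d"
    and x: "line_poly d (of_real c) (of_real s) x = 0"
    and min: "\<And>y. line_poly d (of_real c) (of_real s) y = 0 \<Longrightarrow> cmod x \<le> cmod y"
  shows "Re (of_nat d / x - (of_nat d - 1) * of_real s) > 0"
proof -
  have c0: "c > 0" using c zero_le_power[of "real d - 1" "d - 1"] d by linarith
  have x0: "x \<noteq> 0" using x d by auto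
  have "Re (of_nat d * (1 / x) - (of_nat d - 1) * of_real s) > 0"
  proof (rule max_modulus_root_Re[OF d c0 s(1)])
    fix v :: complex assume v: "v ^ (d - 1) * (of_real s - v) = of_real c"
    show "of_nat d * v \<noteq> (of_nat d - 1) * of_real s"
    proof
      assume e: "of_nat d * v = (of_nat d - 1) * of_real s"
      define t where "t = s / real d"
      have vt: "v = of_real ((real d - 1) * t)" using e d by (simp add: t_def field_simps)
      have "s - (real d - 1) * t = t" using d by (simp add: t_def field_simps)
      then have "of_real (((real d - 1) * t) ^ (d - 1) * t) = (of_real c :: complex)"
        using v unfolding vt by (simp only: of_real_diff[symmetric] of_real_power[symmetric] of_real_mult[symmetric])
      then have "c = ((real d - 1) * t) ^ (d - 1) * t" by (simp only: of_real_eq_iff)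
      also have "\<dots> = (real d - 1) ^ (d - 1) * t ^ d"
        using d by (cases d) (auto simp: power_mult_distrib)
      also have "\<dots> \<le> (real d - 1) ^ (d - 1) * 1"
        using s d by (intro mult_left_mono power_le_one) (auto simp: t_def)
      finally show False using c by simp
    qed
    have "v \<noteq> 0" using v c0 d by (auto simp: power_0_left)
    then have "line_poly d (of_real c) (of_real s) (1 / v) = 0"
      using v d by (subst line_poly_root_reciprocal) auto
    then have "cmod x \<le> 1 / cmod v" using min[of "1 / v"] by (simp add: norm_divide)
    then show "cmod v \<le> cmod (1 / x)" using \<open>v \<noteq> 0\<close> x0 by (simp add: norm_divide field_simps)
  next
    show "(1 / x) ^ (d - 1) * (of_real s - 1 / x) = of_real c"
      using x line_poly_root_reciprocal[of d x] x0 d by simp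
  qed
  then show ?thesis by simp
qed

text \<open>Along the branch the derivative of \<open>cmod x ^ 2\<close> in \<open>s\<close> is
  \<open>2 * cmod x1 ^ 2 * Re (1 / D)\<close> with \<open>D = (d - 1) s1 - d / x1\<close>. The
  hypothesis makes it negative, so a slightly larger \<open>s\<close> has a root closer to the
  origin.\<close>

lemma root_moves_inwards:
  fixes c s1 :: real and x1 :: complex
  assumes d: "d \<ge> 2" and s1: "s1 < real d" and x1: "line_poly d (of_real c) (of_real s1) x1 = 0"
    and re: "Re (of_nat d / x1 - (of_nat d - 1) * of_real s1) > 0"
  obtains s x where "s1 < s" "s \<le> real d" "line_poly d (of_real c) (of_real s) x = 0" "cmod x < cmod x1"
proof -
  have x0: "x1 \<noteq> 0" using x1 d by auto
  define D where "D = (of_nat d - 1) * of_real s1 - of_nat d / x1"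
  have ReD: "Re D < 0" using re by (simp add: D_def)
  then have D0: "D \<noteq> 0" by auto
  have S1: "line_param d (of_real c) x1 = of_real s1"
    using x1 line_poly_eq_0_iff_param[of d x1] x0 d by simp
  obtain g U where gU: "open U" "x1 \<in> U" "U \<subseteq> ball x1 1" "0 \<notin> U" "open (line_param d (of_real c) ` U)"
    "g holomorphic_on (line_param d (of_real c) ` U)" "\<And>x. x \<in> U \<Longrightarrow> g (line_param d (of_real c) x) = x"
    "(g has_field_derivative x1 / ((of_nat d - 1) * of_real s1 - of_nat d / x1)) (at (of_real s1))"
    using line_param_local_inverse[OF d x0 S1 D0[unfolded D_def] zero_less_one] by blast
  have g1: "g (of_real s1) = x1" using gU(7)[of x1] gU(2) S1 by simp
  define g' where "g' = x1 / D"
  have dg: "((\<lambda>t. g (of_real t)) has_vector_derivative g') (at s1)"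
    using gU(8) unfolding D_def[symmetric] g'_def[symmetric] by (rule has_vector_derivative_real_field)
  define \<phi> where "\<phi> t = Re (g (of_real t)) ^ 2 + Im (g (of_real t)) ^ 2" for t :: real
  have dRe: "((\<lambda>t. Re (g (of_real t))) has_real_derivative Re g') (at s1)"
    using bounded_linear.has_vector_derivative[OF bounded_linear_Re dg]
    by (simp add: has_real_derivative_iff_has_vector_derivative)
  have dIm: "((\<lambda>t. Im (g (of_real t))) has_real_derivative Im g') (at s1)"
    using bounded_linear.has_vector_derivative[OF bounded_linear_Im dg]
    by (simp add: has_real_derivative_iff_has_vector_derivative)
  have "(\<phi> has_real_derivative (2 * Re x1 * Re g' + 2 * Im x1 * Im g')) (at s1)"
    unfolding \<phi>_def by (rule DERIV_cong[OF DERIV_add[OF DERIV_power[OF dRe] DERIV_power[OF dIm]]]) (simp add: g1)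
  moreover have "2 * Re x1 * Re g' + 2 * Im x1 * Im g' < 0"
  proof -
    have "Re (cnj x1 * g') = Re (of_real (cmod x1 ^ 2) * (1 / D))"
      unfolding g'_def complex_norm_square by (simp add: mult_ac)
    also have "\<dots> = cmod x1 ^ 2 * (Re D / cmod D ^ 2)"
      by (simp add: Re_divide cmod_power2)
    also have "\<dots> < 0" using ReD D0 x0 by (intro mult_pos_neg divide_neg_pos) auto
    finally show ?thesis by simp
  qed
  ultimately obtain \<delta> where \<delta>: "\<delta> > 0" "\<And>h. 0 < h \<Longrightarrow> h < \<delta> \<Longrightarrow> \<phi> (s1 + h) < \<phi> s1"
    using DERIV_neg_dec_right by blast
  have "of_real s1 \<in> line_param d (of_real c) ` U" using S1 gU(2) by (auto intro!: image_eqI[of _ _ x1])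
  then obtain e where e: "e > 0" "ball (of_real s1) e \<subseteq> line_param d (of_real c) ` U"
    using gU(5) open_contains_ball by blast
  define h where "h = min (min \<delta> e) (real d - s1) / 2"
  have "0 < h" "h < \<delta>" "h < e" using \<delta>(1) e(1) s1 by (auto simp: h_def min_def)
  moreover have "h \<le> (real d - s1) / 2" by (simp add: h_def)
  then have "s1 + h \<le> real d" using s1 by (simp add: field_simps)
  ultimately have h: "0 < h" "h < \<delta>" "h < e" "s1 + h \<le> real d" by auto
  have "complex_of_real (s1 + h) \<in> ball (of_real s1) e"
    using h by (simp add: dist_norm del: of_real_add) (simp add: norm_minus_commute)
  then obtain x where x: "x \<in> U" "line_param d (of_real c) x = of_real (s1 + h)" using e(2) by force
  have "x \<noteq> 0" using x gU(4) by auto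
  show ?thesis
  proof (rule that[of "s1 + h" x])
    show "line_poly d (of_real c) (of_real (s1 + h)) x = 0"
      using x \<open>x \<noteq> 0\<close> d by (subst line_poly_eq_0_iff_param) auto
    have "g (of_real (s1 + h)) = x" using gU(7)[OF x(1)] x(2) by simp
    then have "cmod x ^ 2 < cmod x1 ^ 2"
      using \<delta>(2)[OF h(1,2)] by (simp add: \<phi>_def g1 cmod_power2)
    then show "cmod x < cmod x1" by (rule power_less_imp_less_base) simp
  qed (use h in auto)
qed

lemma ex_line_poly_root:
  assumes d: "d \<ge> 2"
  shows "\<exists>x. line_poly d (of_real c) (of_nat d) x = 0"
proof -
  have "\<not> constant (poly (diag_poly d c))"
  proof
    assume "constant (poly (diag_poly d c))"
    then have "poly (diag_poly d c) x = 1" for x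
      using d unfolding constant_def by (metis poly_diag_poly diff_zero add.right_neutral mult_zero_right power_0_left not_numeral_le_zero)
    then have "poly (diag_poly d c) = poly 1" by auto
    then have "diag_poly d c = 1" by (simp only: poly_eq_poly_eq_iff)
    then have "coeff (diag_poly d c) 1 = 0" by simp
    then show False using d by (simp add: diag_poly_def)
  qed
  then obtain x where "poly (diag_poly d c) x = 0" using fundamental_theorem_of_algebra by blast
  then show ?thesis by (auto simp: poly_diag_poly line_poly_def)
qed

text \<open>There is no explicit dominant root here. Instead \<open>\<rho>\<close> is the minimum of
  \<open>cmod x\<close> over all pairs \<open>(s, x)\<close> with \<open>s\<close> in
  \<open>[0, d]\<close>; were it attained for some \<open>s < d\<close>, the root could be moved
  further inwards by increasing \<open>s\<close>.\<close>

lemma dominant_root_large_c: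
  fixes c :: real
  assumes d: "d \<ge> 3" and c: "c > (real d - 1) ^ (d - 1)"
  obtains \<rho> where "\<exists>x. line_poly d (of_real c) (of_nat d) x = 0 \<and> cmod x = \<rho>"
    "\<And>s x. 0 \<le> s \<Longrightarrow> s \<le> real d \<Longrightarrow> line_poly d (of_real c) (of_real s) x = 0 \<Longrightarrow> \<rho> \<le> cmod x \<and> (cmod x = \<rho> \<longrightarrow> s = real d)"
proof -
  have c0: "c > 0" using c zero_le_power[of "real d - 1" "d - 1"] d by linarith
  obtain y where y: "line_poly d (of_real c) (of_nat d) y = 0" using ex_line_poly_root[of d c] d by auto
  define Z where "Z = {p :: real \<times> complex. line_poly d (of_real c) (of_real (fst p)) (snd p) = 0}"
  \<comment> \<open>A root \<open>y\<close> for \<open>s = d\<close> bounds the search, which makes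
    the set of competing pairs compact.\<close>
  define K where "K = ({0..real d} \<times> cball 0 (cmod y)) \<inter> Z"
  have "closed Z" unfolding Z_def line_poly_def
    by (intro closed_Collect_eq continuous_intros)
  then have "compact K" unfolding K_def by (intro compact_Int_closed compact_Times) auto
  moreover have "(real d, y) \<in> K" using y by (auto simp: K_def Z_def)
  moreover have "continuous_on K (\<lambda>p. cmod (snd p))" by (intro continuous_intros)
  ultimately obtain p where p: "p \<in> K" "\<And>q. q \<in> K \<Longrightarrow> cmod (snd p) \<le> cmod (snd q)"
    using continuous_attains_inf[of K "\<lambda>p. cmod (snd p)"] by blast
  define \<rho> where "\<rho> = cmod (snd p)"
  have min: "\<rho> \<le> cmod x" if "0 \<le> s" "s \<le> real d" "line_poly d (of_real c) (of_real s) x = 0" for s x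
  proof (cases "cmod x \<le> cmod y")
    case True
    then show ?thesis using p(2)[of "(s, x)"] that by (auto simp: K_def Z_def \<rho>_def)
  next
    case False
    have "\<rho> \<le> cmod y" using p(1) by (auto simp: K_def \<rho>_def)
    then show ?thesis using False by simp
  qed
  have not_less: False if s: "0 \<le> s" "s < real d" and x: "line_poly d (of_real c) (of_real s) x = 0" "cmod x = \<rho>" for s x
  proof -
    have "\<exists>x'. line_poly d (of_real c) (of_real s) x' = 0 \<and> cmod x' = \<rho>
       \<and> Re (of_nat d / x' - (of_nat d - 1) * of_real s) > 0"
    proof (cases "s = 0")
      case False
      then show ?thesis
        using s x min by (intro exI[of _ x] conjI min_modulus_root_Re[OF d c]) auto
    next
      case True
      \<comment> \<open>The inequality for minimal roots is available for \<open>s > 0\<close>. At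
        \<open>s = 0\<close> all roots of \<open>1 + c * x ^ d\<close> have the same modulus, and
        the one with argument \<open>pi / d\<close> has positive real part because
        \<open>d \<ge> 3\<close>.\<close>
      define x' where "x' = of_real (root d (1 / c)) * cis (pi / real d)"
      have "cis (pi / real d) ^ d = cis pi" using d by (simp add: Complex.DeMoivre)
      moreover have "root d (1 / c) ^ d = 1 / c" using d c0 by (intro real_root_pow_pos2) auto
      ultimately have "x' ^ d = of_real (1 / c) * cis pi"
        unfolding x'_def power_mult_distrib of_real_power[symmetric] by simp
      then have x'd: "x' ^ d = - of_real (1 / c)" by simp
      have "1 + of_real c * x ^ d = 0" using x(1) True by (simp add: line_poly_def)
      then have "x ^ d = - of_real (1 / c)" using c0 by (simp add: field_simps eq_neg_iff_add_eq_0)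
      then have "cmod x' ^ d = cmod x ^ d" using x'd by (metis norm_power)
      then have "cmod x' = \<rho>" using x(2) d by (metis norm_ge_zero power_eq_imp_eq_base not_numeral_le_zero gr0I)
      moreover have "line_poly d (of_real c) (of_real s) x' = 0"
        using c0 True x'd by (simp add: line_poly_def)
      moreover have "Re (of_nat d / x') > 0"
      proof -
        have "cos (pi / real d) > 0"
        proof (rule cos_gt_zero_pi)
          show "pi / real d < pi / 2" using d by (intro divide_strict_left_mono) auto
          have "0 < pi / real d" using d by simp
          then show "- (pi / 2) < pi / real d" using pi_gt_zero by linarith
        qed
        then have "Re x' > 0" using d c0 by (simp add: x'_def)
        then show ?thesis using d by (auto simp: Re_divide zero_less_divide_iff sum_power2_gt_zero_iff)
      qed
      ultimately show ?thesis using True by auto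
    qed
    then obtain x' where x': "line_poly d (of_real c) (of_real s) x' = 0" "cmod x' = \<rho>"
       "Re (of_nat d / x' - (of_nat d - 1) * of_real s) > 0" by blast
    obtain t v where tv: "s < t" "t \<le> real d" "line_poly d (of_real c) (of_real t) v = 0" "cmod v < cmod x'"
      by (rule root_moves_inwards[OF _ s(2) x'(1) x'(3)]) (use d in auto)
    then have "\<rho> \<le> cmod v" using s by (intro min[of t]) auto
    then show False using tv x' by simp
  qed
  show ?thesis
  proof (rule that[of \<rho>])
    have p1: "0 \<le> fst p" "fst p \<le> real d" "line_poly d (of_real c) (of_real (fst p)) (snd p) = 0"
      using p(1) by (auto simp: K_def Z_def)
    then have "fst p = real d" using not_less[of "fst p" "snd p"] by (auto simp: \<rho>_def less_le)
    then show "\<exists>x. line_poly d (of_real c) (of_nat d) x = 0 \<and> cmod x = \<rho>" using p1(3) by (auto simp: \<rho>_def)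
    show "\<rho> \<le> cmod x \<and> (cmod x = \<rho> \<longrightarrow> s = real d)"
      if "0 \<le> s" "s \<le> real d" "line_poly d (of_real c) (of_real s) x = 0" for s x
      using min[OF that] not_less[of s x] that by (auto simp: less_le)
  qed
qed

text \<open>The information about roots on which the estimates rest. The last clause covers all
  smaller parameters as well: the closed disc of radius \<open>\<rho>\<close> contains no root for
  \<open>s < d\<close>, and for \<open>s = d\<close> only those in \<open>E\<close>.\<close>

definition dominant :: "nat \<Rightarrow> real \<Rightarrow> complex set \<Rightarrow> real \<Rightarrow> bool" where
  "dominant d c E \<rho> \<longleftrightarrow> \<rho> > 0 \<and> finite E \<and> E \<noteq> {} \<and>
     (\<forall>x\<in>E. line_poly d (of_real c) (of_nat d) x = 0 \<and> cmod x = \<rho> \<and> Re (1 / x) > real d - 1) \<and>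
     (\<forall>s x. 0 \<le> s \<longrightarrow> s \<le> real d \<longrightarrow> line_poly d (of_real c) (of_real s) x = 0 \<longrightarrow>
        \<rho> \<le> cmod x \<and> (cmod x = \<rho> \<longrightarrow> s = real d \<and> x \<in> E))"

text \<open>The hypothesis \<open>cd\<close> excludes \<open>d = 2\<close>, \<open>c > 1\<close>,
  where the minimal roots have \<open>1 / x = 1 +- i sqrt (c - 1)\<close> and the inequality for
  \<open>Re (1 / x)\<close> is not strict.\<close>

lemma dominant_min_modulus_roots:
  fixes c :: real
  assumes d: "d \<ge> 2" and c: "c \<noteq> (real d - 1) ^ (d - 1)" and cd: "c < (real d - 1) ^ (d - 1) \<or> d \<ge> 3"
    and E: "E = min_modulus_roots (diag_poly d c)"
  shows "\<exists>\<rho>. dominant d c E \<rho>"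
proof -
  define P where "P = line_poly d (of_real c)"
  have "\<exists>\<rho>. (\<exists>x. P (of_nat d) x = 0 \<and> cmod x = \<rho>)
     \<and> (\<forall>s x. 0 \<le> s \<longrightarrow> s \<le> real d \<longrightarrow> P (of_real s) x = 0 \<longrightarrow> \<rho> \<le> cmod x \<and> (cmod x = \<rho> \<longrightarrow> s = real d))
     \<and> (\<forall>x. P (of_nat d) x = 0 \<longrightarrow> cmod x = \<rho> \<longrightarrow> Re (1 / x) > real d - 1)"
  proof (cases "c < (real d - 1) ^ (d - 1)")
    case True
    obtain W where W: "W > real d - 1" "W ^ (d - 1) * (real d - W) = c"
      using real_root_small_c[OF d True] by blast
    have W0: "W > 0" using W(1) d by simp
    have dom: "1 / W \<le> cmod x \<and> (cmod x = 1 / W \<longrightarrow> s = real d \<and> 1 / x = of_real W)"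
      if "0 \<le> s" "s \<le> real d" "P (of_real s) x = 0" for s x
    proof -
      have x0: "x \<noteq> 0" using that(3) d by (auto simp: P_def)
      have "(1 / x) ^ (d - 1) * (of_real s - 1 / x) = of_real c"
        using that(3) line_poly_root_reciprocal[of d x] x0 d by (simp add: P_def)
      from dominant_root_small_c[OF d W that(1,2) this] x0
      have "cmod (1 / x) \<le> W" "cmod (1 / x) = W \<Longrightarrow> s = real d \<and> 1 / x = of_real W" by auto
      then show ?thesis using x0 W0 by (auto simp: norm_divide field_simps)
    qed
    have "P (of_nat d) (of_real (1 / W)) = 0"
    proof -
      have "of_real (W ^ (d - 1) * (real d - W)) = (of_real c :: complex)" using W(2) by simp
      then have "(1 / of_real (1 / W)) ^ (d - 1) * (of_nat d - 1 / of_real (1 / W)) = (of_real c :: complex)"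
        using W0 by simp
      then show ?thesis unfolding P_def using W0 d by (subst line_poly_root_reciprocal) auto
    qed
    moreover have "Re (1 / x) > real d - 1" if "P (of_nat d) x = 0" "cmod x = 1 / W" for x
    proof -
      have "1 / x = of_real W" using dom[of "real d" x] that by simp
      then show ?thesis using W(1) by simp
    qed
    ultimately show ?thesis
      using dom W0 by (intro exI[of _ "1 / W"] conjI allI impI exI[of _ "of_real (1 / W) :: complex"]) (auto simp: norm_divide)
  next
    case False
    then have c': "c > (real d - 1) ^ (d - 1)" and d3: "d \<ge> 3" using c cd by auto
    obtain \<rho> where \<rho>: "\<exists>x. P (of_nat d) x = 0 \<and> cmod x = \<rho>"
      "\<And>s x. 0 \<le> s \<Longrightarrow> s \<le> real d \<Longrightarrow> P (of_real s) x = 0 \<Longrightarrow> \<rho> \<le> cmod x \<and> (cmod x = \<rho> \<longrightarrow> s = real d)"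
      using dominant_root_large_c[OF d3 c'] unfolding P_def by blast
    have "Re (1 / x) > real d - 1" if "P (of_nat d) x = 0" "cmod x = \<rho>" for x
    proof -
      have "Re (of_nat d / x - (of_nat d - 1) * of_real (real d)) > 0"
        by (rule min_modulus_root_Re[OF d3 c']) (use that \<rho>(2)[of "real d"] d in \<open>auto simp: P_def\<close>)
      then have "real d * Re (1 / x) > real d * (real d - 1)"
        by (simp add: Re_divide algebra_simps)
      then show ?thesis using d by simp
    qed
    then show ?thesis using \<rho> by blast
  qed
  then obtain \<rho> where \<rho>: "\<exists>x. P (of_nat d) x = 0 \<and> cmod x = \<rho>"
     "\<And>s x. 0 \<le> s \<Longrightarrow> s \<le> real d \<Longrightarrow> P (of_real s) x = 0 \<Longrightarrow> \<rho> \<le> cmod x \<and> (cmod x = \<rho> \<longrightarrow> s = real d)"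
     "\<And>x. P (of_nat d) x = 0 \<Longrightarrow> cmod x = \<rho> \<Longrightarrow> Re (1 / x) > real d - 1" by blast
  have pE: "poly (diag_poly d c) x = P (of_nat d) x" for x
    by (simp add: poly_diag_poly P_def line_poly_def)
  have \<rho>_min: "\<rho> \<le> cmod x" if "P (of_nat d) x = 0" for x using \<rho>(2)[of "real d" x] that by simp
  obtain x0 where x0: "P (of_nat d) x0 = 0" "cmod x0 = \<rho>" using \<rho>(1) by blast
  have E': "E = {x. P (of_nat d) x = 0 \<and> cmod x = \<rho>}"
    unfolding E min_modulus_roots_def pE using \<rho>_min x0 by (auto intro: antisym)
  have "x0 \<noteq> 0" using x0 d by (auto simp: P_def)
  have "finite E" using finite_line_poly_roots[of d "of_real c" "of_nat d"] d
    by (auto simp: E' P_def intro: finite_subset)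
  moreover have "s = real d \<and> x \<in> E" if "0 \<le> s" "s \<le> real d" "P (of_real s) x = 0" "cmod x = \<rho>" for s x
  proof -
    have "s = real d" using \<rho>(2)[of s x] that by simp
    then show ?thesis using that by (simp add: E')
  qed
  moreover have "\<rho> > 0" "E \<noteq> {}" using x0 \<open>x0 \<noteq> 0\<close> E' by auto
  moreover have "\<forall>x\<in>E. P (of_nat d) x = 0 \<and> cmod x = \<rho> \<and> Re (1 / x) > real d - 1"
    using E' \<rho>(3) by auto
  ultimately show ?thesis
    using \<rho>(2) unfolding dominant_def P_def[symmetric] by (intro exI[of _ \<rho>]) blast
qed

section \<open>Uniform estimates for the one-variable coefficients\<close>

text \<open>Writing the root as \<open>x0 * exp (\<psi> / d)\<close> turns its power
  \<open>- d n\<close> into \<open>x0\<close> to that power times \<open>exp (- n * \<psi>)\<close>.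
  Here \<open>\<psi> = lam * y + O(y^2)\<close> with \<open>lam = x0 / (1 - (d - 1) x0)\<close>.
  With \<open>\<kappa>\<close> half of \<open>Re lam\<close>, both the exact and the linearised
  exponential are bounded by \<open>exp (- n * \<kappa> * y)\<close>.\<close>

lemma branch_expansion:
  fixes c x0 :: complex
  assumes d: "d \<ge> 2" and x0: "line_poly d c (of_nat d) x0 = 0" and re: "Re (1 / x0) > real d - 1" and \<epsilon>: "\<epsilon> > 0"
  shows "\<exists>U g \<eta> C \<kappa>. open U \<and> x0 \<in> U \<and> U \<subseteq> ball x0 \<epsilon> \<and> 0 \<notin> U \<and> \<eta> > 0 \<and> C \<ge> 0 \<and> \<kappa> > 0 \<and> \<kappa> \<le> Re (x0 / (1 - (of_nat d - 1) * x0)) \<and>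
    (\<forall>y. 0 \<le> y \<longrightarrow> y \<le> \<eta> \<longrightarrow> (let s = complex_of_real (real d * exp (- y / real d)) in
       g y \<in> U \<and> (\<forall>x\<in>U. line_poly d c s x = 0 \<longleftrightarrow> x = g y) \<and> (of_nat d - 1) * s * g y \<noteq> of_nat d \<and>
       (\<forall>n. cmod (1 / (g y ^ (d * n) * (of_nat d - (of_nat d - 1) * s * g y))
              - 1 / (x0 ^ (d * n) * (of_nat d * (1 - (of_nat d - 1) * x0))) * exp (- of_nat n * (x0 / (1 - (of_nat d - 1) * x0)) * of_real y))
            \<le> C / cmod x0 ^ (d * n) * ((y + real n * y ^ 2) * exp (- real n * \<kappa> * y)))))"
proof -
  define dd where "dd = (of_nat d :: complex)"
  have dd: "dd \<noteq> 0" using d by (simp add: dd_def)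
  have x00: "x0 \<noteq> 0" using x0 d by auto
  define q where "q = 1 / x0 - (dd - 1)"
  have Req: "Re q > 0" using re by (simp add: q_def dd_def)
  then have q0: "q \<noteq> 0" by auto
  define lam where "lam = 1 / q"
  have Relam: "Re lam > 0" using Req q0 by (simp add: lam_def Re_divide zero_less_divide_iff sum_power2_gt_zero_iff complex_eq_iff)
  have qx: "1 - (dd - 1) * x0 = q * x0" using x00 by (simp add: q_def algebra_simps)
  have lamx: "x0 / (1 - (dd - 1) * x0) = lam" unfolding qx lam_def using x00 q0 by simp
  have S0: "line_param d c x0 = dd"
    using x0 line_poly_eq_0_iff_param[of d x0] x00 d by (simp add: dd_def)
  have E: "(dd - 1) * dd - dd / x0 = - dd * q" by (simp add: q_def algebra_simps)
  obtain g U where gU: "open U" "x0 \<in> U" "U \<subseteq> ball x0 \<epsilon>" "0 \<notin> U" "open (line_param d c ` U)"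
    "g holomorphic_on (line_param d c ` U)" "\<And>x. x \<in> U \<Longrightarrow> g (line_param d c x) = x"
    "(g has_field_derivative x0 / (- dd * q)) (at dd)"
    using line_param_local_inverse[OF d x00 S0 _ \<epsilon>] E dd q0 unfolding dd_def[symmetric] by (auto 4 4)
  define V where "V = line_param d c ` U"
  define sz where "sz z = dd * exp (- z / dd)" for z
  have sz0: "sz 0 = dd" by (simp add: sz_def)
  have g0: "g dd = x0" using gU(7)[OF gU(2)] S0 by simp
  define A0 where "A0 = UNIV \<inter> sz -` V"
  have contsz: "continuous_on UNIV sz" unfolding sz_def using dd by (intro continuous_intros) auto
  have A0: "open A0" unfolding A0_def V_def by (rule continuous_open_preimage[OF contsz open_UNIV gU(5)])
  have "0 \<in> A0" using S0 gU(2) by (auto simp: A0_def V_def sz0 intro!: image_eqI[of _ _ x0])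
  define X where "X z = g (sz z)" for z
  have holsz: "sz holomorphic_on A" for A unfolding sz_def using dd by (intro holomorphic_intros) auto
  have holX: "X holomorphic_on A0"
    unfolding X_def[abs_def] using holomorphic_on_compose[OF holsz[of A0], of g] gU(6)
    by (simp add: o_def A0_def V_def holomorphic_on_subset)
  have X0: "X 0 = x0" by (simp add: X_def sz0 g0)
  define B where "B z = 1 / (dd - (dd - 1) * sz z * X z)" for z
  \<comment> \<open>\<open>Ln\<close> is applied only where \<open>X z / x0\<close> avoids the cut;
    at \<open>z = 0\<close> this quotient is 1. The further restriction to \<open>A2\<close> keeps
    the residue factor \<open>B\<close> finite.\<close>
  define A1 where "A1 = A0 \<inter> (\<lambda>z. X z / x0) -` (- \<real>\<^sub>\<le>\<^sub>0)"
  have A1: "open A1" unfolding A1_def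
    by (rule continuous_open_preimage) (use A0 holX x00 in \<open>auto intro!: holomorphic_on_imp_continuous_on holomorphic_intros\<close>)
  define A2 where "A2 = A1 \<inter> (\<lambda>z. dd - (dd - 1) * sz z * X z) -` (- {0})"
  have holX1: "X holomorphic_on A1" using holX by (rule holomorphic_on_subset) (auto simp: A1_def)
  have A2: "open A2" unfolding A2_def
    by (rule continuous_open_preimage) (use A1 holX1 holsz in \<open>auto intro!: holomorphic_on_imp_continuous_on holomorphic_intros\<close>)
  have B00: "dd - (dd - 1) * sz 0 * X 0 = dd * (q * x0)"
    unfolding sz0 X0 qx[symmetric] by (simp add: algebra_simps)
  have "0 \<in> A2" using \<open>0 \<in> A0\<close> x00 B00 dd q0 by (auto simp: A2_def A1_def X0)
  define \<psi> where "\<psi> z = dd * Ln (X z / x0)" for z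
  have hol\<psi>: "\<psi> holomorphic_on A2"
    unfolding \<psi>_def using x00 by (intro holomorphic_intros holomorphic_on_subset[OF holX]) (auto simp: A2_def A1_def)
  have holB: "B holomorphic_on A2"
    unfolding B_def by (intro holomorphic_intros holsz holomorphic_on_subset[OF holX]) (auto simp: A2_def A1_def)
  have dsz: "(sz has_field_derivative - 1) (at 0)"
    unfolding sz_def using dd by (auto intro!: derivative_eq_intros)
  have dX: "(X has_field_derivative x0 / (dd * q)) (at 0)"
    using DERIV_chain2[OF gU(8)[folded sz0] dsz] by (simp add: X_def[abs_def] sz0)
  have d\<psi>: "(\<psi> has_field_derivative lam) (at 0)"
    unfolding \<psi>_def lam_def using dd q0 x00
    by (auto intro!: derivative_eq_intros dX simp: X0 complex_nonpos_Reals_iff)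
  have \<psi>0: "\<psi> 0 = 0" using x00 by (simp add: \<psi>_def X0)
  obtain C1 \<eta>1 where 1: "C1 \<ge> 0" "\<eta>1 > 0" "cball 0 \<eta>1 \<subseteq> A2"
    "\<And>z. z \<in> cball 0 \<eta>1 \<Longrightarrow> cmod (\<psi> z - \<psi> 0 - deriv \<psi> 0 * (z - 0)) \<le> C1 * cmod (z - 0) ^ 2"
    using second_order_bound[OF hol\<psi> A2 \<open>0 \<in> A2\<close>] by blast
  obtain C2 \<eta>2 where 2: "C2 \<ge> 0" "\<eta>2 > 0" "cball 0 \<eta>2 \<subseteq> A2"
    "\<And>z. z \<in> cball 0 \<eta>2 \<Longrightarrow> cmod (B z - B 0 - deriv B 0 * (z - 0)) \<le> C2 * cmod (z - 0) ^ 2"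
    using second_order_bound[OF holB A2 \<open>0 \<in> A2\<close>] by blast
  define \<kappa> where "\<kappa> = Re lam / 2"
  have \<kappa>: "\<kappa> > 0" using Relam by (simp add: \<kappa>_def)
  \<comment> \<open>For \<open>y \<le> \<kappa> / (C1 + 1)\<close> the quadratic error
    \<open>C1 * y^2\<close> is at most \<open>\<kappa> * y\<close>, so half of the linear decay
    survives in \<open>Re \<psi>\<close>.\<close>
  define \<eta> where "\<eta> = min (min \<eta>1 \<eta>2) (min 1 (\<kappa> / (C1 + 1)))"
  have \<eta>: "\<eta> > 0" "\<eta> \<le> \<eta>1" "\<eta> \<le> \<eta>2" "\<eta> \<le> 1" "\<eta> \<le> \<kappa> / (C1 + 1)"
    using 1 2 \<kappa> by (auto simp: \<eta>_def intro!: divide_pos_pos)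
  define CB where "CB = cmod (deriv B 0) + C2"
  define C where "C = CB + cmod (B 0) * C1"
  have C: "C \<ge> 0" using 1 2 by (simp add: C_def CB_def)
  have main: "let s = complex_of_real (real d * exp (- y / real d)) in
       X (of_real y) \<in> U \<and> (\<forall>x\<in>U. line_poly d c s x = 0 \<longleftrightarrow> x = X (of_real y)) \<and> (dd - 1) * s * X (of_real y) \<noteq> dd \<and>
       (\<forall>n. cmod (1 / (X (of_real y) ^ (d * n) * (dd - (dd - 1) * s * X (of_real y)))
              - 1 / (x0 ^ (d * n) * (dd * (1 - (dd - 1) * x0))) * exp (- of_nat n * (x0 / (1 - (dd - 1) * x0)) * of_real y))
            \<le> C / cmod x0 ^ (d * n) * ((y + real n * y ^ 2) * exp (- real n * \<kappa> * y)))"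
    if y: "0 \<le> y" "y \<le> \<eta>" for y
  proof -
    define z where "z = complex_of_real y"
    have z: "cmod z = y" using y by (simp add: z_def)
    have zA: "z \<in> A2" using 1(3) y \<eta>(2) z by (auto simp: subset_iff)
    have s: "complex_of_real (real d * exp (- y / real d)) = sz z"
      by (simp add: sz_def z_def dd_def exp_of_real[symmetric])
    have "sz z \<in> V" using zA by (auto simp: A2_def A1_def A0_def)
    then obtain u where u: "u \<in> U" "line_param d c u = sz z" by (auto simp: V_def)
    have Xu: "X z = u" using gU(7)[OF u(1)] u(2) by (simp add: X_def)
    have XU: "X z \<in> U" using Xu u by simp
    have roots: "line_poly d c (sz z) x = 0 \<longleftrightarrow> x = X z" if "x \<in> U" for x
    proof -
      have "x \<noteq> 0" using that gU(4) by auto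
      then have "line_poly d c (sz z) x = 0 \<longleftrightarrow> line_param d c x = sz z"
        using d by (intro line_poly_eq_0_iff_param) auto
      also have "\<dots> \<longleftrightarrow> x = X z" using gU(7)[OF that] u Xu by (auto simp: X_def)
      finally show ?thesis .
    qed
    have nz: "dd - (dd - 1) * sz z * X z \<noteq> 0" using zA by (auto simp: A2_def)
    have Xz0: "X z \<noteq> 0" using XU gU(4) by auto
    have \<psi>b: "cmod (\<psi> z - lam * z) \<le> C1 * y ^ 2"
      using 1(4)[of z] y \<eta>(2) z DERIV_imp_deriv[OF d\<psi>] by (simp add: \<psi>0)
    have Bb: "cmod (B z - B 0) \<le> CB * y"
    proof -
      have "cmod (B z - B 0) \<le> cmod (B z - B 0 - deriv B 0 * z) + cmod (deriv B 0 * z)"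
        using norm_triangle_ineq[of "B z - B 0 - deriv B 0 * z" "deriv B 0 * z"] by simp
      also have "\<dots> \<le> C2 * y ^ 2 + cmod (deriv B 0) * y"
        using 2(4)[of z] y \<eta>(3) z by (simp add: norm_mult)
      also have "C2 * y ^ 2 \<le> C2 * y"
        using y \<eta>(4) 2(1) by (intro mult_left_mono) (auto simp: power2_eq_square mult_left_le)
      finally show ?thesis by (simp add: CB_def algebra_simps)
    qed
    have Re\<psi>: "Re (\<psi> z) \<ge> \<kappa> * y"
    proof -
      have "Re (lam * z) - Re (\<psi> z) \<le> cmod (\<psi> z - lam * z)"
        using abs_Re_le_cmod[of "\<psi> z - lam * z"] by simp
      also have "\<dots> \<le> C1 * y ^ 2" by (rule \<psi>b)
      also have "\<dots> \<le> (C1 + 1) * \<eta> * y"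
        using y 1(1) by (auto simp: power2_eq_square mult.assoc intro!: mult_mono)
      also have "\<dots> \<le> \<kappa> * y"
      proof (rule mult_right_mono)
        show "(C1 + 1) * \<eta> \<le> \<kappa>" using \<eta>(5) 1(1) by (simp add: pos_le_divide_eq mult.commute)
      qed (use y in simp)
      finally show ?thesis by (simp add: \<kappa>_def z_def algebra_simps)
    qed
    have est: "cmod (1 / (X z ^ (d * n) * (dd - (dd - 1) * sz z * X z))
              - 1 / (x0 ^ (d * n) * (dd * (1 - (dd - 1) * x0))) * exp (- of_nat n * (x0 / (1 - (dd - 1) * x0)) * z))
            \<le> C / cmod x0 ^ (d * n) * ((y + real n * y ^ 2) * exp (- real n * \<kappa> * y))" for n
    proof -
      have "exp (of_nat n * \<psi> z) = exp (of_nat (n * d) * Ln (X z / x0))"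
        by (simp add: \<psi>_def dd_def mult.assoc)
      also have "\<dots> = exp (Ln (X z / x0)) ^ (n * d)" by (rule exp_of_nat_mult)
      finally have "exp (of_nat n * \<psi> z) = (X z / x0) ^ (d * n)"
        using Xz0 x00 by (simp add: mult.commute)
      then have "exp (- of_nat n * \<psi> z) = (x0 / X z) ^ (d * n)"
        by (simp add: exp_minus inverse_eq_divide power_one_over[symmetric] flip: power_divide)
      then have t1: "1 / (X z ^ (d * n) * (dd - (dd - 1) * sz z * X z)) = 1 / x0 ^ (d * n) * (B z * exp (- of_nat n * \<psi> z))"
        using Xz0 x00 by (simp add: B_def power_divide)
      have t2: "1 / (x0 ^ (d * n) * (dd * (1 - (dd - 1) * x0))) * exp (- of_nat n * (x0 / (1 - (dd - 1) * x0)) * z)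
         = 1 / x0 ^ (d * n) * (B 0 * exp (- of_nat n * lam * z))"
        unfolding lamx B_def B00 qx[symmetric] by simp
      have m1: "Re (- of_nat n * \<psi> z) \<le> - real n * \<kappa> * y"
        using mult_left_mono[OF Re\<psi>, of "real n"] by (simp add: mult.assoc)
      have m2: "Re (- of_nat n * lam * z) \<le> - real n * \<kappa> * y"
      proof -
        have "\<kappa> * y \<le> Re lam * y" using y Relam by (intro mult_right_mono) (auto simp: \<kappa>_def)
        from mult_left_mono[OF this, of "real n"] show ?thesis by (simp add: z_def mult.assoc)
      qed
      have "cmod (exp (- of_nat n * \<psi> z) - exp (- of_nat n * lam * z))
          \<le> exp (- real n * \<kappa> * y) * cmod (- of_nat n * \<psi> z - (- of_nat n * lam * z))"
        by (rule exp_diff_bound[OF m1 m2])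
      also have "- of_nat n * \<psi> z - (- of_nat n * lam * z) = - (of_nat n * (\<psi> z - lam * z))"
        by (simp add: algebra_simps)
      also have "cmod \<dots> = real n * cmod (\<psi> z - lam * z)" by (simp add: norm_mult)
      also have "exp (- real n * \<kappa> * y) * (real n * cmod (\<psi> z - lam * z)) \<le> exp (- real n * \<kappa> * y) * (real n * (C1 * y ^ 2))"
        by (intro mult_left_mono \<psi>b) auto
      finally have e1: "cmod (exp (- of_nat n * \<psi> z) - exp (- of_nat n * lam * z)) \<le> exp (- real n * \<kappa> * y) * (real n * (C1 * y ^ 2))" .
      have e2: "cmod (exp (- of_nat n * \<psi> z)) \<le> exp (- real n * \<kappa> * y)" using m1 by simp
      have "B z * exp (- of_nat n * \<psi> z) - B 0 * exp (- of_nat n * lam * z)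
         = (B z - B 0) * exp (- of_nat n * \<psi> z) + B 0 * (exp (- of_nat n * \<psi> z) - exp (- of_nat n * lam * z))"
        by (simp add: algebra_simps)
      also have "cmod \<dots> \<le> cmod (B z - B 0) * cmod (exp (- of_nat n * \<psi> z))
          + cmod (B 0) * cmod (exp (- of_nat n * \<psi> z) - exp (- of_nat n * lam * z))"
        unfolding norm_mult[symmetric] by (rule norm_triangle_ineq)
      also have "\<dots> \<le> (CB * y) * exp (- real n * \<kappa> * y) + cmod (B 0) * (exp (- real n * \<kappa> * y) * (real n * (C1 * y ^ 2)))"
        using Bb e2 y 2(1) by (intro add_mono mult_mono mult_left_mono e1) (auto simp: CB_def)
      also have "\<dots> \<le> C * ((y + real n * y ^ 2) * exp (- real n * \<kappa> * y))"
      proof -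
        define w where "w = exp (- real n * \<kappa> * y)"
        have w: "w \<ge> 0" by (simp add: w_def)
        have CB: "CB \<ge> 0" using 2(1) by (simp add: CB_def)
        have "0 \<le> CB * (real n * y ^ 2) * w + cmod (B 0) * C1 * y * w"
          using w CB y 1(1) by (intro add_nonneg_nonneg mult_nonneg_nonneg) auto
        then have "CB * y * w + cmod (B 0) * (w * (real n * (C1 * y ^ 2)))
            \<le> CB * y * w + cmod (B 0) * (w * (real n * (C1 * y ^ 2))) + (CB * (real n * y ^ 2) * w + cmod (B 0) * C1 * y * w)"
          by simp
        also have "\<dots> = C * ((y + real n * y ^ 2) * w)"
          by (simp add: C_def algebra_simps)
        finally show ?thesis unfolding w_def .
      qed
      finally have fin: "cmod (B z * exp (- of_nat n * \<psi> z) - B 0 * exp (- of_nat n * lam * z))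
         \<le> C * ((y + real n * y ^ 2) * exp (- real n * \<kappa> * y))" .
      have "cmod (1 / x0 ^ (d * n) * (B z * exp (- of_nat n * \<psi> z)) - 1 / x0 ^ (d * n) * (B 0 * exp (- of_nat n * lam * z)))
         = 1 / cmod x0 ^ (d * n) * cmod (B z * exp (- of_nat n * \<psi> z) - B 0 * exp (- of_nat n * lam * z))"
        unfolding right_diff_distrib[symmetric] norm_mult by (simp add: norm_divide norm_power)
      also have "\<dots> \<le> 1 / cmod x0 ^ (d * n) * (C * ((y + real n * y ^ 2) * exp (- real n * \<kappa> * y)))"
        by (rule mult_left_mono[OF fin]) simp
      finally show ?thesis unfolding t1 t2 by simp
    qed
    show ?thesis
      unfolding Let_def s z_def[symmetric] using XU roots nz est by auto
  qed
  have kap: "\<kappa> \<le> Re (x0 / (1 - (dd - 1) * x0))" unfolding lamx using Relam by (simp add: \<kappa>_def)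
  show ?thesis
    unfolding dd_def[symmetric]
    by (rule exI[of _ U], rule exI[of _ "\<lambda>y. X (of_real y)"], rule exI[of _ \<eta>], rule exI[of _ C], rule exI[of _ \<kappa>],
        intro conjI gU(1-4) \<eta>(1) C \<kappa> kap allI impI main)
qed

lemma line_poly_lower_bound:
  fixes c :: complex
  assumes "compact K" and nz: "\<And>s x. (s, x) \<in> K \<Longrightarrow> line_poly d c (complex_of_real s) x \<noteq> 0"
  shows "\<exists>\<mu>>0. \<forall>(s, x)\<in>K. cmod (line_poly d c (complex_of_real s) x) \<ge> \<mu>"
proof -
  define F where "F p = line_poly d c (complex_of_real (fst p)) (snd p)" for p
  have "continuous_on K F" unfolding F_def line_poly_def by (intro continuous_intros)
  then have "compact (F ` K)" using assms(1) by (rule compact_continuous_image)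
  then have cl: "closed (F ` K)" by (rule compact_imp_closed)
  have "0 \<notin> F ` K" using nz by (auto simp: F_def)
  from separate_point_closed[OF cl this] obtain \<mu> where "\<mu> > 0 \<and> (\<forall>z\<in>F ` K. \<mu> \<le> dist 0 z)" ..
  then have \<mu>: "\<mu> > 0" "\<forall>z\<in>F ` K. \<mu> \<le> dist 0 z" by simp_all
  have "\<mu> \<le> cmod (F p)" if "p \<in> K" for p using \<mu>(2) that by simp
  then show ?thesis using \<mu>(1) by (intro exI[of _ \<mu>]) (auto simp: F_def)
qed

text \<open>For parameters bounded away from \<open>d\<close>, compactness gives a radius larger
  than \<open>\<rho>\<close> whose disc contains no root at all. The residue sum is then empty and
  only the integral remains.\<close>

lemma line_coeff_small_parameter:
  fixes c :: complex
  assumes d: "d \<ge> 2" and \<rho>: "\<rho> > 0" and s0: "s0 < real d"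
    and out: "\<And>s x. 0 \<le> s \<Longrightarrow> s \<le> s0 \<Longrightarrow> line_poly d c (of_real s) x = 0 \<Longrightarrow> \<rho> < cmod x"
  shows "\<exists>r \<mu>. r > \<rho> \<and> \<mu> > 0 \<and> (\<forall>s m. 0 \<le> s \<longrightarrow> s \<le> s0 \<longrightarrow> cmod (line_coeff d c (of_real s) m) \<le> 1 / (\<mu> * r ^ m))"
proof -
  define Z where "Z = {p. line_poly d c (complex_of_real (fst p)) (snd p) = 0}"
  define K where "K = ({0..s0} \<times> cball 0 (\<rho> + 1)) \<inter> Z"
  have "closed Z" unfolding Z_def line_poly_def by (intro closed_Collect_eq continuous_intros)
  then have K: "compact K" unfolding K_def by (intro compact_Int_closed compact_Times) auto
  \<comment> \<open>Only roots of modulus at most \<open>\<rho> + 1\<close> are considered, for the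
    sake of compactness. \<open>r\<close> is halfway between \<open>\<rho>\<close> and the closest
    of them, or \<open>\<rho> + 1\<close> if there are none.\<close>
  obtain r where r: "\<rho> < r" "\<And>p. p \<in> K \<Longrightarrow> r < cmod (snd p)" "r \<le> \<rho> + 1"
  proof (cases "K = {}")
    case True
    then show ?thesis using that[of "\<rho> + 1"] by simp
  next
    case False
    have "continuous_on K (\<lambda>p. cmod (snd p))" by (intro continuous_intros)
    then obtain p where p: "p \<in> K" "\<And>q. q \<in> K \<Longrightarrow> cmod (snd p) \<le> cmod (snd q)"
      using continuous_attains_inf[OF K False] by blast
    have "\<rho> < cmod (snd p)" "cmod (snd p) \<le> \<rho> + 1" using p(1) out by (auto simp: K_def Z_def)
    then show ?thesis using that[of "(\<rho> + cmod (snd p)) / 2"] p(2) by (force intro: less_le_trans)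
  qed
  have nz: "line_poly d c (complex_of_real s) x \<noteq> 0" if "s \<in> {0..s0}" "cmod x \<le> r" for s x
    using r(2)[of "(s, x)"] r(3) that by (auto simp: K_def Z_def)
  have "compact ({0..s0} \<times> cball (0 :: complex) r)" by (intro compact_Times) auto
  then have "\<exists>\<mu>>0. \<forall>(s, x)\<in>{0..s0} \<times> cball 0 r. cmod (line_poly d c (complex_of_real s) x) \<ge> \<mu>"
    by (rule line_poly_lower_bound) (use nz in auto)
  then obtain \<mu> where \<mu>: "\<mu> > 0" "\<And>s x. s \<in> {0..s0} \<Longrightarrow> x \<in> cball 0 r \<Longrightarrow> cmod (line_poly d c (complex_of_real s) x) \<ge> \<mu>"
    by auto
  show ?thesis
  proof (rule exI[of _ r], rule exI[of _ \<mu>], intro conjI allI impI r(1) \<mu>(1))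
    fix s m assume s: "0 \<le> s" "s \<le> s0"
    have "cmod (line_coeff d c (of_real s) m - (\<Sum>x\<in>{}. 1 / (x ^ m * (of_nat d - (of_nat d - 1) * of_real s * x)))) \<le> 1 / (\<mu> * r ^ m)"
      by (rule line_coeff_residue_estimate) (use d \<rho> r(1) \<mu> nz[of s] s in auto)
    then show "cmod (line_coeff d c (of_real s) m) \<le> 1 / (\<mu> * r ^ m)" by simp
  qed
qed

lemma finite_separation:
  fixes E :: "complex set"
  assumes "finite E" "\<delta> > 0"
  shows "\<exists>\<epsilon>. 0 < \<epsilon> \<and> \<epsilon> \<le> \<delta> \<and> (\<forall>x\<in>E. \<forall>y\<in>E. x \<noteq> y \<longrightarrow> ball x \<epsilon> \<inter> ball y \<epsilon> = {})"
proof -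
  define D where "D = insert (2 * \<delta>) ((\<lambda>(x, y). dist x y) ` {(x, y)\<in>E \<times> E. x \<noteq> y})"
  have "finite {(x, y)\<in>E \<times> E. x \<noteq> y}" by (rule finite_subset[of _ "E \<times> E"]) (use assms in auto)
  then have fin: "finite D" by (simp add: D_def)
  have "D \<noteq> {}" by (simp add: D_def)
  have "Min D > 0" using fin assms by (subst Min_gr_iff) (auto simp: D_def)
  moreover have "Min D \<le> 2 * \<delta>" using fin by (intro Min_le) (auto simp: D_def)
  moreover have "ball x (Min D / 2) \<inter> ball y (Min D / 2) = {}" if "x \<in> E" "y \<in> E" "x \<noteq> y" for x y
  proof -
    have "Min D \<le> dist x y" using fin that by (intro Min_le) (auto simp: D_def)
    then show ?thesis by (intro disjoint_ballI) simp
  qed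
  ultimately show ?thesis by (intro exI[of _ "Min D / 2"]) auto
qed

text \<open>The residue at the branch of \<open>x\<close>, with the residue factor frozen at
  \<open>y = 0\<close> and the exponent linearised in \<open>y\<close>. Its mean over a law of
  \<open>y\<close> is a value of the Laplace transform.\<close>

definition main_term :: "nat \<Rightarrow> complex \<Rightarrow> nat \<Rightarrow> real \<Rightarrow> complex" where
  "main_term d x n y = 1 / (x ^ (d * n) * (of_nat d * (1 - (of_nat d - 1) * x)))
     * exp (- of_nat n * (x / (1 - (of_nat d - 1) * x)) * of_real y)"

text \<open>Two regimes: for small \<open>y\<close> a circle slightly beyond \<open>\<rho>\<close>
  encloses exactly the branches that start in \<open>E\<close>; for larger \<open>y\<close> both the
  coefficient and the main terms are exponentially smaller than \<open>\<rho>\<close> to the power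
  \<open>- d n\<close>, which is the term \<open>\<theta> ^ n\<close>.\<close>

lemma line_coeff_pointwise:
  fixes c :: real
  assumes d: "d \<ge> 2" and D: "dominant d c E \<rho>"
  shows "\<exists>C \<kappa> \<theta>. C \<ge> 0 \<and> \<kappa> > 0 \<and> 0 < \<theta> \<and> \<theta> < 1 \<and> (\<forall>x\<in>E. \<kappa> \<le> Re (x / (1 - (of_nat d - 1) * x))) \<and>
    (\<forall>n y. y \<ge> 0 \<longrightarrow> cmod (line_coeff d (of_real c) (of_real (real d * exp (- y / real d))) (d * n) - (\<Sum>x\<in>E. main_term d x n y))
        \<le> C / \<rho> ^ (d * n) * ((y + real n * y ^ 2) * exp (- real n * \<kappa> * y) + \<theta> ^ n))"
proof -
  have \<rho>: "\<rho> > 0" and E: "finite E" "E \<noteq> {}"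
    and rootE: "\<And>x. x \<in> E \<Longrightarrow> line_poly d (of_real c) (of_nat d) x = 0"
    and modE: "\<And>x. x \<in> E \<Longrightarrow> cmod x = \<rho>"
    and ReE: "\<And>x. x \<in> E \<Longrightarrow> Re (1 / x) > real d - 1"
    and ge: "\<And>s x. 0 \<le> s \<Longrightarrow> s \<le> real d \<Longrightarrow> line_poly d (of_real c) (of_real s) x = 0 \<Longrightarrow> \<rho> \<le> cmod x"
    and eq: "\<And>s x. 0 \<le> s \<Longrightarrow> s \<le> real d \<Longrightarrow> line_poly d (of_real c) (of_real s) x = 0 \<Longrightarrow> cmod x = \<rho> \<Longrightarrow> s = real d \<and> x \<in> E"
    using D unfolding dominant_def by simp_all
  define P where "P s = line_poly d (of_real c) (complex_of_real s)" for s
  define Z where "Z = {x. P (real d) x = 0}"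
  have finZ: "finite Z" unfolding Z_def P_def using d by (intro finite_line_poly_roots) auto
  \<comment> \<open>Halfway to the next root modulus at \<open>s = d\<close>, capped at
    \<open>\<rho> + 1\<close> so that the minimum also exists without a further root.\<close>
  define r where "r = (\<rho> + Min (insert (\<rho> + 1) (cmod ` (Z - E)))) / 2"
  have Zout: "\<rho> < cmod x" if "x \<in> Z - E" for x
    using that ge[of "real d" x] eq[of "real d" x] by (auto simp: Z_def P_def less_le)
  have "\<rho> < Min (insert (\<rho> + 1) (cmod ` (Z - E)))"
    using finZ Zout by (subst Min_gr_iff) auto
  then have r: "\<rho> < r" "r < Min (insert (\<rho> + 1) (cmod ` (Z - E)))" by (auto simp: r_def)
  have Zr: "x \<in> E" if "x \<in> Z" "cmod x \<le> r" for x
  proof (rule ccontr)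
    assume "x \<notin> E"
    then have "Min (insert (\<rho> + 1) (cmod ` (Z - E))) \<le> cmod x"
      using that finZ by (intro Min_le) auto
    then show False using r(2) that(2) by simp
  qed
  \<comment> \<open>Disjoint balls keep the branches of different roots distinct, and
    \<open>\<epsilon> \<le> r - \<rho>\<close> keeps them inside the circle of radius
    \<open>r\<close>.\<close>
  obtain \<epsilon> where \<epsilon>: "0 < \<epsilon>" "\<epsilon> \<le> r - \<rho>" "\<And>x y. x \<in> E \<Longrightarrow> y \<in> E \<Longrightarrow> x \<noteq> y \<Longrightarrow> ball x \<epsilon> \<inter> ball y \<epsilon> = {}"
    using finite_separation[OF E(1), of "r - \<rho>"] r(1) by (auto simp del: disjoint_iff)
  define goodA where "goodA x U \<eta> C \<kappa> \<longleftrightarrow> open U \<and> x \<in> U \<and> U \<subseteq> ball x \<epsilon> \<and> 0 \<notin> U \<and> \<eta> > 0 \<and> C \<ge> 0 \<and> \<kappa> > 0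
     \<and> \<kappa> \<le> Re (x / (1 - (of_nat d - 1) * x))" for x and U :: "complex set" and \<eta> C \<kappa> :: real
  define s where "s y = real d * exp (- y / real d)" for y
  define goodB where "goodB x U g C \<kappa> y \<longleftrightarrow>
       g y \<in> U \<and> (\<forall>v\<in>U. P (s y) v = 0 \<longleftrightarrow> v = g y) \<and> (of_nat d - 1) * complex_of_real (s y) * g y \<noteq> of_nat d \<and>
       (\<forall>n. cmod (1 / (g y ^ (d * n) * (of_nat d - (of_nat d - 1) * of_real (s y) * g y)) - main_term d x n y)
            \<le> C / cmod x ^ (d * n) * ((y + real n * y ^ 2) * exp (- real n * \<kappa> * y)))"
    for x and U :: "complex set" and g :: "real \<Rightarrow> complex" and C \<kappa> y :: real
  define good where "good x U g \<eta> C \<kappa> \<longleftrightarrow> goodA x U \<eta> C \<kappa> \<and> (\<forall>y. 0 \<le> y \<longrightarrow> y \<le> \<eta> \<longrightarrow> goodB x U g C \<kappa> y)"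
    for x U g \<eta> C \<kappa>
  have "\<forall>x\<in>E. \<exists>U g \<eta> C \<kappa>. good x U g \<eta> C \<kappa>"
  proof
    fix x assume x: "x \<in> E"
    show "\<exists>U g \<eta> C \<kappa>. good x U g \<eta> C \<kappa>"
      unfolding good_def goodA_def goodB_def main_term_def s_def P_def conj_assoc
      by (rule branch_expansion[OF d rootE[OF x] ReE[OF x] \<epsilon>(1), unfolded Let_def])
  qed
  from bchoice[OF this] obtain U where "\<forall>x\<in>E. \<exists>g \<eta> C \<kappa>. good x (U x) g \<eta> C \<kappa>" ..
  from bchoice[OF this] obtain g where "\<forall>x\<in>E. \<exists>\<eta> C \<kappa>. good x (U x) (g x) \<eta> C \<kappa>" ..
  from bchoice[OF this] obtain \<eta> where "\<forall>x\<in>E. \<exists>C \<kappa>. good x (U x) (g x) (\<eta> x) C \<kappa>" ..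
  from bchoice[OF this] obtain C where "\<forall>x\<in>E. \<exists>\<kappa>. good x (U x) (g x) (\<eta> x) (C x) \<kappa>" ..
  from bchoice[OF this] obtain \<kappa> where "\<forall>x\<in>E. good x (U x) (g x) (\<eta> x) (C x) (\<kappa> x)" ..
  then have gdA: "goodA x (U x) (\<eta> x) (C x) (\<kappa> x)"
    and gdB: "\<And>y. 0 \<le> y \<Longrightarrow> y \<le> \<eta> x \<Longrightarrow> goodB x (U x) (g x) (C x) (\<kappa> x) y" if "x \<in> E" for x
    using that unfolding good_def by blast+
  have U: "open (U x)" "x \<in> U x" "U x \<subseteq> ball x \<epsilon>" "0 \<notin> U x" "\<eta> x > 0" "C x \<ge> 0" "\<kappa> x > 0"
     "\<kappa> x \<le> Re (x / (1 - (of_nat d - 1) * x))" if "x \<in> E" for x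
    using gdA[OF that] unfolding goodA_def by blast+
  define K where "K = {real d} \<times> (cball 0 r - (\<Union>x\<in>E. U x))"
  have "compact K" unfolding K_def using U(1) by (intro compact_Times compact_diff) auto
  moreover have "P (real d) x \<noteq> 0" if "x \<in> cball 0 r - (\<Union>x\<in>E. U x)" for x
    using that Zr[of x] U(2) by (auto simp: Z_def)
  ultimately have "\<exists>\<mu>>0. \<forall>(s, x)\<in>K. cmod (P s x) \<ge> \<mu>"
    unfolding P_def by (intro line_poly_lower_bound) (auto simp: K_def)
  then obtain \<mu> where \<mu>: "\<mu> > 0" "\<And>x. x \<in> cball 0 r - (\<Union>x\<in>E. U x) \<Longrightarrow> cmod (P (real d) x) \<ge> \<mu>"
    by (auto simp: K_def)
  have r0: "r > 0" using r(1) \<rho> by simp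
  \<comment> \<open>On the disc of radius \<open>r\<close>, replacing \<open>s = d\<close> by
    \<open>s y\<close> changes the polynomial by at most \<open>y * r\<close>, so up to
    \<open>\<mu> / (2 * r)\<close> half of its lower bound \<open>\<mu>\<close> is
    preserved.\<close>
  define \<eta>0 where "\<eta>0 = Min (insert (\<mu> / (2 * r)) (\<eta> ` E))"
  have \<eta>0: "\<eta>0 > 0" "\<eta>0 \<le> \<mu> / (2 * r)" "\<And>x. x \<in> E \<Longrightarrow> \<eta>0 \<le> \<eta> x"
  proof -
    show "\<eta>0 > 0" unfolding \<eta>0_def using E(1) U(5) \<mu>(1) r0 by (subst Min_gr_iff) auto
    show "\<eta>0 \<le> \<mu> / (2 * r)" unfolding \<eta>0_def using E(1) by (intro Min_le) auto
    show "\<eta>0 \<le> \<eta> x" if "x \<in> E" for x unfolding \<eta>0_def using E(1) that by (intro Min_le) auto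
  qed
  define \<kappa>0 where "\<kappa>0 = Min (\<kappa> ` E)"
  have \<kappa>0: "\<kappa>0 > 0" "\<And>x. x \<in> E \<Longrightarrow> \<kappa>0 \<le> \<kappa> x"
    unfolding \<kappa>0_def using E U(7) by auto
  have s: "0 \<le> s y" "s y \<le> real d" if "y \<ge> 0" for y using that d by (auto simp: s_def)
  have s_near: "\<bar>s y - real d\<bar> \<le> y" if "y \<ge> 0" for y
  proof -
    have "1 - y / real d \<le> exp (- y / real d)" using exp_ge_add_one_self[of "- y / real d"] by simp
    then have "real d * (1 - y / real d) \<le> s y" unfolding s_def by (intro mult_left_mono) auto
    then show ?thesis using s[OF that] d by (simp add: right_diff_distrib)
  qed
  have near: "cmod (line_coeff d (of_real c) (of_real (s y)) (d * n) - (\<Sum>x\<in>E. main_term d x n y))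
      \<le> 1 / (\<mu> / 2 * r ^ (d * n)) + (\<Sum>x\<in>E. C x / \<rho> ^ (d * n) * ((y + real n * y ^ 2) * exp (- real n * \<kappa>0 * y)))"
    if y: "0 \<le> y" "y \<le> \<eta>0" for y n
  proof -
    have gB: "goodB x (U x) (g x) (C x) (\<kappa> x) y" if "x \<in> E" for x
      using gdB[OF that y(1)] y(2) \<eta>0(3)[OF that] by simp
    note gB = this[unfolded goodB_def]
    note gy1 = gB[THEN conjunct1]
    note gy2 = gB[THEN conjunct2, THEN conjunct1, rule_format]
    note gy3 = gB[THEN conjunct2, THEN conjunct2, THEN conjunct1]
    note gy4 = gB[THEN conjunct2, THEN conjunct2, THEN conjunct2, rule_format]
    have lower: "cmod (P (s y) x) \<ge> \<mu> / 2" if "x \<in> cball 0 r - (\<Union>x\<in>E. U x)" for x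
    proof -
      have "P (real d) x = P (s y) x + (of_real (s y - real d)) * x"
        by (simp add: P_def line_poly_def algebra_simps)
      then have "cmod (P (real d) x) \<le> cmod (P (s y) x) + \<bar>s y - real d\<bar> * cmod x"
        using norm_triangle_ineq[of "P (s y) x" "of_real (s y - real d) * x"]
        by (simp add: norm_mult del: of_real_diff)
      moreover have "\<bar>s y - real d\<bar> * cmod x \<le> \<mu> / (2 * r) * r"
        using s_near[OF y(1)] y(2) \<eta>0(2) that r0 \<mu>(1) by (intro mult_mono) auto
      ultimately show ?thesis using \<mu>(2)[OF that] r0 by simp
    qed
    have Ur: "U x \<subseteq> ball 0 r" if "x \<in> E" for x
    proof
      fix v assume "v \<in> U x"
      then have "dist x v < \<epsilon>" using U(3)[OF that] by auto
      moreover have "cmod v \<le> cmod x + dist x v"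
        using norm_triangle_ineq[of x "v - x"] by (simp add: dist_norm norm_minus_commute)
      ultimately show "v \<in> ball 0 r" using modE[OF that] \<epsilon>(2) by simp
    qed
    have inj: "inj_on (\<lambda>x. g x y) E"
    proof (rule inj_onI, rule ccontr)
      fix x x' assume "x \<in> E" "x' \<in> E" "g x y = g x' y" "x \<noteq> x'"
      then have "g x y \<in> ball x \<epsilon> \<inter> ball x' \<epsilon>" using gy1[of x] gy1[of x'] U(3)[of x] U(3)[of x'] by auto
      then show False using \<epsilon>(3)[OF \<open>x \<in> E\<close> \<open>x' \<in> E\<close> \<open>x \<noteq> x'\<close>] by auto
    qed
    have "cmod (line_coeff d (of_real c) (of_real (s y)) (d * n)
        - (\<Sum>v\<in>(\<lambda>x. g x y) ` E. 1 / (v ^ (d * n) * (of_nat d - (of_nat d - 1) * of_real (s y) * v)))) \<le> 1 / (\<mu> / 2 * r ^ (d * n))"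
    proof (rule line_coeff_residue_estimate)
      show "line_poly d (of_real c) (of_real (s y)) x = 0 \<longleftrightarrow> x \<in> (\<lambda>x. g x y) ` E" if "cmod x < r" for x
      proof
        assume 0: "line_poly d (of_real c) (of_real (s y)) x = 0"
        have "x \<in> (\<Union>x\<in>E. U x)"
        proof (rule ccontr)
          assume "x \<notin> (\<Union>x\<in>E. U x)"
          then show False using lower[of x] that 0 \<mu>(1) by (simp add: P_def)
        qed
        then obtain x' where x': "x' \<in> E" "x \<in> U x'" by blast
        then show "x \<in> (\<lambda>x. g x y) ` E" using gy2[OF x'] 0 by (auto simp: P_def)
      next
        assume "x \<in> (\<lambda>x. g x y) ` E"
        then show "line_poly d (of_real c) (of_real (s y)) x = 0" using gy1 gy2 by (auto simp: P_def)
      qed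
      show "cmod x < r" if "x \<in> (\<lambda>x. g x y) ` E" for x using that gy1 Ur by fastforce
      show "(of_nat d - 1) * of_real (s y) * x \<noteq> of_nat d" if "x \<in> (\<lambda>x. g x y) ` E" for x using that gy3 by auto
      show "cmod (line_poly d (of_real c) (of_real (s y)) x) \<ge> \<mu> / 2" if "cmod x = r" for x
      proof -
        have "x \<notin> (\<Union>x\<in>E. U x)" using Ur that by fastforce
        then show ?thesis using lower[of x] that by (simp add: P_def)
      qed
    qed (use d r0 \<mu> in auto)
    also have "(\<Sum>v\<in>(\<lambda>x. g x y) ` E. 1 / (v ^ (d * n) * (of_nat d - (of_nat d - 1) * of_real (s y) * v)))
       = (\<Sum>x\<in>E. 1 / (g x y ^ (d * n) * (of_nat d - (of_nat d - 1) * of_real (s y) * g x y)))"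
      by (simp add: sum.reindex[OF inj])
    finally have 1: "cmod (line_coeff d (of_real c) (of_real (s y)) (d * n)
        - (\<Sum>x\<in>E. 1 / (g x y ^ (d * n) * (of_nat d - (of_nat d - 1) * of_real (s y) * g x y)))) \<le> 1 / (\<mu> / 2 * r ^ (d * n))" .
    have 2: "cmod ((\<Sum>x\<in>E. 1 / (g x y ^ (d * n) * (of_nat d - (of_nat d - 1) * of_real (s y) * g x y))) - (\<Sum>x\<in>E. main_term d x n y))
        \<le> (\<Sum>x\<in>E. C x / \<rho> ^ (d * n) * ((y + real n * y ^ 2) * exp (- real n * \<kappa>0 * y)))"
      unfolding sum_subtractf[symmetric]
    proof (rule sum_norm_le)
      fix x assume x: "x \<in> E"
      have "exp (- real n * \<kappa> x * y) \<le> exp (- real n * \<kappa>0 * y)"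
        using mult_right_mono[OF mult_left_mono[OF \<kappa>0(2)[OF x], of "real n"] y(1)] by simp
      then have "C x / cmod x ^ (d * n) * ((y + real n * y ^ 2) * exp (- real n * \<kappa> x * y))
         \<le> C x / \<rho> ^ (d * n) * ((y + real n * y ^ 2) * exp (- real n * \<kappa>0 * y))"
        unfolding modE[OF x] using U(6)[OF x] y \<rho> by (intro mult_left_mono) auto
      then show "cmod (1 / (g x y ^ (d * n) * (of_nat d - (of_nat d - 1) * of_real (s y) * g x y)) - main_term d x n y)
        \<le> C x / \<rho> ^ (d * n) * ((y + real n * y ^ 2) * exp (- real n * \<kappa>0 * y))"
        by (rule order_trans[OF gy4[OF x]])
    qed
    show ?thesis using norm_triangle_ineq[of
      "line_coeff d (of_real c) (of_real (s y)) (d * n) - (\<Sum>x\<in>E. 1 / (g x y ^ (d * n) * (of_nat d - (of_nat d - 1) * of_real (s y) * g x y)))"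
      "(\<Sum>x\<in>E. 1 / (g x y ^ (d * n) * (of_nat d - (of_nat d - 1) * of_real (s y) * g x y))) - (\<Sum>x\<in>E. main_term d x n y)"] 1 2
      by simp
  qed
  define s0 where "s0 = s \<eta>0"
  have s0: "s0 < real d" using \<eta>0(1) d by (simp add: s0_def s_def)
  have "\<exists>r \<mu>. r > \<rho> \<and> \<mu> > 0 \<and> (\<forall>s m. 0 \<le> s \<longrightarrow> s \<le> s0 \<longrightarrow> cmod (line_coeff d (of_real c) (of_real s) m) \<le> 1 / (\<mu> * r ^ m))"
  proof (rule line_coeff_small_parameter[OF d \<rho> s0])
    show "\<rho> < cmod x" if "0 \<le> t" "t \<le> s0" "line_poly d (of_real c) (of_real t) x = 0" for t x
      using ge[of t x] eq[of t x] that s0 by (auto simp: less_le)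
  qed
  then obtain r' \<mu>' where r': "r' > \<rho>" "\<mu>' > 0"
    "\<And>t m. 0 \<le> t \<Longrightarrow> t \<le> s0 \<Longrightarrow> cmod (line_coeff d (of_real c) (of_real t) m) \<le> 1 / (\<mu>' * r' ^ m)"
    by blast
  define B where "B = (\<Sum>x\<in>E. 1 / cmod (of_nat d * (1 - (of_nat d - 1) * x)))"
  have main_bound: "cmod (\<Sum>x\<in>E. main_term d x n y) \<le> B / \<rho> ^ (d * n) * exp (- real n * \<kappa>0 * \<eta>0)" if y: "y \<ge> \<eta>0" for n y
  proof -
    have "cmod (\<Sum>x\<in>E. main_term d x n y) \<le> (\<Sum>x\<in>E. 1 / cmod (of_nat d * (1 - (of_nat d - 1) * x)) / \<rho> ^ (d * n) * exp (- real n * \<kappa>0 * \<eta>0))"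
    proof (rule sum_norm_le)
      fix x assume x: "x \<in> E"
      define L where "L = x / (1 - (of_nat d - 1) * x)"
      have "\<kappa>0 * \<eta>0 \<le> Re L * y"
        using \<kappa>0(1) \<kappa>0(2)[OF x] U(8)[OF x] \<eta>0(1) y unfolding L_def by (intro mult_mono) auto
      then have "real n * (\<kappa>0 * \<eta>0) \<le> real n * (Re L * y)"
        by (rule mult_left_mono) simp
      then have "exp (Re (- of_nat n * L * of_real y)) \<le> exp (- real n * \<kappa>0 * \<eta>0)"
        by (simp add: mult.assoc)
      then show "cmod (main_term d x n y) \<le> 1 / cmod (of_nat d * (1 - (of_nat d - 1) * x)) / \<rho> ^ (d * n) * exp (- real n * \<kappa>0 * \<eta>0)"
        unfolding main_term_def norm_mult norm_divide norm_power modE[OF x] norm_exp_eq_Re L_def[symmetric]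
        using \<rho> by (simp add: field_simps divide_right_mono mult_left_mono)
    qed
    also have "\<dots> = B / \<rho> ^ (d * n) * exp (- real n * \<kappa>0 * \<eta>0)"
      by (simp add: B_def sum_distrib_right sum_divide_distrib)
    finally show ?thesis .
  qed
  \<comment> \<open>The three ratios are the error on the circle for small \<open>y\<close>, the
    coefficient for large \<open>y\<close>, and the decay of the main terms for large
    \<open>y\<close>.\<close>
  define \<theta> where "\<theta> = max (max ((\<rho> / r) ^ d) ((\<rho> / r') ^ d)) (exp (- \<kappa>0 * \<eta>0))"
  have \<theta>: "0 < \<theta>" "\<theta> < 1"
  proof -
    show "0 < \<theta>" by (auto simp: \<theta>_def less_max_iff_disj)
    have "(\<rho> / r) ^ d < 1" "(\<rho> / r') ^ d < 1" using \<rho> r(1) r'(1) d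
      by (auto intro!: power_less_one_iff[THEN iffD2])
    then show "\<theta> < 1" using \<kappa>0(1) \<eta>0(1) by (simp add: \<theta>_def)
  qed
  have \<theta>n: "1 / R ^ (d * n) \<le> 1 / \<rho> ^ (d * n) * \<theta> ^ n" if "(\<rho> / R) ^ d \<le> \<theta>" "R > 0" for R n
  proof -
    have "1 / R ^ (d * n) = 1 / \<rho> ^ (d * n) * ((\<rho> / R) ^ d) ^ n"
      using \<rho> that by (simp add: power_mult[symmetric] power_divide)
    also have "\<dots> \<le> 1 / \<rho> ^ (d * n) * \<theta> ^ n"
      using that \<rho> by (intro mult_left_mono power_mono) auto
    finally show ?thesis .
  qed
  have \<theta>e: "exp (- real n * \<kappa>0 * \<eta>0) \<le> \<theta> ^ n" for n
  proof -
    have "exp (- real n * \<kappa>0 * \<eta>0) = exp (- \<kappa>0 * \<eta>0) ^ n"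
      by (simp add: exp_of_nat_mult[symmetric] mult.assoc)
    also have "\<dots> \<le> \<theta> ^ n" by (intro power_mono) (auto simp: \<theta>_def)
    finally show ?thesis .
  qed
  define C0 where "C0 = 2 / \<mu> + 1 / \<mu>' + B + (\<Sum>x\<in>E. C x)"
  have B0: "B \<ge> 0" unfolding B_def by (intro sum_nonneg) auto
  have CE: "(\<Sum>x\<in>E. C x) \<ge> 0" using U(6) by (intro sum_nonneg) auto
  have C0: "C0 \<ge> 0" "2 / \<mu> \<le> C0" "1 / \<mu>' + B \<le> C0" "(\<Sum>x\<in>E. C x) \<le> C0"
    using B0 CE \<mu>(1) r'(2) by (auto simp: C0_def add_nonneg_nonneg)
  have fin: "cmod (line_coeff d (of_real c) (of_real (s y)) (d * n) - (\<Sum>x\<in>E. main_term d x n y))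
        \<le> C0 / \<rho> ^ (d * n) * ((y + real n * y ^ 2) * exp (- real n * \<kappa>0 * y) + \<theta> ^ n)" if y: "y \<ge> 0" for n y
  proof -
    define w where "w = (y + real n * y ^ 2) * exp (- real n * \<kappa>0 * y)"
    define p where "p = 1 / \<rho> ^ (d * n)"
    have w: "w \<ge> 0" and p: "p \<ge> 0" using y \<rho> by (auto simp: w_def p_def)
    have tn: "\<theta> ^ n \<ge> 0" using \<theta> by simp
    have "cmod (line_coeff d (of_real c) (of_real (s y)) (d * n) - (\<Sum>x\<in>E. main_term d x n y)) \<le> C0 * (p * (w + \<theta> ^ n))"
    proof (cases "y \<le> \<eta>0")
      case True
      have "1 / (\<mu> / 2 * r ^ (d * n)) = 2 / \<mu> * (1 / r ^ (d * n))" using \<mu>(1) by simp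
      also have "\<dots> \<le> 2 / \<mu> * (p * \<theta> ^ n)"
        unfolding p_def using \<mu>(1) r0 by (intro mult_left_mono \<theta>n) (auto simp: \<theta>_def)
      also have "\<dots> \<le> C0 * (p * \<theta> ^ n)" using C0 p tn by (intro mult_right_mono) auto
      finally have 1: "1 / (\<mu> / 2 * r ^ (d * n)) \<le> C0 * (p * \<theta> ^ n)" .
      have "(\<Sum>x\<in>E. C x / \<rho> ^ (d * n) * w) = (\<Sum>x\<in>E. C x) * (p * w)"
        by (simp add: p_def sum_distrib_right sum_divide_distrib)
      also have "\<dots> \<le> C0 * (p * w)" using C0 p w by (intro mult_right_mono) auto
      finally have 2: "(\<Sum>x\<in>E. C x / \<rho> ^ (d * n) * w) \<le> C0 * (p * w)" .
      show ?thesis using near[OF y True, of n] 1 2 unfolding w_def[symmetric] by (simp add: distrib_left)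
    next
      case False
      then have "s y \<le> s0" using d by (simp add: s_def s0_def divide_right_mono)
      have "cmod (line_coeff d (of_real c) (of_real (s y)) (d * n)) \<le> 1 / \<mu>' * (1 / r' ^ (d * n))"
        using r'(3)[OF s(1)[OF y] \<open>s y \<le> s0\<close>, of "d * n"] by simp
      also have "\<dots> \<le> 1 / \<mu>' * (p * \<theta> ^ n)"
        unfolding p_def using r' \<rho> by (intro mult_left_mono \<theta>n) (auto simp: \<theta>_def)
      finally have 1: "cmod (line_coeff d (of_real c) (of_real (s y)) (d * n)) \<le> 1 / \<mu>' * (p * \<theta> ^ n)" .
      have "cmod (\<Sum>x\<in>E. main_term d x n y) \<le> B / \<rho> ^ (d * n) * exp (- real n * \<kappa>0 * \<eta>0)"
        using main_bound[of y n] False by simp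
      also have "\<dots> \<le> B / \<rho> ^ (d * n) * \<theta> ^ n" using B0 \<rho> by (intro mult_left_mono \<theta>e) auto
      also have "\<dots> = B * (p * \<theta> ^ n)" by (simp add: p_def)
      finally have 2: "cmod (\<Sum>x\<in>E. main_term d x n y) \<le> B * (p * \<theta> ^ n)" .
      have "cmod (line_coeff d (of_real c) (of_real (s y)) (d * n) - (\<Sum>x\<in>E. main_term d x n y))
         \<le> 1 / \<mu>' * (p * \<theta> ^ n) + B * (p * \<theta> ^ n)"
        using norm_triangle_ineq4[of "line_coeff d (of_real c) (of_real (s y)) (d * n)" "\<Sum>x\<in>E. main_term d x n y"] 1 2 by linarith
      also have "\<dots> = (1 / \<mu>' + B) * (p * \<theta> ^ n)" by (simp only: distrib_right)
      also have "\<dots> \<le> C0 * (p * (w + \<theta> ^ n))"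
        using C0 p w tn B0 r'(2) by (intro mult_mono mult_left_mono) auto
      finally show ?thesis .
    qed
    then show ?thesis unfolding w_def p_def by simp
  qed
  have kap: "\<forall>x\<in>E. \<kappa>0 \<le> Re (x / (1 - (of_nat d - 1) * x))"
  proof
    fix x assume "x \<in> E"
    then show "\<kappa>0 \<le> Re (x / (1 - (of_nat d - 1) * x))" using order_trans[OF \<kappa>0(2) U(8)] by simp
  qed
  show ?thesis
    by (rule exI[of _ C0], rule exI[of _ \<kappa>0], rule exI[of _ \<theta>],
        intro conjI C0(1) \<kappa>0(1) \<theta> kap allI impI fin[unfolded s_def])
qed

section \<open>The nondegenerate case\<close>

lemma diagonal_expectation:
  assumes d: "d \<ge> 1" and M: "nonneg_law M"
    and mom: "\<And>k. laplace M (of_nat k) = of_real (fact (d * k) / (real d ^ (d * k) * fact k ^ d))"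
  shows "(\<Sum>k\<le>n. (- c) ^ k * fact (d * (n - k) + k) / (fact k * fact (n - k) ^ d))
       = (LINT y|M. line_coeff d c (of_real (real d * exp (- y / real d))) (d * n))"
proof -
  have pw: "complex_of_real (real d * exp (- y / real d)) ^ (d * j) = of_nat d ^ (d * j) * exp (- of_nat j * of_real y)" for y j
  proof -
    have "exp (- y / real d) ^ (d * j) = exp (real (d * j) * (- y / real d))" by (rule exp_of_nat_mult[symmetric])
    also have "real (d * j) * (- y / real d) = - real j * y" using d by simp
    finally have "complex_of_real (exp (- y / real d) ^ (d * j)) = exp (- of_nat j * of_real y)"
      by (simp add: exp_of_real[symmetric])
    then show ?thesis by (simp add: power_mult_distrib)
  qed
  have int: "integrable M (\<lambda>y. exp (- of_nat j * complex_of_real y))" for j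
    by (rule laplace_integrable[OF M]) simp
  have "(LINT y|M. line_coeff d c (of_real (real d * exp (- y / real d))) (d * n))
     = (LINT y|M. (\<Sum>k\<le>n. (- c) ^ k * of_nat (d * (n - k) + k choose k) * of_nat d ^ (d * (n - k)) * exp (- of_nat (n - k) * of_real y)))"
    unfolding line_coeff_mult[OF d] pw by (simp add: mult.assoc)
  also have "\<dots> = (\<Sum>k\<le>n. (- c) ^ k * of_nat (d * (n - k) + k choose k) * of_nat d ^ (d * (n - k)) * laplace M (of_nat (n - k)))"
    unfolding laplace_def
    by (subst Bochner_Integration.integral_sum, intro integrable_mult_right int, simp only: integral_mult_right_zero)
  also have "\<dots> = (\<Sum>k\<le>n. (- c) ^ k * fact (d * (n - k) + k) / (fact k * fact (n - k) ^ d))"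
  proof (rule sum.cong[OF refl])
    fix k assume "k \<in> {..n}"
    define j where "j = n - k"
    \<comment> \<open>The factor \<open>fact (d * j)\<close> in the denominator of the binomial
      coefficient cancels against the numerator of the moment, which leaves the multinomial
      weight.\<close>
    have b: "(of_nat (d * j + k choose k) :: complex) = fact (d * j + k) / (fact k * fact (d * j))"
      by (subst binomial_fact) auto
    have l: "of_nat d ^ (d * j) * laplace M (of_nat j) = fact (d * j) / fact j ^ d"
      unfolding mom using d by simp
    have "(- c) ^ k * of_nat (d * j + k choose k) * of_nat d ^ (d * j) * laplace M (of_nat j)
        = (- c) ^ k * of_nat (d * j + k choose k) * (of_nat d ^ (d * j) * laplace M (of_nat j))"
      by (simp only: mult.assoc)
    also have "\<dots> = (- c) ^ k * fact (d * j + k) / (fact k * fact j ^ d)"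
      unfolding l b by simp
    finally show "(- c) ^ k * of_nat (d * (n - k) + k choose k) * of_nat d ^ (d * (n - k)) * laplace M (of_nat (n - k))
       = (- c) ^ k * fact (d * (n - k) + k) / (fact k * fact (n - k) ^ d)"
      unfolding j_def .
  qed
  finally show ?thesis ..
qed

text \<open>Half of the exponential, with \<open>t = n * \<kappa> * y / 2\<close>, absorbs the
  polynomial factor and yields \<open>1 / n\<close>. The other half is kept, because its mean
  supplies the remaining power of \<open>n\<close>.\<close>

lemma exp_polynomial_bound:
  fixes \<kappa> y :: real
  assumes "n \<ge> 1" "\<kappa> > 0" "y \<ge> 0"
  shows "(y + real n * y ^ 2) * exp (- real n * \<kappa> * y) \<le> (2 / \<kappa> + 8 / \<kappa> ^ 2) / real n * exp (- (real n * \<kappa> / 2) * y)"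
proof -
  define t where "t = real n * \<kappa> / 2 * y"
  have t: "t \<ge> 0" using assms by (simp add: t_def)
  have y: "y = 2 / \<kappa> / real n * t" using assms by (simp add: t_def)
  have e: "exp t \<ge> 1 + t + t ^ 2 / 2" using exp_lower_Taylor_quadratic[OF t] .
  have pos: "exp (- t) > 0" "exp (- t) * exp t = 1" by (simp_all add: exp_minus)
  have t1: "t * exp (- t) \<le> 1"
  proof -
    have "t \<le> exp t" using e t by (smt (verit) zero_le_power2 divide_nonneg_nonneg)
    then have "exp (- t) * t \<le> exp (- t) * exp t" using pos(1) by (intro mult_left_mono) auto
    then show ?thesis unfolding pos(2) by (simp only: mult.commute)
  qed
  have t2: "t ^ 2 * exp (- t) \<le> 2"
  proof -
    have "t ^ 2 \<le> 2 * exp t" using e t by simp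
    then have "exp (- t) * t ^ 2 \<le> exp (- t) * (2 * exp t)" using pos(1) by (intro mult_left_mono) auto
    also have "\<dots> = 2 * (exp (- t) * exp t)" by simp
    finally show ?thesis unfolding pos(2) by (simp only: mult.commute mult_1_right)
  qed
  have "exp (- real n * \<kappa> * y) = exp (- t) * exp (- t)"
    by (simp add: t_def exp_add[symmetric])
  then have "(y + real n * y ^ 2) * exp (- real n * \<kappa> * y)
      = (2 / \<kappa> / real n * (t * exp (- t)) + 4 / \<kappa> ^ 2 / real n * (t ^ 2 * exp (- t))) * exp (- t)"
    using assms by (subst y, subst y) (simp add: field_simps power2_eq_square)
  also have "\<dots> \<le> (2 / \<kappa> / real n * 1 + 4 / \<kappa> ^ 2 / real n * 2) * exp (- t)"
    using t1 t2 assms by (intro mult_right_mono add_mono mult_left_mono) auto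
  also have "\<dots> = (2 / \<kappa> + 8 / \<kappa> ^ 2) / real n * exp (- t)" by (simp add: add_divide_distrib)
  finally show ?thesis by (simp add: t_def)
qed

text \<open>Identifies the contribution with the residue factor times the leading term
  \<open>K / (n * lam) powr \<beta>\<close> of the Laplace transform. Since \<open>lam\<close> and
  \<open>q = 1 / lam\<close> both lie in the open right half-plane, their principal powers are
  reciprocal; \<open>n\<close> and \<open>2 * pi\<close> split off as positive reals.\<close>

lemma diag_contribution_eq:
  fixes x :: complex
  assumes d: "d \<ge> 2" and re: "Re (1 / x) > real d - 1" and n: "n \<ge> 1"
  defines "lam \<equiv> x / (1 - (of_nat d - 1) * x)" and "\<beta> \<equiv> (real d - 1) / 2"
  shows "diag_contribution d x n = 1 / (x ^ (d * n) * (of_nat d * (1 - (of_nat d - 1) * x)))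
      * (of_real (sqrt d / (2 * pi) powr \<beta>) / (of_nat n * lam) powr of_real \<beta>)"
proof -
  have x0: "x \<noteq> 0" using re d by auto
  define q where "q = (1 - (of_nat d - 1) * x) / x"
  have "q = 1 / x - (of_nat d - 1)" using x0 by (simp add: q_def field_simps)
  then have Req: "Re q > 0" using re by simp
  then have q0: "q \<noteq> 0" by auto
  have lamq: "lam = 1 / q" by (simp add: lam_def q_def)
  have Relam: "Re lam > 0"
  proof -
    have "Re (1 / q) = Re q / ((Re q)\<^sup>2 + (Im q)\<^sup>2)" by (simp add: Re_divide)
    moreover have "(Re q)\<^sup>2 + (Im q)\<^sup>2 > 0" using Req by (intro add_pos_nonneg) auto
    ultimately show ?thesis using Req unfolding lamq by (simp only: divide_pos_pos)
  qed
  have qpos: "q powr of_real \<beta> \<noteq> 0" using q0 by simp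
  have "q powr of_real \<beta> * lam powr of_real \<beta> = (q * lam) powr of_real \<beta>"
    by (rule powr_mult_right_half_plane[symmetric, OF Req Relam])
  also have "\<dots> = 1" using q0 by (simp add: lamq)
  finally have lamp: "lam powr of_real \<beta> = 1 / q powr of_real \<beta>" unfolding nonzero_eq_divide_eq[OF qpos] by (simp only: mult.commute)
  have "(of_nat n * lam) powr of_real \<beta> = of_real (real n) powr of_real \<beta> * lam powr of_real \<beta>"
    using powr_times_real_left[of "of_real (real n)" lam "of_real \<beta>"] by simp
  also have "of_real (real n) powr (of_real \<beta> :: complex) = of_real (real n powr \<beta>)" by (rule powr_of_real) simp
  finally have np: "(of_nat n * lam) powr of_real \<beta> = of_real (real n powr \<beta>) / q powr of_real \<beta>" by (simp add: lamp)
  have "q = of_real (2 * pi) * ((1 - (of_nat d - 1) * x) / (2 * of_real pi * x))"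
    using x0 by (simp add: q_def field_simps)
  then have "q powr of_real \<beta> = of_real (2 * pi) powr of_real \<beta> * ((1 - (of_nat d - 1) * x) / (2 * of_real pi * x)) powr of_real \<beta>"
    by (simp only:) (rule powr_times_real_left; simp)
  also have "of_real (2 * pi) powr (of_real \<beta> :: complex) = of_real ((2 * pi) powr \<beta>)" by (rule powr_of_real) simp
  finally have qp: "((1 - (of_nat d - 1) * x) / (2 * of_real pi * x)) powr of_real \<beta> = q powr of_real \<beta> / of_real ((2 * pi) powr \<beta>)"
    by simp
  have xp: "x powi (- int (d * n)) = 1 / x ^ (d * n)"
    by (simp only: power_int_minus power_int_of_nat inverse_eq_divide)
  have sq: "(of_nat d :: complex) = of_real (sqrt d) * of_real (sqrt d)"
    by (simp flip: of_real_mult)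
  have sd: "complex_of_real (sqrt d) \<noteq> 0" using d by simp
  have frac: "1 / X / N * (Q / P) * (1 / (s * u)) = 1 / (X * (s * s * u)) * (s / P / (N / Q))"
    if "s \<noteq> 0" for X N Q P s u :: complex
    using that by (simp add: divide_simps)
  show ?thesis
    unfolding diag_contribution_def \<beta>_def[symmetric] qp xp np
    unfolding sq of_real_divide by (rule frac[OF sd])
qed

text \<open>The pointwise bound is integrated against the multinomial law. The asymptotics of the
  transform serves both sides: at \<open>n * lm x\<close> it evaluates the main terms, and at the
  real point \<open>n * \<kappa> / 2\<close> it adds the decay \<open>n powr (- \<beta>)\<close> to
  the \<open>1 / n\<close> of the error.\<close>

lemma diagonal_asymptotics:
  fixes c :: real and \<delta> :: "nat \<Rightarrow> complex"
  assumes d: "d \<ge> 2" and cd: "c \<noteq> (real d - 1) ^ (d - 1)" "c < (real d - 1) ^ (d - 1) \<or> d \<ge> 3"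
    and E: "E = min_modulus_roots (diag_poly d c)"
    and \<delta>: "\<And>n. \<delta> n = (\<Sum>k\<le>n. (- of_real c) ^ k * fact (d * (n - k) + k) / (fact k * fact (n - k) ^ d))"
  shows "\<exists>\<rho> C. \<rho> > 0 \<and> finite E \<and> E \<noteq> {} \<and> (\<forall>x\<in>E. cmod x = \<rho> \<and> 1 - (of_nat d - 1) * x \<noteq> 0) \<and>
    (\<forall>\<^sub>F n in sequentially. cmod (\<delta> n - (\<Sum>x\<in>E. diag_contribution d x n)) \<le> C / \<rho> ^ (d * n) * (1 / (real n powr ((real d - 1) / 2) * real n)))"
proof -
  define \<beta> where "\<beta> = (real d - 1) / 2"
  define K where "K = sqrt d / (2 * pi) powr \<beta>"
  obtain \<rho> where D: "dominant d c E \<rho>" using dominant_min_modulus_roots[OF d cd E] ..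
  then have \<rho>: "\<rho> > 0" and finE: "finite E" and neE: "E \<noteq> {}"
    and modE: "\<And>x. x \<in> E \<Longrightarrow> cmod x = \<rho>"
    and ReE: "\<And>x. x \<in> E \<Longrightarrow> Re (1 / x) > real d - 1"
    unfolding dominant_def by simp_all
  obtain C \<kappa> \<theta> where C: "C \<ge> 0" "\<kappa> > 0" "0 < \<theta>" "\<theta> < 1"
    and re\<kappa>: "\<forall>x\<in>E. \<kappa> \<le> Re (x / (1 - (of_nat d - 1) * x))"
    and pw: "\<forall>n y. y \<ge> 0 \<longrightarrow> cmod (line_coeff d (of_real c) (of_real (real d * exp (- y / real d))) (d * n) - (\<Sum>x\<in>E. main_term d x n y))
        \<le> C / \<rho> ^ (d * n) * ((y + real n * y ^ 2) * exp (- real n * \<kappa> * y) + \<theta> ^ n)"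
    using line_coeff_pointwise[OF d D] by (elim exE conjE) (rule that; assumption)
  obtain M where M: "nonneg_law M"
    and mom: "\<And>k. laplace M (of_nat k) = of_real (fact (d * k) / (real d ^ (d * k) * fact k ^ d))"
    and asy: "laplace_asymp (laplace M) \<beta> K"
    using multinomial_law_exists[of d] d unfolding \<beta>_def K_def by auto
  interpret prob_space M using M by (simp add: nonneg_law_def)
  have sets_M [measurable_cong]: "sets M = sets borel" using M by (simp add: nonneg_law_def)
  have AE_M: "AE y in M. y \<ge> 0" using M by (simp add: nonneg_law_def)
  obtain CL R where L: "\<forall>\<zeta>. Re \<zeta> > 0 \<longrightarrow> cmod \<zeta> \<ge> R \<longrightarrow>
      cmod (laplace M \<zeta> * \<zeta> powr of_real \<beta> - of_real K) \<le> CL / cmod \<zeta>"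
    using asy unfolding laplace_asymp_def by blast
  define lm where "lm x = x / (1 - (of_nat d - 1) * x)" for x :: complex
  define A where "A x = of_nat d * (1 - (of_nat d - 1) * x)" for x :: complex
  have lm_Re: "Re (lm x) > 0" if "x \<in> E" for x using re\<kappa> that C(2) unfolding lm_def by force
  have nzE: "1 - (of_nat d - 1) * x \<noteq> 0" if "x \<in> E" for x using lm_Re[OF that] by (auto simp: lm_def)
  have mt: "main_term d x n y = 1 / (x ^ (d * n) * A x) * exp (- (of_nat n * lm x) * of_real y)" for x n y
    by (simp add: main_term_def A_def lm_def)
  have int_mt: "integrable M (main_term d x n)" if "x \<in> E" for x n
    unfolding mt[abs_def] using lm_Re[OF that] by (intro integrable_mult_right laplace_integrable[OF M]) auto
  have LINT_mt: "(LINT y|M. main_term d x n y) = 1 / (x ^ (d * n) * A x) * laplace M (of_nat n * lm x)" for x n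
    unfolding mt laplace_def by simp
  have int_lc: "integrable M (\<lambda>y. line_coeff d (of_real c) (of_real (real d * exp (- y / real d))) (d * n))" for n
  proof -
    have "continuous_on {0..real d} (\<lambda>s. cmod (line_coeff d (of_real c) (of_real s) (d * n)))"
      unfolding line_coeff_def by (intro continuous_intros)
    then have "bounded ((\<lambda>s. cmod (line_coeff d (of_real c) (of_real s) (d * n))) ` {0..real d})"
      by (intro compact_imp_bounded compact_continuous_image) auto
    then obtain B where B: "\<And>s. s \<in> {0..real d} \<Longrightarrow> cmod (line_coeff d (of_real c) (of_real s) (d * n)) \<le> B"
      unfolding bounded_iff by force
    show ?thesis
    proof (rule nonneg_law_integrable[OF M])
      show "(\<lambda>y. line_coeff d (of_real c) (of_real (real d * exp (- y / real d))) (d * n)) \<in> borel_measurable borel"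
        unfolding line_coeff_def by measurable
      show "norm (line_coeff d (of_real c) (of_real (real d * exp (- y / real d))) (d * n)) \<le> B" if "y \<ge> 0" for y
        by (rule B) (use that d in auto)
    qed
  qed
  have \<delta>_int: "\<delta> n = (LINT y|M. line_coeff d (of_real c) (of_real (real d * exp (- y / real d))) (d * n))" for n
    unfolding \<delta> by (rule diagonal_expectation[OF _ M mom]) (use d in simp)
  define B1 where "B1 = 2 / \<kappa> + 8 / \<kappa> ^ 2"
  have B1: "B1 \<ge> 0" using C(2) by (simp add: B1_def)
  have int_e: "integrable M (\<lambda>y. exp (- a * y))" if "a \<ge> 0" for a :: real
    by (rule nonneg_law_integrable[OF M, of _ 1]) (use that in auto)
  have step1: "cmod (\<delta> n - (\<Sum>x\<in>E. 1 / (x ^ (d * n) * A x) * laplace M (of_nat n * lm x)))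
      \<le> C / \<rho> ^ (d * n) * (B1 / real n * cmod (laplace M (of_real (real n * \<kappa> / 2))) + \<theta> ^ n)" if n: "n \<ge> 1" for n
  proof -
    define F where "F y = line_coeff d (of_real c) (of_real (real d * exp (- y / real d))) (d * n) - (\<Sum>x\<in>E. main_term d x n y)" for y
    define G where "G y = C / \<rho> ^ (d * n) * (B1 / real n * exp (- (real n * \<kappa> / 2) * y) + \<theta> ^ n)" for y
    have nk: "real n * \<kappa> / 2 \<ge> 0" using C(2) by simp
    have "\<delta> n - (\<Sum>x\<in>E. 1 / (x ^ (d * n) * A x) * laplace M (of_nat n * lm x)) = (LINT y|M. F y)"
    proof -
      have i1: "integrable M (\<lambda>y. \<Sum>x\<in>E. main_term d x n y)"
        by (intro Bochner_Integration.integrable_sum int_mt)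
      have "(LINT y|M. F y) = \<delta> n - (LINT y|M. (\<Sum>x\<in>E. main_term d x n y))"
        unfolding F_def \<delta>_int by (rule Bochner_Integration.integral_diff[OF int_lc i1])
      also have "(LINT y|M. (\<Sum>x\<in>E. main_term d x n y)) = (\<Sum>x\<in>E. LINT y|M. main_term d x n y)"
        by (rule Bochner_Integration.integral_sum[OF int_mt])
      finally show ?thesis unfolding LINT_mt ..
    qed
    also have "cmod \<dots> \<le> (LINT y|M. G y)"
    proof (rule norm_integral_le_AE)
      show "integrable M F" unfolding F_def by (intro Bochner_Integration.integrable_diff int_lc Bochner_Integration.integrable_sum int_mt)
      show "integrable M G" unfolding G_def by (intro integrable_mult_right Bochner_Integration.integrable_add int_e[OF nk] integrable_const)
      show "AE y in M. norm (F y) \<le> G y"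
        using AE_M
      proof (rule eventually_mono)
        fix y :: real assume y: "y \<ge> 0"
        have "norm (F y) \<le> C / \<rho> ^ (d * n) * ((y + real n * y ^ 2) * exp (- real n * \<kappa> * y) + \<theta> ^ n)"
          using pw y by (simp add: F_def)
        also have "\<dots> \<le> G y" unfolding G_def B1_def
          using exp_polynomial_bound[OF n C(2) y] C(1) \<rho> by (intro mult_left_mono add_mono) auto
        finally show "norm (F y) \<le> G y" .
      qed
    qed
    also have "(LINT y|M. G y) = C / \<rho> ^ (d * n) * (B1 / real n * (LINT y|M. exp (- (real n * \<kappa> / 2) * y)) + \<theta> ^ n)"
      unfolding G_def using int_e[OF nk] by (simp add: prob_space Bochner_Integration.integral_add)
    also have "(LINT y|M. exp (- (real n * \<kappa> / 2) * y)) = cmod (laplace M (of_real (real n * \<kappa> / 2)))"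
    proof -
      have "laplace M (of_real (real n * \<kappa> / 2)) = (LINT y|M. of_real (exp (- (real n * \<kappa> / 2) * y)))"
        unfolding laplace_def by (simp add: exp_of_real[symmetric])
      also have "\<dots> = of_real (LINT y|M. exp (- (real n * \<kappa> / 2) * y))" by (rule integral_complex_of_real)
      finally show ?thesis by simp
    qed
    finally show ?thesis .
  qed
  define CL' where "CL' = \<bar>CL\<bar>"
  have CL': "CL' \<ge> 0" by (simp add: CL'_def)
  have L': "cmod (laplace M \<zeta> * \<zeta> powr of_real \<beta> - of_real K) \<le> CL' / cmod \<zeta>" if "Re \<zeta> > 0" "cmod \<zeta> \<ge> R" for \<zeta>
  proof -
    have "CL / cmod \<zeta> \<le> CL' / cmod \<zeta>" by (intro divide_right_mono) (auto simp: CL'_def)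
    then show ?thesis using L that by force
  qed
  define S where "S = (\<Sum>x\<in>E. CL' / (cmod (A x) * cmod (lm x powr of_real \<beta>) * cmod (lm x)))"
  define C3 where "C3 = (\<bar>K\<bar> + CL') / (\<kappa> / 2) powr \<beta>"
  have C3: "C3 \<ge> 0" using CL' by (simp add: C3_def)
  define CF where "CF = S + C * (B1 * C3 + 1)"
  have npw: "cmod ((of_nat n * lm x) powr of_real \<beta>) = real n powr \<beta> * cmod (lm x powr of_real \<beta>)" for n x
  proof -
    have "(of_nat n * lm x) powr of_real \<beta> = of_real (real n) powr of_real \<beta> * lm x powr of_real \<beta>"
      using powr_times_real_left[of "of_real (real n)" "lm x" "of_real \<beta>"] by simp
    also have "of_real (real n) powr (of_real \<beta> :: complex) = of_real (real n powr \<beta>)" by (rule powr_of_real) simp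
    finally show ?thesis by (simp add: norm_mult)
  qed
  have big: "\<forall>\<^sub>F n in sequentially. real n * a \<ge> R'" if "a > 0" for a R' :: real
    using that by real_asymp
  have ev1: "\<forall>\<^sub>F n in sequentially. \<forall>x\<in>E. real n * cmod (lm x) \<ge> R"
    using finE big lm_Re by (intro eventually_ball_finite ballI big) (force simp: )+
  have ev2: "\<forall>\<^sub>F n in sequentially. real n * (\<kappa> / 2) \<ge> max R 1" using big C(2) by simp
  \<comment> \<open>The exponentially small part of the error is absorbed into the power of
    \<open>n\<close>.\<close>
  have ev3: "\<forall>\<^sub>F n in sequentially. \<theta> ^ n \<le> 1 / (real n powr \<beta> * real n)"
    using C(3,4) by real_asymp
  have "\<forall>\<^sub>F n in sequentially. cmod (\<delta> n - (\<Sum>x\<in>E. diag_contribution d x n)) \<le> CF / \<rho> ^ (d * n) * (1 / (real n powr \<beta> * real n))"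
    using eventually_ge_at_top[of 1] ev1 ev2 ev3
  proof eventually_elim
    case (elim n)
    define w where "w = 1 / (real n powr \<beta> * real n)"
    have n: "real n > 0" using elim(1) by simp
    have w: "w > 0" using n by (simp add: w_def)
    have main: "cmod ((\<Sum>x\<in>E. 1 / (x ^ (d * n) * A x) * laplace M (of_nat n * lm x)) - (\<Sum>x\<in>E. diag_contribution d x n)) \<le> S * (1 / \<rho> ^ (d * n) * w)"
      unfolding sum_subtractf[symmetric] S_def sum_distrib_right
    proof (rule sum_norm_le)
      fix x assume x: "x \<in> E"
      define \<zeta> where "\<zeta> = of_nat n * lm x"
      define p where "p = \<zeta> powr of_real \<beta>"
      have "Re \<zeta> > 0" using lm_Re[OF x] n by (simp add: \<zeta>_def)
      then have "\<zeta> \<noteq> 0" by auto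
      then have p0: "p \<noteq> 0" by (simp add: p_def)
      have c\<zeta>: "cmod \<zeta> = real n * cmod (lm x)" by (simp add: \<zeta>_def norm_mult)
      have dc: "diag_contribution d x n = 1 / (x ^ (d * n) * A x) * (of_real K / p)"
        unfolding A_def K_def p_def \<zeta>_def lm_def \<beta>_def by (rule diag_contribution_eq[OF d ReE[OF x] elim(1)])
      have "1 / (x ^ (d * n) * A x) * laplace M \<zeta> - diag_contribution d x n
          = 1 / (x ^ (d * n) * A x) * ((laplace M \<zeta> * p - of_real K) / p)"
        unfolding dc using p0 by (simp add: diff_divide_distrib right_diff_distrib)
      also have "cmod \<dots> = 1 / (\<rho> ^ (d * n) * cmod (A x)) * (cmod (laplace M \<zeta> * p - of_real K) / cmod p)"
        by (simp add: norm_mult norm_divide norm_power modE[OF x])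
      also have "\<dots> \<le> 1 / (\<rho> ^ (d * n) * cmod (A x)) * (CL' / cmod \<zeta> / cmod p)"
        using L'[OF \<open>Re \<zeta> > 0\<close>] elim(2) x c\<zeta> \<rho> unfolding p_def[symmetric]
        by (intro mult_left_mono divide_right_mono) auto
      also have "cmod p = real n powr \<beta> * cmod (lm x powr of_real \<beta>)" unfolding p_def \<zeta>_def by (rule npw)
      also have "1 / (\<rho> ^ (d * n) * cmod (A x)) * (CL' / cmod \<zeta> / (real n powr \<beta> * cmod (lm x powr of_real \<beta>)))
          = CL' / (cmod (A x) * cmod (lm x powr of_real \<beta>) * cmod (lm x)) * (1 / \<rho> ^ (d * n) * w)"
        unfolding c\<zeta> w_def by simp
      finally show "cmod (1 / (x ^ (d * n) * A x) * laplace M (of_nat n * lm x) - diag_contribution d x n)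
         \<le> CL' / (cmod (A x) * cmod (lm x powr of_real \<beta>) * cmod (lm x)) * (1 / \<rho> ^ (d * n) * w)"
        unfolding \<zeta>_def .
    qed
    have lap: "cmod (laplace M (of_real (real n * \<kappa> / 2))) \<le> C3 / real n powr \<beta>"
    proof -
      define u where "u = real n * \<kappa> / 2"
      have u: "u \<ge> 1" "u \<ge> R" using elim(3) by (auto simp: u_def)
      have up: "of_real u powr (of_real \<beta> :: complex) = of_real (u powr \<beta>)" using u by (intro powr_of_real) auto
      have "cmod (laplace M (of_real u) * of_real (u powr \<beta>) - of_real K) \<le> CL' / u"
        using L'[of "of_real u"] u up by simp
      also have "\<dots> \<le> CL'" using CL' u by (simp add: divide_le_eq mult_left_le mult_le_cancel_left1)
      finally have "cmod (laplace M (of_real u) * of_real (u powr \<beta>)) \<le> \<bar>K\<bar> + CL'"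
        using norm_triangle_sub[of "laplace M (of_real u) * of_real (u powr \<beta>)" "of_real K"] by simp
      then have "cmod (laplace M (of_real u)) * u powr \<beta> \<le> \<bar>K\<bar> + CL'" using u by (simp add: norm_mult)
      then have "cmod (laplace M (of_real u)) \<le> (\<bar>K\<bar> + CL') / u powr \<beta>" using u by (simp add: pos_le_divide_eq)
      also have "u powr \<beta> = real n powr \<beta> * (\<kappa> / 2) powr \<beta>"
        using C(2) by (simp add: u_def powr_mult[symmetric])
      finally show ?thesis by (simp add: C3_def u_def mult.commute)
    qed
    have "cmod (\<delta> n - (\<Sum>x\<in>E. 1 / (x ^ (d * n) * A x) * laplace M (of_nat n * lm x)))
      \<le> C / \<rho> ^ (d * n) * (B1 / real n * (C3 / real n powr \<beta>) + w)"
      using step1[OF elim(1)]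
    proof (rule order_trans)
      show "C / \<rho> ^ (d * n) * (B1 / real n * cmod (laplace M (of_real (real n * \<kappa> / 2))) + \<theta> ^ n)
         \<le> C / \<rho> ^ (d * n) * (B1 / real n * (C3 / real n powr \<beta>) + w)"
        using C(1) \<rho> B1 n lap elim(4) unfolding w_def by (intro mult_left_mono add_mono) auto
    qed
    also have "\<dots> = C * (B1 * C3 + 1) * (1 / \<rho> ^ (d * n) * w)"
      using n by (simp add: w_def field_simps)
    finally have "cmod (\<delta> n - (\<Sum>x\<in>E. diag_contribution d x n)) \<le> C * (B1 * C3 + 1) * (1 / \<rho> ^ (d * n) * w) + S * (1 / \<rho> ^ (d * n) * w)"
      using main norm_triangle_ineq[of "\<delta> n - (\<Sum>x\<in>E. 1 / (x ^ (d * n) * A x) * laplace M (of_nat n * lm x))"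
         "(\<Sum>x\<in>E. 1 / (x ^ (d * n) * A x) * laplace M (of_nat n * lm x)) - (\<Sum>x\<in>E. diag_contribution d x n)"] by simp
    also have "\<dots> = CF / \<rho> ^ (d * n) * w" by (simp add: CF_def algebra_simps add_divide_distrib)
    finally show ?case unfolding w_def .
  qed
  then show ?thesis unfolding \<beta>_def
    by (intro exI[of _ \<rho>] exI[of _ CF] conjI \<rho> finE neE ballI modE nzE)
qed

section \<open>Two variables beyond the critical parameter\<close>

lemma fps_binomial_minus_half_compose:
  fixes a :: "complex fps"
  assumes "fps_nth a 0 = 0"
  shows "(fps_binomial (- 1 / 2) oo a)\<^sup>2 * (1 + a) = 1"
proof -
  let ?W = "fps_binomial (- 1 / 2 :: complex)"
  have "?W\<^sup>2 = fps_binomial (- 1)" unfolding fps_binomial_power by simp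
  then have "?W\<^sup>2 * (1 + fps_X) = 1"
    by (simp add: fps_binomial_1[symmetric] fps_binomial_add_mult[symmetric])
  then have "(?W\<^sup>2 * (1 + fps_X)) oo a = 1" by simp
  then show ?thesis using assms
    by (simp add: fps_compose_mult_distrib fps_compose_power fps_compose_add_distrib)
qed

lemma fps_square_mult_eq_1_unique:
  fixes D D' Q :: "complex fps"
  assumes "D\<^sup>2 * Q = 1" "D'\<^sup>2 * Q = 1" "fps_nth D 0 = 1" "fps_nth D' 0 = 1"
  shows "D = D'"
proof -
  have "Q \<noteq> 0" using assms(1) by auto
  moreover have "D\<^sup>2 * Q = D'\<^sup>2 * Q" using assms by simp
  ultimately have "D\<^sup>2 = D'\<^sup>2" by simp
  then have "D = D' \<or> D = - D'" by (simp add: power2_eq_iff)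
  moreover have "fps_nth D 0 \<noteq> fps_nth (- D') 0" using assms by simp
  ultimately show ?thesis by auto
qed

text \<open>Both sides are coefficients of \<open>((1 - u1 t) (1 - u2 t))^(- 1 / 2)\<close>, where
  the product of the two factors is \<open>(1 + c t)^2 - 4 t\<close>. Expanding
  \<open>(1 + c t)^(- 1) (1 - 4 t / (1 + c t)^2)^(- 1 / 2)\<close> gives the left side; expanding
  the two factors separately gives the right side.\<close>

lemma two_variable_diagonal_coeff:
  fixes c u1 u2 :: complex
  assumes u: "u1 + u2 = 4 - 2 * c" "u1 * u2 = c\<^sup>2"
  defines "b \<equiv> \<lambda>k. pochhammer (1 / 2 :: complex) k / fact k"
  shows "(\<Sum>k\<le>n. (- c) ^ k * fact (2 * (n - k) + k) / (fact k * fact (n - k) ^ 2))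
       = (\<Sum>k\<le>n. b k * b (n - k) * u1 ^ k * u2 ^ (n - k))"
proof -
  define W where "W = fps_binomial (- 1 / 2 :: complex)"
  define P where "P = 1 - fps_const (- c) * fps_X"
  define I where "I = inverse P"
  define a where "a = fps_const (- 4) * (fps_X * I ^ 2)"
  define Q where "Q = P\<^sup>2 - 4 * fps_X"
  have W_nth: "fps_nth W j = (- 1) ^ j * b j" for j
    by (simp add: W_def b_def gbinomial_pochhammer)
  have IP: "I * P = 1" unfolding I_def by (rule inverse_mult_eq_1) (simp add: P_def)
  have a0: "fps_nth a 0 = 0" by (simp add: a_def)
  have Q: "Q = (1 - fps_const u1 * fps_X) * (1 - fps_const u2 * fps_X)"
  proof -
    have 1: "fps_const u1 + fps_const u2 = 4 - 2 * fps_const c"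
      unfolding fps_const_add u(1) by (simp add: numeral_fps_const)
    have 2: "fps_const u1 * fps_const u2 = (fps_const c)\<^sup>2"
      unfolding fps_const_mult u(2) fps_const_power ..
    have "(1 - fps_const u1 * fps_X) * (1 - fps_const u2 * fps_X)
        = 1 - (fps_const u1 + fps_const u2) * fps_X + (fps_const u1 * fps_const u2) * fps_X\<^sup>2"
      by (simp only: power2_eq_square ring_distribs) (simp add: algebra_simps del: fps_const_mult fps_const_add)
    also have "\<dots> = Q" unfolding 1 2 Q_def P_def fps_const_neg[symmetric]
      by (simp only: power2_eq_square) (simp add: algebra_simps del: fps_const_mult fps_const_add fps_const_neg)
    finally show ?thesis ..
  qed
  have D1: "(I * (W oo a))\<^sup>2 * Q = 1"
  proof -
    have "P\<^sup>2 * a = - 4 * fps_X * (I * P)\<^sup>2"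
      unfolding a_def by (simp add: power_mult_distrib numeral_fps_const mult_ac)
    then have "Q = P\<^sup>2 * (1 + a)" unfolding Q_def IP by (simp add: distrib_left)
    then have "(I * (W oo a))\<^sup>2 * Q = (I * P)\<^sup>2 * ((W oo a)\<^sup>2 * (1 + a))"
      by (simp only: power_mult_distrib mult_ac)
    then show ?thesis unfolding IP W_def fps_binomial_minus_half_compose[OF a0] by simp
  qed
  define V where "V u = W oo (fps_const (- u) * fps_X)" for u
  have V_nth: "fps_nth (V u) k = b k * u ^ k" for u k
  proof -
    have "fps_nth (V u) k = (- u) ^ k * ((- 1) ^ k * b k)"
      by (simp only: V_def fps_compose_linear fps_nth_Abs_fps W_nth)
    also have "\<dots> = ((- u) * (- 1)) ^ k * b k" by (simp only: power_mult_distrib mult.assoc)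
    finally show ?thesis by simp
  qed
  have V: "(V u)\<^sup>2 * (1 - fps_const u * fps_X) = 1" for u
  proof -
    have e: "1 - fps_const u * fps_X = 1 + fps_const (- u) * fps_X"
      by (simp add: fps_const_neg[symmetric] del: fps_const_neg)
    have "(fps_binomial (- 1 / 2) oo (fps_const (- u) * fps_X))\<^sup>2 * (1 + fps_const (- u) * fps_X) = 1"
      by (rule fps_binomial_minus_half_compose) simp
    then show ?thesis unfolding e V_def W_def .
  qed
  have D2: "(V u1 * V u2)\<^sup>2 * Q = 1"
  proof -
    have "(V u1 * V u2)\<^sup>2 * Q = ((V u1)\<^sup>2 * (1 - fps_const u1 * fps_X)) * ((V u2)\<^sup>2 * (1 - fps_const u2 * fps_X))"
      unfolding Q by (simp only: power_mult_distrib mult_ac)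
    then show ?thesis unfolding V by simp
  qed
  have "I * (W oo a) = V u1 * V u2"
    by (rule fps_square_mult_eq_1_unique[OF D1 D2]) (simp_all add: I_def P_def W_nth V_nth b_def)
  then have "fps_nth (I * (W oo a)) n = fps_nth (V u1 * V u2) n" by simp
  also have "\<dots> = (\<Sum>k\<le>n. b k * b (n - k) * u1 ^ k * u2 ^ (n - k))"
    by (simp add: fps_mult_nth V_nth atMost_atLeast0 mult_ac)
  \<comment> \<open>Powers of \<open>a\<close> start in degree \<open>j\<close>, so the composition
    sums for all degrees up to \<open>n\<close> may be cut at the common bound
    \<open>n\<close>.\<close>
  also have "fps_nth (I * (W oo a)) n = (\<Sum>i\<in>{0..n}. fps_nth I i * (\<Sum>j\<in>{0..n}. fps_nth W j * fps_nth (a ^ j) (n - i)))"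
  proof -
    have "fps_nth (W oo a) m = (\<Sum>j\<in>{0..n}. fps_nth W j * fps_nth (a ^ j) m)" if "m \<le> n" for m
      unfolding fps_compose_nth
    proof (rule sum.mono_neutral_left)
      show "\<forall>j\<in>{0..n} - {0..m}. fps_nth W j * fps_nth (a ^ j) m = 0"
        using startsby_zero_power_prefix[OF a0] by auto
    qed (use that in auto)
    then show ?thesis unfolding fps_mult_nth by (intro sum.cong) auto
  qed
  also have "\<dots> = (\<Sum>j\<in>{0..n}. fps_nth W j * fps_nth (I * a ^ j) n)"
    unfolding fps_mult_nth sum_distrib_left by (subst sum.swap) (simp add: mult_ac)
  also have "\<dots> = (\<Sum>j\<in>{0..n}. (- c) ^ (n - j) * fact (2 * j + (n - j)) / (fact (n - j) * fact j ^ 2))"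
  proof (rule sum.cong[OF refl])
    fix j assume j: "j \<in> {0..n}"
    \<comment> \<open>Every factor \<open>a\<close> carries \<open>I ^ 2\<close>, so
      \<open>I\<close> occurs with exponent \<open>2 * j + 1\<close>, and the coefficients of that
      power of a geometric series are binomial coefficients. The factor \<open>(- 4) ^ j\<close>
      combines with the coefficient of \<open>W\<close> to the central binomial coefficient.\<close>
    have "I * a ^ j = fps_const ((- 4) ^ j) * (fps_X ^ j * I ^ (2 * j + 1))"
      by (simp add: a_def power_mult_distrib fps_const_power power_mult[symmetric] mult_ac)
    then have "fps_nth (I * a ^ j) n = (- 4) ^ j * fps_nth (I ^ (2 * j + 1)) (n - j)"
      using j by (simp add: fps_X_power_mult_nth del: power_Suc)
    also have "I ^ (2 * j + 1) = Abs_fps (\<lambda>k. of_nat ((2 * j + 1 + k - 1) choose k) * (- c) ^ k)"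
      unfolding I_def fps_inverse_power[symmetric] P_def by (rule one_minus_const_fps_X_neg_power') simp
    finally have 1: "fps_nth (I * a ^ j) n = (- 4) ^ j * (of_nat (2 * j + (n - j) choose (n - j)) * (- c) ^ (n - j))"
      by simp
    have 2: "fps_nth W j * (- 4) ^ j = fact (2 * j) / (fact j ^ 2)"
    proof -
      have "(- 1) ^ j * (- 4) ^ j = (4 :: complex) ^ j" by (simp add: power_mult_distrib[symmetric])
      then have "fps_nth W j * (- 4) ^ j = 4 ^ j * b j" unfolding W_nth by (simp add: mult_ac)
      then show ?thesis by (simp add: b_def fact_double power_mult power2_eq_square)
    qed
    have 3: "(of_nat (2 * j + (n - j) choose (n - j)) :: complex) = fact (2 * j + (n - j)) / (fact (n - j) * fact (2 * j))"
      by (subst binomial_fact) auto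
    have "fps_nth W j * fps_nth (I * a ^ j) n
        = (fps_nth W j * (- 4) ^ j) * of_nat (2 * j + (n - j) choose (n - j)) * (- c) ^ (n - j)"
      unfolding 1 by (simp only: mult_ac)
    also have "\<dots> = (- c) ^ (n - j) * fact (2 * j + (n - j)) / (fact (n - j) * fact j ^ 2)"
      unfolding 2 3 by (simp add: mult.commute)
    finally show "fps_nth W j * fps_nth (I * a ^ j) n = (- c) ^ (n - j) * fact (2 * j + (n - j)) / (fact (n - j) * fact j ^ 2)" .
  qed
  also have "\<dots> = (\<Sum>k\<le>n. (- c) ^ k * fact (2 * (n - k) + k) / (fact k * fact (n - k) ^ 2))"
    unfolding atMost_atLeast0 by (rule sum.reindex_bij_witness[of _ "\<lambda>k. n - k" "\<lambda>k. n - k"]) auto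
  finally show ?thesis .
qed

text \<open>After squaring, the right side exceeds the left by
  \<open>(1 + Re \<omega>) * (s - t)^2 / 2\<close>.\<close>

lemma cmod_diff_unit_mult_ge:
  fixes \<omega> :: complex
  assumes \<omega>: "cmod \<omega> = 1" and "s \<ge> 0" "t \<ge> 0"
  shows "cmod (1 - \<omega>) / 2 * (s + t) \<le> cmod (of_real s - \<omega> * of_real t)"
proof (rule power2_le_imp_le)
  have n: "(Re \<omega>)\<^sup>2 + (Im \<omega>)\<^sup>2 = 1" using \<omega> by (simp add: cmod_def)
  have "- 1 \<le> Re \<omega>" using abs_Re_le_cmod[of \<omega>] \<omega> by simp
  have 1: "(cmod (1 - \<omega>))\<^sup>2 = 2 - 2 * Re \<omega>"
    unfolding cmod_power2 using n by (simp add: power2_eq_square algebra_simps)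
  have 2: "(cmod (of_real s - \<omega> * of_real t))\<^sup>2 = s\<^sup>2 + t\<^sup>2 * ((Re \<omega>)\<^sup>2 + (Im \<omega>)\<^sup>2) - 2 * (s * t * Re \<omega>)"
    unfolding cmod_power2 by (simp add: power2_eq_square algebra_simps)
  have "0 \<le> (1 + Re \<omega>) * (s - t)\<^sup>2" using \<open>- 1 \<le> Re \<omega>\<close> by (intro mult_nonneg_nonneg) auto
  then have "(2 - 2 * Re \<omega>) * (s + t)\<^sup>2 \<le> 4 * (s\<^sup>2 + t\<^sup>2 - 2 * (s * t * Re \<omega>))"
    by (simp add: power2_eq_square algebra_simps)
  then show "(cmod (1 - \<omega>) / 2 * (s + t))\<^sup>2 \<le> (cmod (of_real s - \<omega> * of_real t))\<^sup>2"
    unfolding power_mult_distrib power_divide 1 2 n by simp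
qed simp

text \<open>The last bound is the essential one: moving \<open>s\<close> to 1 costs a multiple of
  \<open>1 - s\<close>, uniformly in \<open>t\<close>. The difference is
  \<open>\<omega> * t * (1 - s) / (D * D1)\<close>, and its factor \<open>t\<close> compensates for
  a small \<open>D\<close> when \<open>s\<close> and \<open>t\<close> are both small.\<close>

lemma cauchy_kernel_bounds:
  fixes \<omega> :: complex and s t :: real
  assumes \<omega>: "cmod \<omega> = 1" "\<omega> \<noteq> 1" and s: "0 < s" "s \<le> 1" and t: "0 < t" "t \<le> 1"
  defines "\<kappa> \<equiv> cmod (1 - \<omega>) / 2"
  shows "of_real s \<noteq> \<omega> * of_real t"
    and "cmod (of_real s / (of_real s - \<omega> * of_real t)) \<le> 1 / \<kappa>"
    and "cmod (of_real s / (of_real s - \<omega> * of_real t) - 1 / (1 - \<omega> * of_real t)) \<le> (1 - s) / \<kappa>\<^sup>2"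
proof -
  have \<kappa>: "\<kappa> > 0" using \<omega> by (simp add: \<kappa>_def)
  define D D1 where "D = complex_of_real s - \<omega> * of_real t" and "D1 = 1 - \<omega> * of_real t"
  have D: "\<kappa> * (s + t) \<le> cmod D" using cmod_diff_unit_mult_ge[OF \<omega>(1), of s t] s t by (simp add: D_def \<kappa>_def)
  have D1: "\<kappa> * (1 + t) \<le> cmod D1" using cmod_diff_unit_mult_ge[OF \<omega>(1), of 1 t] t by (simp add: D1_def \<kappa>_def)
  have p: "\<kappa> * (s + t) > 0" "\<kappa> * (1 + t) > 0" using \<kappa> s t by simp_all
  then have nz: "D \<noteq> 0" "D1 \<noteq> 0" using D D1 by auto
  from nz(1) show "of_real s \<noteq> \<omega> * of_real t" by (simp add: D_def)
  have st: "\<kappa> * s \<le> \<kappa> * (s + t)" "\<kappa> * t \<le> \<kappa> * (s + t)" using \<kappa> s t by (intro mult_left_mono; simp)+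
  have "\<kappa> * s \<le> cmod D" using D st by simp
  then have "cmod (of_real s / D) \<le> 1 / \<kappa>"
    using \<kappa> s nz by (simp add: norm_divide divide_le_eq le_divide_eq mult.commute)
  then show "cmod (of_real s / (of_real s - \<omega> * of_real t)) \<le> 1 / \<kappa>" by (simp add: D_def)
  have "of_real s / D - 1 / D1 = \<omega> * of_real t * of_real (1 - s) / (D * D1)"
    using nz by (simp add: divide_simps) (simp add: D_def D1_def algebra_simps)
  then have eq: "cmod (of_real s / D - 1 / D1) = t * (1 - s) / (cmod D * cmod D1)"
    using s t \<omega> by (simp add: norm_mult norm_divide flip: of_real_diff)
  have "t * \<kappa>\<^sup>2 \<le> (\<kappa> * (s + t)) * (\<kappa> * (1 + t))"
  proof -
    have "(\<kappa> * t) * (\<kappa> * 1) \<le> (\<kappa> * (s + t)) * (\<kappa> * (1 + t))"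
      using \<kappa> s t by (intro mult_mono) auto
    then show ?thesis by (simp add: power2_eq_square mult_ac)
  qed
  also have "\<dots> \<le> cmod D * cmod D1" using D D1 p by (intro mult_mono) auto
  finally have "t * \<kappa>\<^sup>2 \<le> cmod D * cmod D1" .
  then have "t * \<kappa>\<^sup>2 * (1 - s) \<le> cmod D * cmod D1 * (1 - s)" using s by (intro mult_right_mono) auto
  then have "t * (1 - s) / (cmod D * cmod D1) \<le> (1 - s) / \<kappa>\<^sup>2"
    using \<kappa> nz by (simp add: divide_le_eq le_divide_eq mult_ac)
  then show "cmod (of_real s / (of_real s - \<omega> * of_real t) - 1 / (1 - \<omega> * of_real t)) \<le> (1 - s) / \<kappa>\<^sup>2"
    using eq by (simp add: D_def D1_def)
qed

text \<open>
  The convolution is the expectation of a divided difference of \<open>z\<^sup>n\<^sup>+\<^sup>1\<close> at two independent points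
  \<open>v\<close>, \<open>\<omega> v'\<close>; each of its two terms concentrates where the point carrying the power is close to \<open>1\<close>.
\<close>

lemma moment_convolution_asymptotics:
  fixes b :: "nat \<Rightarrow> complex" and v :: "'a \<Rightarrow> real" and \<omega> :: complex
  assumes M: "prob_space M" and v [measurable]: "v \<in> borel_measurable M"
    and v01: "\<And>y. 0 < v y" "\<And>y. v y \<le> 1"
    and mom: "\<And>k. (LINT y|M. of_real (v y) ^ k) = b k"
    and \<omega>: "cmod \<omega> = 1" "\<omega> \<noteq> 1"
  shows "\<exists>C. \<forall>n. cmod ((\<Sum>k\<le>n. b k * b (n - k) * \<omega> ^ (n - k))
      - b n * ((LINT y|M. 1 / (1 - \<omega> * of_real (v y))) + \<omega> ^ n * (LINT y|M. 1 / (1 - cnj \<omega> * of_real (v y)))))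
     \<le> C * cmod (b n - b (Suc n))"
proof -
  interpret prob_space M by fact
  interpret P: pair_prob_space M M ..
  define \<kappa> where "\<kappa> = cmod (1 - \<omega>) / 2"
  have \<kappa>: "\<kappa> > 0" using \<omega> by (simp add: \<kappa>_def)
  define h where "h w y z = of_real (v y) / (of_real (v y) - w * of_real (v z))" for w :: complex and y z
  define G where "G w = (LINT y|M. 1 / (1 - w * of_real (v y)))" for w :: complex
  define T where "T w n = (LINT y|M. of_real (v y) ^ n * (LINT z|M. h w y z))" for w :: complex and n
  have vn: "norm (complex_of_real (v y) ^ n) \<le> 1" for y n
    using v01[of y] by (simp add: norm_power power_le_one)
  have h_meas: "h w y \<in> borel_measurable M" for w y unfolding h_def by measurable
  have hI: "(\<lambda>y. LINT z|M. h w y z) \<in> borel_measurable M" for w unfolding h_def by measurable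
  have hb: "cmod (h w y z) \<le> 2 / cmod (1 - w)" if "cmod w = 1" "w \<noteq> 1" for w y z
    using cauchy_kernel_bounds(2)[OF that v01(1)[of y] v01(2)[of y] v01(1)[of z] v01(2)[of z]] by (simp add: h_def)
  have int_h: "integrable M (h w y)" if "cmod w = 1" "w \<noteq> 1" for w y
    by (rule integrable_const_bound[of _ "2 / cmod (1 - w)"]) (use hb[OF that] h_meas in auto)
  have int_v: "integrable M (\<lambda>y. complex_of_real (v y) ^ n)" for n
    by (rule integrable_const_bound[of _ 1]) (use vn in auto)
  have hI_b: "cmod (LINT z|M. h w y z) \<le> 2 / cmod (1 - w)" if "cmod w = 1" "w \<noteq> 1" for w y
  proof -
    have "cmod (LINT z|M. h w y z) \<le> (LINT z|M. 2 / cmod (1 - w))"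
      by (rule norm_integral_le_AE[OF int_h[OF that]]) (use hb[OF that] in auto)
    then show ?thesis by (simp add: prob_space)
  qed
  have int_g: "integrable M (\<lambda>z. 1 / (1 - w * of_real (v z)))" if "cmod w = 1" "w \<noteq> 1" for w
  proof (rule integrable_const_bound[of _ "2 / cmod (1 - w)"])
    show "AE z in M. norm (1 / (1 - w * complex_of_real (v z))) \<le> 2 / cmod (1 - w)"
      using cauchy_kernel_bounds(2)[OF that, of 1] v01 by (intro AE_I2) simp
  qed measurable
  have int_T: "integrable M (\<lambda>y. of_real (v y) ^ n * (LINT z|M. h w y z))" if "cmod w = 1" "w \<noteq> 1" for w n
  proof (rule integrable_const_bound[of _ "1 * (2 / cmod (1 - w))"])
    show "AE y in M. norm (complex_of_real (v y) ^ n * (LINT z|M. h w y z)) \<le> 1 * (2 / cmod (1 - w))"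
      unfolding norm_mult using vn hI_b[OF that] by (intro AE_I2 mult_mono) auto
  qed (use hI in measurable)
  have int_r: "integrable M (\<lambda>y. v y ^ n * (1 - v y))" for n
  proof (rule integrable_const_bound[of _ "1 * 1"])
    show "AE y in M. norm (v y ^ n * (1 - v y)) \<le> 1 * 1"
      unfolding norm_mult using v01 by (intro AE_I2 mult_mono) (auto simp: power_le_one less_imp_le)
  qed measurable
  \<comment> \<open>The difference of moments is the mean of \<open>v ^ n * (1 - v)\<close>, which
    is just the weight that the kernel bound produces.\<close>
  have diff: "b n - b (Suc n) = of_real (LINT y|M. v y ^ n * (1 - v y))" for n
  proof -
    have "b n - b (Suc n) = (LINT y|M. of_real (v y) ^ n - of_real (v y) ^ Suc n)"
      unfolding mom[symmetric] by (rule Bochner_Integration.integral_diff[symmetric, OF int_v int_v])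
    also have "\<dots> = (LINT y|M. of_real (v y ^ n * (1 - v y)))" by (simp add: algebra_simps)
    also have "\<dots> = of_real (LINT y|M. v y ^ n * (1 - v y))" by (rule integral_complex_of_real)
    finally show ?thesis .
  qed
  have T_bound: "cmod (T w n - b n * G w) \<le> cmod (b n - b (Suc n)) / (cmod (1 - w) / 2)\<^sup>2" if w: "cmod w = 1" "w \<noteq> 1" for w n
  proof -
    let ?k = "(cmod (1 - w) / 2)\<^sup>2"
    have "b n * G w = (LINT y|M. of_real (v y) ^ n * G w)" unfolding mom[symmetric] by simp
    then have "T w n - b n * G w = (LINT y|M. of_real (v y) ^ n * (LINT z|M. h w y z) - of_real (v y) ^ n * G w)"
      unfolding T_def by (simp add: Bochner_Integration.integral_diff[OF int_T[OF w]] int_v)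
    also have "cmod \<dots> \<le> (LINT y|M. v y ^ n * (1 - v y) / ?k)"
    proof (rule norm_integral_le_AE)
      show "integrable M (\<lambda>y. of_real (v y) ^ n * (LINT z|M. h w y z) - of_real (v y) ^ n * G w)"
        by (intro Bochner_Integration.integrable_diff int_T[OF w] integrable_mult_left int_v)
      show "integrable M (\<lambda>y. v y ^ n * (1 - v y) / ?k)" by (intro integrable_divide int_r)
      show "AE y in M. cmod (of_real (v y) ^ n * (LINT z|M. h w y z) - of_real (v y) ^ n * G w) \<le> v y ^ n * (1 - v y) / ?k"
      proof (rule AE_I2)
        fix y
        have "(LINT z|M. h w y z) - G w = (LINT z|M. h w y z - 1 / (1 - w * of_real (v z)))"
          unfolding G_def by (rule Bochner_Integration.integral_diff[symmetric, OF int_h[OF w] int_g[OF w]])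
        also have "cmod \<dots> \<le> (LINT z|M. (1 - v y) / ?k)"
          by (rule norm_integral_le_AE[OF Bochner_Integration.integrable_diff[OF int_h[OF w] int_g[OF w]]])
            (use cauchy_kernel_bounds(3)[OF w v01(1)[of y] v01(2)[of y] v01(1) v01(2)] in \<open>auto simp: h_def\<close>)
        finally have "cmod ((LINT z|M. h w y z) - G w) \<le> (1 - v y) / ?k" by (simp add: prob_space)
        then have "v y ^ n * cmod ((LINT z|M. h w y z) - G w) \<le> v y ^ n * ((1 - v y) / ?k)"
          using v01(1)[of y] by (intro mult_left_mono) auto
        moreover have "cmod (of_real (v y) ^ n * (LINT z|M. h w y z) - of_real (v y) ^ n * G w)
            = v y ^ n * cmod ((LINT z|M. h w y z) - G w)"
          unfolding right_diff_distrib[symmetric] norm_mult using v01(1)[of y] by (simp add: norm_power)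
        ultimately show "cmod (of_real (v y) ^ n * (LINT z|M. h w y z) - of_real (v y) ^ n * G w) \<le> v y ^ n * (1 - v y) / ?k"
          by simp
      qed
    qed
    also have "\<dots> = (LINT y|M. v y ^ n * (1 - v y)) / ?k" by simp
    also have "\<dots> = cmod (b n - b (Suc n)) / ?k"
    proof -
      have "(LINT y|M. v y ^ n * (1 - v y)) \<ge> 0" using v01 by (intro integral_nonneg_AE AE_I2) (simp add: less_imp_le)
      then show ?thesis unfolding diff by simp
    qed
    finally show ?thesis .
  qed
  have cn: "cmod (cnj \<omega>) = 1" "cnj \<omega> \<noteq> 1" using \<omega> by (auto simp: complex_cnj_cancel_iff[of \<omega> 1, simplified])
  have inv: "\<omega> * cnj \<omega> = 1" using \<omega>(1) by (simp add: complex_mult_cnj cmod_def)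
  \<comment> \<open>The geometric sum is split into its two end terms. In the second the variables
    exchange roles, and factoring out \<open>\<omega>\<close> replaces it in the kernel by its
    inverse \<open>cnj \<omega>\<close>.\<close>
  have pointwise: "(\<Sum>k\<le>n. of_real (v y) ^ k * (\<omega> * of_real (v z)) ^ (n - k))
      = of_real (v y) ^ n * h \<omega> y z + \<omega> ^ n * (of_real (v z) ^ n * h (cnj \<omega>) z y)" for n y z
  proof -
    define s t where "s = complex_of_real (v y)" and "t = complex_of_real (v z)"
    have ne: "s - \<omega> * t \<noteq> 0"
      using cauchy_kernel_bounds(1)[OF \<omega> v01(1)[of y] v01(2)[of y] v01(1)[of z] v01(2)[of z]] by (simp add: s_def t_def)
    have "h (cnj \<omega>) z y = (\<omega> * t) / (\<omega> * (t - cnj \<omega> * s))"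
      using \<omega>(1) by (auto simp: h_def s_def t_def)
    also have "\<omega> * (t - cnj \<omega> * s) = - (s - \<omega> * t)"
      using inv by (simp add: right_diff_distrib mult.assoc[symmetric])
    finally have h2: "h (cnj \<omega>) z y = - (\<omega> * t) / (s - \<omega> * t)" by (simp only: divide_minus_right minus_divide_left)
    have "(s - \<omega> * t) * (\<Sum>k\<le>n. s ^ k * (\<omega> * t) ^ (n - k)) = s ^ Suc n - (\<omega> * t) ^ Suc n"
      by (subst power_diff_sumr2) (simp add: lessThan_Suc_atMost mult.commute)
    then have "(\<Sum>k\<le>n. s ^ k * (\<omega> * t) ^ (n - k)) = (s ^ Suc n - (\<omega> * t) ^ Suc n) / (s - \<omega> * t)"
      using ne by (simp add: nonzero_eq_divide_eq mult.commute)
    also have "\<dots> = s ^ n * (s / (s - \<omega> * t)) + \<omega> ^ n * (t ^ n * (- (\<omega> * t) / (s - \<omega> * t)))"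
      by (simp add: diff_divide_distrib power_mult_distrib mult_ac)
    finally show ?thesis unfolding h2 unfolding h_def s_def t_def .
  qed
  have conv: "(\<Sum>k\<le>n. b k * b (n - k) * \<omega> ^ (n - k)) = T \<omega> n + \<omega> ^ n * T (cnj \<omega>) n" for n
  proof -
    define f where "f y z = of_real (v z) ^ n * h (cnj \<omega>) z y" for y z
    have fI: "integrable (M \<Otimes>\<^sub>M M) (\<lambda>(y, z). f y z)"
    proof (rule P.integrable_const_bound[of _ "1 * (2 / cmod (1 - cnj \<omega>))"])
      show "AE p in M \<Otimes>\<^sub>M M. norm (case p of (y, z) \<Rightarrow> f y z) \<le> 1 * (2 / cmod (1 - cnj \<omega>))"
      proof (rule AE_I2)
        fix p :: "'a \<times> 'a"
        have "norm (f (fst p) (snd p)) \<le> 1 * (2 / cmod (1 - cnj \<omega>))"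
          unfolding f_def norm_mult using vn hb[OF cn] by (intro mult_mono) auto
        then show "norm (case p of (y, z) \<Rightarrow> f y z) \<le> 1 * (2 / cmod (1 - cnj \<omega>))" by (simp add: case_prod_unfold)
      qed
      show "(\<lambda>(y, z). f y z) \<in> borel_measurable (M \<Otimes>\<^sub>M M)"
        unfolding f_def h_def case_prod_unfold by measurable
    qed
    have f_int: "integrable M (f y)" for y
    proof (rule integrable_const_bound[of _ "1 * (2 / cmod (1 - cnj \<omega>))"])
      show "AE z in M. norm (f y z) \<le> 1 * (2 / cmod (1 - cnj \<omega>))"
        unfolding f_def norm_mult using vn hb[OF cn] by (intro AE_I2 mult_mono) auto
      show "f y \<in> borel_measurable M" unfolding f_def h_def by measurable
    qed
    have f_outer: "integrable M (\<lambda>y. LINT z|M. f y z)" using P.integrable_fst[OF fI] .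
    \<comment> \<open>In the second end term the power sits on the inner variable; exchanging the
      integrals brings it to the shape of \<open>T\<close>.\<close>
    have "(LINT y|M. LINT z|M. f y z) = (LINT z|M. LINT y|M. f y z)"
      by (rule P.Fubini_integral[symmetric, OF fI])
    also have "\<dots> = T (cnj \<omega>) n" unfolding T_def f_def by simp
    finally have Tf: "(LINT y|M. LINT z|M. f y z) = T (cnj \<omega>) n" .
    have "(\<Sum>k\<le>n. b k * b (n - k) * \<omega> ^ (n - k))
        = (\<Sum>k\<le>n. LINT y|M. of_real (v y) ^ k * (LINT z|M. (\<omega> * of_real (v z)) ^ (n - k)))"
      unfolding mom[symmetric] by (simp add: power_mult_distrib mult_ac)
    also have "\<dots> = (LINT y|M. (\<Sum>k\<le>n. of_real (v y) ^ k * (LINT z|M. (\<omega> * of_real (v z)) ^ (n - k))))"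
      by (subst Bochner_Integration.integral_sum) (auto intro!: integrable_mult_left int_v)
    also have "\<dots> = (LINT y|M. LINT z|M. (\<Sum>k\<le>n. of_real (v y) ^ k * (\<omega> * of_real (v z)) ^ (n - k)))"
    proof (intro Bochner_Integration.integral_cong refl)
      fix y
      have i: "integrable M (\<lambda>z. of_real (v y) ^ k * (\<omega> * of_real (v z)) ^ (n - k))" for k
        unfolding power_mult_distrib by (intro integrable_mult_right int_v)
      show "(\<Sum>k\<le>n. of_real (v y) ^ k * (LINT z|M. (\<omega> * of_real (v z)) ^ (n - k)))
          = (LINT z|M. (\<Sum>k\<le>n. of_real (v y) ^ k * (\<omega> * of_real (v z)) ^ (n - k)))"
        unfolding Bochner_Integration.integral_sum[OF i] by simp
    qed
    also have "\<dots> = (LINT y|M. of_real (v y) ^ n * (LINT z|M. h \<omega> y z) + \<omega> ^ n * (LINT z|M. f y z))"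
    proof (intro Bochner_Integration.integral_cong refl)
      fix y
      have "(LINT z|M. of_real (v y) ^ n * h \<omega> y z + \<omega> ^ n * f y z)
          = (LINT z|M. of_real (v y) ^ n * h \<omega> y z) + (LINT z|M. \<omega> ^ n * f y z)"
        by (intro Bochner_Integration.integral_add integrable_mult_right int_h[OF \<omega>] f_int)
      then show "(LINT z|M. (\<Sum>k\<le>n. of_real (v y) ^ k * (\<omega> * of_real (v z)) ^ (n - k)))
          = of_real (v y) ^ n * (LINT z|M. h \<omega> y z) + \<omega> ^ n * (LINT z|M. f y z)"
        unfolding pointwise f_def[symmetric] by simp
    qed
    also have "\<dots> = T \<omega> n + (LINT y|M. \<omega> ^ n * (LINT z|M. f y z))"
      unfolding T_def by (intro Bochner_Integration.integral_add int_T[OF \<omega>] integrable_mult_right f_outer)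
    finally show ?thesis using Tf by simp
  qed
  define C where "C = 1 / (cmod (1 - \<omega>) / 2)\<^sup>2 + 1 / (cmod (1 - cnj \<omega>) / 2)\<^sup>2"
  have "cmod ((T \<omega> n + \<omega> ^ n * T (cnj \<omega>) n) - b n * (G \<omega> + \<omega> ^ n * G (cnj \<omega>))) \<le> C * cmod (b n - b (Suc n))" for n
  proof -
    have "(T \<omega> n + \<omega> ^ n * T (cnj \<omega>) n) - b n * (G \<omega> + \<omega> ^ n * G (cnj \<omega>))
        = (T \<omega> n - b n * G \<omega>) + \<omega> ^ n * (T (cnj \<omega>) n - b n * G (cnj \<omega>))" by (simp add: algebra_simps)
    also have "cmod \<dots> \<le> cmod (T \<omega> n - b n * G \<omega>) + cmod (T (cnj \<omega>) n - b n * G (cnj \<omega>))"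
      using norm_triangle_ineq[of "T \<omega> n - b n * G \<omega>" "\<omega> ^ n * (T (cnj \<omega>) n - b n * G (cnj \<omega>))"] \<omega>
      by (simp add: norm_mult norm_power)
    also have "\<dots> \<le> C * cmod (b n - b (Suc n))"
      using T_bound[OF \<omega>, of n] T_bound[OF cn, of n] unfolding C_def by (simp add: distrib_right)
    finally show ?thesis .
  qed
  then show ?thesis unfolding conv G_def by (intro exI[of _ C] allI)
qed

text \<open>\<open>g\<close> is \<open>(1 - \<omega>)^(- 1 / 2)\<close> on the unit circle. Inside
  the disc the moments give the binomial series, and the boundary point is reached radially by
  dominated convergence. What passes to the limit is the squared identity; \<open>Re g > 0\<close>
  then fixes the sign.\<close>

lemma cauchy_transform_half_beta:
  fixes b :: "nat \<Rightarrow> complex" and v :: "'a \<Rightarrow> real" and \<omega> :: complex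
  assumes M: "prob_space M" and v [measurable]: "v \<in> borel_measurable M"
    and v01: "\<And>y. 0 < v y" "\<And>y. v y \<le> 1"
    and mom: "\<And>k. (LINT y|M. of_real (v y) ^ k) = (pochhammer (1 / 2) k / fact k :: complex)"
    and \<omega>: "cmod \<omega> = 1" "\<omega> \<noteq> 1"
  defines "g \<equiv> (LINT y|M. 1 / (1 - \<omega> * of_real (v y)))"
  shows "g\<^sup>2 * (1 - \<omega>) = 1" and "Re g > 0"
proof -
  interpret prob_space M by fact
  define b :: "nat \<Rightarrow> complex" where "b k = pochhammer (1 / 2) k / fact k" for k
  have vn: "norm (complex_of_real (v y) ^ n) \<le> 1" for y n
    using v01[of y] by (simp add: norm_power power_le_one)
  have int_v: "integrable M (\<lambda>y. complex_of_real (v y) ^ n)" for n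
    by (rule integrable_const_bound[of _ 1]) (use vn in auto)
  define G where "G w = (LINT y|M. 1 / (1 - w * of_real (v y)))" for w :: complex
  have inside: "(G w)\<^sup>2 * (1 - w) = 1" if w: "cmod w < 1" for w
  proof -
    have w1: "1 - cmod w \<le> cmod (1 - w * of_real (v y))" for y
    proof -
      have "cmod (w * of_real (v y)) \<le> cmod w * 1"
        unfolding norm_mult using v01[of y] by (intro mult_left_mono) auto
      then show ?thesis using norm_triangle_ineq2[of 1 "w * of_real (v y)"] by simp
    qed
    have nz: "1 - w * of_real (v y) \<noteq> 0" for y using w1[of y] w by auto
    have int: "integrable M (\<lambda>y. (w * of_real (v y)) ^ N / (1 - w * of_real (v y)))" for N
    proof (rule integrable_const_bound[of _ "1 / (1 - cmod w)"])
      show "AE y in M. norm ((w * of_real (v y)) ^ N / (1 - w * of_real (v y))) \<le> 1 / (1 - cmod w)"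
        unfolding norm_divide norm_power norm_mult using w w1 v01
        by (intro AE_I2 frac_le) (auto intro!: power_le_one mult_le_one simp: less_imp_le)
    qed measurable
    have fin: "(\<Sum>k<N. b k * w ^ k) = G w - (LINT y|M. (w * of_real (v y)) ^ N / (1 - w * of_real (v y)))" for N
    proof -
      have "(\<Sum>k<N. b k * w ^ k) = (\<Sum>k<N. LINT y|M. (w * of_real (v y)) ^ k)"
        unfolding power_mult_distrib b_def mom[symmetric] by (simp add: mult.commute)
      also have "\<dots> = (LINT y|M. (\<Sum>k<N. (w * of_real (v y)) ^ k))"
        unfolding power_mult_distrib by (rule Bochner_Integration.integral_sum[symmetric]) (intro integrable_mult_right int_v)
      also have "\<dots> = (LINT y|M. 1 / (1 - w * of_real (v y)) - (w * of_real (v y)) ^ N / (1 - w * of_real (v y)))"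
      proof (intro Bochner_Integration.integral_cong refl)
        fix y
        have "w * of_real (v y) \<noteq> 1" using nz[of y] by auto
        then show "(\<Sum>k<N. (w * of_real (v y)) ^ k) = 1 / (1 - w * of_real (v y)) - (w * of_real (v y)) ^ N / (1 - w * of_real (v y))"
          by (simp add: sum_gp_strict diff_divide_distrib)
      qed
      also have "\<dots> = G w - (LINT y|M. (w * of_real (v y)) ^ N / (1 - w * of_real (v y)))"
        unfolding G_def using int[of 0] int[of N] by (intro Bochner_Integration.integral_diff) auto
      finally show ?thesis .
    qed
    have rem: "cmod (LINT y|M. (w * of_real (v y)) ^ N / (1 - w * of_real (v y))) \<le> cmod w ^ N / (1 - cmod w)" for N
    proof -
      have "cmod (LINT y|M. (w * of_real (v y)) ^ N / (1 - w * of_real (v y))) \<le> (LINT y|M. cmod w ^ N / (1 - cmod w))"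
      proof (rule norm_integral_le_AE[OF int integrable_const AE_I2])
        fix y
        have "cmod (w * of_real (v y)) \<le> cmod w * 1"
          unfolding norm_mult using v01[of y] by (intro mult_left_mono) auto
        then show "cmod ((w * of_real (v y)) ^ N / (1 - w * of_real (v y))) \<le> cmod w ^ N / (1 - cmod w)"
          unfolding norm_divide norm_power using w w1 by (intro frac_le power_mono) auto
      qed
      then show ?thesis by (simp add: prob_space)
    qed
    have "(\<lambda>N. cmod w ^ N / (1 - cmod w)) \<longlonglongrightarrow> 0"
      by (rule tendsto_divide_zero, rule LIMSEQ_power_zero) (use w in simp)
    then have "(\<lambda>N. LINT y|M. (w * of_real (v y)) ^ N / (1 - w * of_real (v y))) \<longlonglongrightarrow> 0"
      by (rule Lim_null_comparison[OF always_eventually[OF allI[OF rem]]])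
    then have "(\<lambda>N. G w - (LINT y|M. (w * of_real (v y)) ^ N / (1 - w * of_real (v y)))) \<longlonglongrightarrow> G w - 0"
      by (rule tendsto_diff[OF tendsto_const])
    then have "(\<lambda>k. b k * w ^ k) sums G w" unfolding sums_def fin by simp
    moreover have "(\<lambda>k. b k * w ^ k) sums (1 + (- w)) powr (- 1 / 2)"
    proof -
      have "((- 1 / 2 :: complex) gchoose k) * (- w) ^ k = b k * w ^ k" for k
      proof -
        have "((- 1 / 2 :: complex) gchoose k) * (- w) ^ k = b k * ((- 1) ^ k * (- w) ^ k)"
          by (simp add: gbinomial_pochhammer b_def)
        also have "(- 1) ^ k * (- w) ^ k = w ^ k" by (simp flip: power_mult_distrib)
        finally show ?thesis .
      qed
      then show ?thesis using gen_binomial_complex[of "- w" "- 1 / 2"] w by simp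
    qed
    ultimately have G: "G w = (1 - w) powr (- 1 / 2)" using sums_unique2 by fastforce
    have "w \<noteq> 1" using w by auto
    have "(G w)\<^sup>2 * (1 - w) = (1 - w) powr (- 1 / 2) * (1 - w) powr (- 1 / 2) * (1 - w) powr 1"
      by (simp add: G power2_eq_square)
    also have "\<dots> = 1" unfolding powr_add[symmetric] using \<open>w \<noteq> 1\<close> by simp
    finally show ?thesis .
  qed
  have gb: "cmod (1 / (1 - \<omega> * of_real t)) \<le> 2 / cmod (1 - \<omega>)" if "0 < t" "t \<le> 1" for t
    using cauchy_kernel_bounds(2)[OF \<omega>, of 1 t] that by simp
  \<comment> \<open>The shift by 2 keeps every radius strictly between 0 and 1, from the first one
    on.\<close>
  define r where "r m = 1 - 1 / (real m + 2)" for m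
  have r: "0 < r m" "r m < 1" for m by (simp_all add: r_def field_simps)
  have rlim: "r \<longlonglongrightarrow> 1" unfolding r_def by real_asymp
  have rlim': "(\<lambda>m. complex_of_real (r m)) \<longlonglongrightarrow> 1" using tendsto_of_real[OF rlim, where ?'a = complex] by simp
  have ne: "1 - \<omega> * of_real (v y) \<noteq> 0" for y
    using cauchy_kernel_bounds(1)[OF \<omega>, of 1 "v y"] v01 by simp
  have Glim: "(\<lambda>m. G (\<omega> * of_real (r m))) \<longlonglongrightarrow> g"
    unfolding G_def g_def
  proof (rule integral_dominated_convergence[where w = "\<lambda>_. 2 / cmod (1 - \<omega>)"])
    show "AE y in M. (\<lambda>m. 1 / (1 - \<omega> * of_real (r m) * of_real (v y))) \<longlonglongrightarrow> 1 / (1 - \<omega> * of_real (v y))"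
    proof (rule AE_I2)
      fix y
      have "(\<lambda>m. 1 / (1 - \<omega> * of_real (r m) * of_real (v y))) \<longlonglongrightarrow> 1 / (1 - \<omega> * 1 * of_real (v y))"
        using ne[of y] by (intro tendsto_intros rlim') auto
      then show "(\<lambda>m. 1 / (1 - \<omega> * of_real (r m) * of_real (v y))) \<longlonglongrightarrow> 1 / (1 - \<omega> * of_real (v y))" by simp
    qed
    show "AE y in M. norm (1 / (1 - \<omega> * of_real (r m) * of_real (v y))) \<le> 2 / cmod (1 - \<omega>)" for m
    proof (rule AE_I2)
      fix y
      have "0 < r m * v y" "r m * v y \<le> 1" using r[of m] v01[of y] by (auto intro: mult_le_one)
      from gb[OF this] show "norm (1 / (1 - \<omega> * of_real (r m) * of_real (v y))) \<le> 2 / cmod (1 - \<omega>)"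
        by (simp add: mult.assoc)
    qed
  qed auto
  have "(\<lambda>m. (G (\<omega> * of_real (r m)))\<^sup>2 * (1 - \<omega> * of_real (r m))) \<longlonglongrightarrow> g\<^sup>2 * (1 - \<omega> * 1)"
    by (intro tendsto_intros Glim rlim')
  moreover have "(G (\<omega> * of_real (r m)))\<^sup>2 * (1 - \<omega> * of_real (r m)) = 1" for m
    by (rule inside) (use r[of m] \<omega> in \<open>simp add: norm_mult\<close>)
  ultimately show "g\<^sup>2 * (1 - \<omega>) = 1" using LIMSEQ_unique[OF _ tendsto_const] by fastforce
  have int_g: "integrable M (\<lambda>y. 1 / (1 - \<omega> * of_real (v y)))"
    by (rule integrable_const_bound[of _ "2 / cmod (1 - \<omega>)"]) (use gb v01 in auto)
  \<comment> \<open>The map \<open>z \<mapsto> 1 / (1 - z)\<close> sends the closed unit disc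
    without 1 into the half-plane \<open>Re \<ge> 1 / 2\<close>.\<close>
  have half: "1 / 2 \<le> Re (1 / (1 - \<omega> * of_real (v y)))" for y
  proof -
    define z where "z = \<omega> * of_real (v y)"
    have cz: "cmod z \<le> 1" using \<omega> v01[of y] by (simp add: z_def norm_mult)
    then have "(cmod z)\<^sup>2 \<le> 1" by (simp add: power_le_one)
    then have 1: "(Re z)\<^sup>2 + (Im z)\<^sup>2 \<le> 1" by (simp add: cmod_power2)
    have "Re (1 - z) > 0 \<or> Im (1 - z) \<noteq> 0"
    proof (rule ccontr)
      assume "\<not> ?thesis"
      then have "Re z \<ge> 1" "Im z = 0" by auto
      moreover have "Re z \<le> 1" using complex_Re_le_cmod[of z] cz by simp
      ultimately have "z = 1" by (simp add: complex_eq_iff)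
      then show False using ne[of y] by (simp add: z_def)
    qed
    then have "(Re (1 - z))\<^sup>2 + (Im (1 - z))\<^sup>2 > 0"
      by (metis less_irrefl sum_power2_gt_zero_iff)
    moreover have "(Re (1 - z))\<^sup>2 + (Im (1 - z))\<^sup>2 \<le> 2 * Re (1 - z)"
      using 1 by (simp add: power2_eq_square algebra_simps)
    ultimately have "1 / 2 \<le> Re (1 - z) / ((Re (1 - z))\<^sup>2 + (Im (1 - z))\<^sup>2)" by (simp add: le_divide_eq)
    also have "\<dots> = Re (1 / (1 - z))" by (simp add: Re_divide)
    finally show ?thesis by (simp add: z_def)
  qed
  have "1 / 2 = (LINT y|M. 1 / 2 :: real)" by (simp add: prob_space)
  also have "\<dots> \<le> (LINT y|M. Re (1 / (1 - \<omega> * of_real (v y))))"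
    by (intro integral_mono integrable_const integrable_Re int_g half)
  also have "\<dots> = Re g" unfolding g_def by (rule integral_Re[OF int_g])
  finally show "Re g > 0" by simp
qed

text \<open>Here \<open>q\<close> is imaginary, so the argument with powers in the open right
  half-plane does not apply. Instead the principal square root and \<open>g\<close> are compared
  through their squares, and positive real parts exclude the opposite sign.\<close>

lemma diag_contribution_two:
  fixes \<tau> :: real and g :: complex
  assumes \<tau>: "\<tau> \<noteq> 0" and q: "q = \<i> * of_real \<tau>"
    and g: "g\<^sup>2 * (4 * q / (1 + q)\<^sup>2) = 1" "Re g > 0" and n: "n \<ge> 1"
  shows "diag_contribution 2 (1 / (1 + q)) n = (1 + q) ^ (2 * n) * g / of_real (sqrt pi * real n powr (1 / 2))"
proof -
  have q0: "q \<noteq> 0" using \<tau> by (simp add: q)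
  have q1: "1 + q \<noteq> 0"
  proof
    assume "1 + q = 0"
    then have "Re (1 + q) = 0" by (simp only: zero_complex.simps)
    then show False by (simp add: q)
  qed
  define p where "p = (q / (2 * of_real pi)) powr (1 / 2)"
  have p_csqrt: "p = csqrt (q / (2 * of_real pi))"
    using q0 by (simp add: p_def powr_def csqrt_exp_Ln)
  have p2: "p\<^sup>2 = q / (2 * of_real pi)" unfolding p_csqrt by simp
  have "Im (p\<^sup>2) = \<tau> / (2 * pi)"
  proof -
    have "p\<^sup>2 = \<i> * of_real (\<tau> / (2 * pi))" unfolding p2 q by simp
    then show ?thesis by (simp only: Im_i_times Re_complex_of_real)
  qed
  then have Imp: "2 * Re p * Im p = \<tau> / (2 * pi)" by (simp add: power2_eq_square mult_ac)
  have "Re p \<noteq> 0" using Imp \<tau> by auto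
  moreover have "Re p \<ge> 0" using csqrt_principal[of "q / (2 * of_real pi)"] unfolding p_csqrt by auto
  ultimately have Rep: "Re p > 0" by simp
  \<comment> \<open>Normalised so that \<open>z\<close> has the square
    \<open>(1 + q)^2 / (4 * q)\<close>, which is also that of \<open>g\<close>.\<close>
  define z where "z = of_real (sqrt (pi / 2)) * (p * ((1 + q) / q))"
  have "(1 + q) / q = 1 - \<i> / of_real \<tau>" using \<tau> unfolding q by (simp add: field_simps)
  \<comment> \<open>\<open>Im (p^2) = 2 * Re p * Im p\<close> is \<open>\<tau> / (2 * pi)\<close>,
    so \<open>Im p\<close> has the sign of \<open>\<tau>\<close> and both summands are
    positive.\<close>
  then have "Re (p * ((1 + q) / q)) = Re p + Im p / \<tau>" by (simp add: Im_divide_of_real Re_divide_of_real)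
  also have "Im p = \<tau> / (4 * pi * Re p)" using Imp Rep by (simp add: field_simps)
  also have "Re p + \<tau> / (4 * pi * Re p) / \<tau> = Re p + 1 / (4 * pi * Re p)" using \<tau> by simp
  finally have "Re (p * ((1 + q) / q)) > 0" using Rep by (simp add: add_pos_pos)
  moreover have "Re (of_real r * w) > 0" if "r > 0" "Re w > 0" for r w using that by simp
  ultimately have Rez: "Re z > 0" unfolding z_def by (metis real_sqrt_gt_zero half_gt_zero pi_gt_zero)
  have "z\<^sup>2 = of_real (pi / 2) * (q / (2 * of_real pi) * ((1 + q) / q)\<^sup>2)"
    unfolding z_def power_mult_distrib p2 of_real_power[symmetric] by simp
  also have "\<dots> = (1 + q)\<^sup>2 / (4 * q)" using q0 by (simp add: field_simps power2_eq_square)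
  also have "\<dots> = g\<^sup>2" using g(1) q0 q1 by (simp add: field_simps)
  finally have "z = g \<or> z = - g" by (simp add: power2_eq_iff)
  then have zg: "z = g" using Rez g(2) by auto
  define x where "x = 1 / (1 + q)"
  have 1: "(1 - (of_nat 2 - 1) * x) / (2 * of_real pi * x) = q / (2 * of_real pi)"
  proof -
    have "1 - (of_nat 2 - 1) * x = q * x" using q1 by (simp add: x_def divide_simps)
    moreover have "x \<noteq> 0" using q1 by (simp add: x_def)
    ultimately show ?thesis by simp
  qed
  have 2: "1 - (of_nat 2 - 1) * x = q / (1 + q)" using q1 by (simp add: x_def field_simps)
  have 3: "x powi (- int (2 * n)) = (1 + q) ^ (2 * n)"
    unfolding x_def by (simp only: power_int_minus power_int_of_nat power_divide power_one inverse_eq_divide) simp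
  have 4: "(real 2 - 1) / 2 = 1 / 2" by simp
  have 5: "(of_real (1 / 2) :: complex) = 1 / 2" by simp
  have "diag_contribution 2 x n = (1 + q) ^ (2 * n) / of_real (real n powr (1 / 2)) * p * (1 / (of_real (sqrt 2) * (q / (1 + q))))"
    unfolding diag_contribution_def 1 unfolding 2 3 4 5 p_def[symmetric] by simp
  also have "1 / (of_real (sqrt 2) * (q / (1 + q))) = ((1 + q) / q) / of_real (sqrt 2)" by simp
  also have "(1 + q) ^ (2 * n) / of_real (real n powr (1 / 2)) * p * (((1 + q) / q) / of_real (sqrt 2))
      = (1 + q) ^ (2 * n) / of_real (real n powr (1 / 2)) * ((p * ((1 + q) / q)) / of_real (sqrt 2))" by simp
  also have "(p * ((1 + q) / q)) / of_real (sqrt 2) = z / of_real (sqrt pi)"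
    unfolding z_def by (simp add: real_sqrt_divide)
  finally show ?thesis unfolding zg x_def by simp
qed

section \<open>Assembly of the case \<open>d = 2\<close>, \<open>c > 1\<close>\<close>

lemma half_beta_moments:
  "\<exists>(M :: real measure) (v :: real \<Rightarrow> real) C. prob_space M \<and> v \<in> borel_measurable M \<and> (\<forall>y. 0 < v y) \<and> (\<forall>y. v y \<le> 1) \<and>
    (\<forall>k. (LINT y|M. of_real (v y) ^ k) = (pochhammer (1 / 2) k / fact k :: complex)) \<and> C \<ge> 0 \<and>
    (\<forall>\<^sub>F n in sequentially. cmod (pochhammer (1 / 2) n / fact n - 1 / of_real (sqrt pi * real n powr (1 / 2)))
       \<le> C * (1 / (real n powr (1 / 2) * real n)))"
proof -
  obtain M where M: "nonneg_law M"
    and FE: "\<And>\<zeta>. Re \<zeta> \<ge> 0 \<Longrightarrow> (\<zeta> + 1) * laplace M (\<zeta> + 1) = (\<zeta> + of_real (1 / 2)) * laplace M \<zeta>"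
    using beta_law_exists[of "1 / 2"] by auto
  have lap: "laplace M (of_nat k) = pochhammer (1 / 2) k / fact k" for k
    using laplace_asymp_beta(1)[OF _ _ M FE, of k] by (simp add: pochhammer_of_real[symmetric])
  have asy: "laplace_asymp (laplace M) (1 / 2) (1 / sqrt pi)"
    using laplace_asymp_beta(2)[OF _ _ M FE] by (simp add: Gamma_one_half_real)
  \<comment> \<open>Truncation at 0 makes the bounds \<open>0 < v y\<close> and
    \<open>v y \<le> 1\<close> hold at every point; almost everywhere \<open>v y\<close> agrees with
    \<open>exp (- y)\<close>.\<close>
  define v :: "real \<Rightarrow> real" where "v y = exp (- max 0 y)" for y
  have sets_M [measurable_cong]: "sets M = sets borel" using M by (simp add: nonneg_law_def)
  have v_meas: "v \<in> borel_measurable M" unfolding v_def by measurable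
  have mom: "(LINT y|M. of_real (v y) ^ k) = (pochhammer (1 / 2) k / fact k :: complex)" for k
  proof -
    have "(LINT y|M. of_real (v y) ^ k) = laplace M (of_nat k)"
      unfolding laplace_def
    proof (rule integral_cong_AE)
      show "AE y in M. complex_of_real (v y) ^ k = exp (- of_nat k * of_real y)"
      proof (rule eventually_mono)
        show "AE y in M. y \<ge> 0" using M by (simp add: nonneg_law_def)
        fix y :: real assume "y \<ge> 0"
        then have "complex_of_real (v y) ^ k = of_real (exp (real k * (- y)))"
          by (simp only: v_def max_absorb2 exp_of_nat_mult of_real_power)
        then show "complex_of_real (v y) ^ k = exp (- of_nat k * of_real y)"
          by (simp add: exp_of_real[symmetric])
      qed
    qed (use v_meas in measurable)
    then show ?thesis unfolding lap .
  qed
  obtain C R where CR: "\<And>\<zeta>. Re \<zeta> > 0 \<Longrightarrow> cmod \<zeta> \<ge> R \<Longrightarrow>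
      cmod (laplace M \<zeta> * \<zeta> powr of_real (1 / 2) - of_real (1 / sqrt pi)) \<le> C / cmod \<zeta>"
    using asy unfolding laplace_asymp_def by blast
  have "cmod (pochhammer (1 / 2) n / fact n - 1 / of_real (sqrt pi * real n powr (1 / 2)))
       \<le> \<bar>C\<bar> * (1 / (real n powr (1 / 2) * real n))" if n: "n \<ge> 1" "real n \<ge> R" for n
  proof -
    define N where "N = real n powr (1 / 2)"
    define p where "p = (pochhammer (1 / 2) n / fact n :: complex)"
    have N: "N > 0" using n by (simp add: N_def)
    have "of_nat n powr of_real (1 / 2) = (of_real N :: complex)"
      unfolding N_def using powr_of_real[of "real n" "1 / 2"] by simp
    then have pN: "cmod (p * of_real N - of_real (1 / sqrt pi)) \<le> C / real n"
      using CR[of "of_nat n"] n unfolding p_def lap by simp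
    have "p - 1 / of_real (sqrt pi * N) = (p * of_real N - of_real (1 / sqrt pi)) / of_real N"
      using N by (simp add: diff_divide_distrib)
    then have "cmod (p - 1 / of_real (sqrt pi * N)) = cmod (p * of_real N - of_real (1 / sqrt pi)) / N"
      using N by (simp only: norm_divide norm_of_real abs_of_pos)
    also have "\<dots> \<le> C / real n / N" by (rule divide_right_mono[OF pN]) (use N in simp)
    also have "\<dots> \<le> \<bar>C\<bar> / real n / N" using N by (intro divide_right_mono) auto
    finally show ?thesis unfolding p_def N_def by (simp add: mult.commute)
  qed
  note pointwise = this
  have "\<forall>\<^sub>F n in sequentially. n \<ge> 1 \<and> real n \<ge> R"
    using eventually_ge_at_top[of 1] eventually_ge_at_top[of "nat \<lceil>R\<rceil>"]
    by eventually_elim (use real_nat_ceiling_ge[of R] in linarith)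
  then have ev: "\<forall>\<^sub>F n in sequentially. cmod (pochhammer (1 / 2) n / fact n - 1 / of_real (sqrt pi * real n powr (1 / 2)))
       \<le> \<bar>C\<bar> * (1 / (real n powr (1 / 2) * real n))"
    by (rule eventually_mono) (elim conjE, rule pointwise)
  show ?thesis
    using M mom ev v_meas
    by (intro exI[of _ M] exI[of _ v] exI[of _ "\<bar>C\<bar>"] conjI allI) (simp_all add: nonneg_law_def v_def[symmetric], simp_all add: v_def)
qed

text \<open>The two roots have the same modulus, so \<open>\<omega> = u2 / u1\<close> lies on the
  unit circle and \<open>\<delta> n\<close> is \<open>u1 ^ n\<close> times a moment convolution with
  phase \<open>\<omega>\<close>. Its two limiting constants \<open>g1\<close> and \<open>g2\<close>
  match the contributions of the two conjugate roots.\<close>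

lemma diagonal_asymptotics_two:
  fixes c :: real and \<delta> :: "nat \<Rightarrow> complex"
  assumes c: "c > 1" and E: "E = min_modulus_roots (diag_poly 2 c)"
    and \<delta>: "\<And>n. \<delta> n = (\<Sum>k\<le>n. (- of_real c) ^ k * fact (2 * (n - k) + k) / (fact k * fact (n - k) ^ 2))"
  shows "\<exists>\<rho> C. \<rho> > 0 \<and> finite E \<and> E \<noteq> {} \<and> (\<forall>x\<in>E. cmod x = \<rho> \<and> 1 - (of_nat 2 - 1) * x \<noteq> 0) \<and>
    (\<forall>\<^sub>F n in sequentially. cmod (\<delta> n - (\<Sum>x\<in>E. diag_contribution 2 x n)) \<le> C / \<rho> ^ (2 * n) * (1 / (real n powr ((real 2 - 1) / 2) * real n)))"
proof -
  define s where "s = sqrt (c - 1)"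
  have s: "s > 0" "s\<^sup>2 = c - 1" using c by (simp_all add: s_def)
  define q where "q = \<i> * complex_of_real s"
  have q2: "q\<^sup>2 = 1 - of_real c"
    unfolding q_def power_mult_distrib of_real_power[symmetric] s(2) by simp
  have q0: "q \<noteq> 0" using s by (simp add: q_def)
  have cm: "cmod (1 + q) = sqrt c" "cmod (1 - q) = sqrt c"
    using s by (simp_all add: cmod_def q_def)
  have nz: "1 + q \<noteq> 0" "1 - q \<noteq> 0" using cm c by auto
  define x1 x2 where "x1 = 1 / (1 + q)" and "x2 = 1 / (1 - q)"
  define \<rho> where "\<rho> = 1 / sqrt c"
  have \<rho>: "\<rho> > 0" using c by (simp add: \<rho>_def)
  have mod: "cmod x1 = \<rho>" "cmod x2 = \<rho>" by (simp_all add: x1_def x2_def norm_divide cm \<rho>_def)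
  have ne: "x1 \<noteq> x2" using nz q0 by (simp add: x1_def x2_def)
  have roots: "poly (diag_poly 2 c) x = 0 \<longleftrightarrow> x = x1 \<or> x = x2" for x
  proof -
    have "poly (diag_poly 2 c) x = 1 - 2 * x + (1 - q\<^sup>2) * x\<^sup>2" unfolding poly_diag_poly q2 by simp
    also have "\<dots> = (1 - (1 + q) * x) * (1 - (1 - q) * x)" by (simp add: power2_eq_square algebra_simps)
    finally have "poly (diag_poly 2 c) x = 0 \<longleftrightarrow> 1 = (1 + q) * x \<or> 1 = (1 - q) * x" by simp
    also have "1 = (1 + q) * x \<longleftrightarrow> x = x1" unfolding x1_def nonzero_eq_divide_eq[OF nz(1)] by (auto simp: mult.commute)
    also have "1 = (1 - q) * x \<longleftrightarrow> x = x2" unfolding x2_def nonzero_eq_divide_eq[OF nz(2)] by (auto simp: mult.commute)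
    finally show ?thesis .
  qed
  have E12: "E = {x1, x2}" unfolding E min_modulus_roots_def roots using mod by auto
  have nzx: "1 - (of_nat 2 - 1) * x \<noteq> 0" if "x \<in> E" for x
    using that nz q0 unfolding E12 by (auto simp: x1_def x2_def divide_simps)
  define u1 u2 where "u1 = (1 + q)\<^sup>2" and "u2 = (1 - q)\<^sup>2"
  have u: "u1 + u2 = 4 - 2 * of_real c" "u1 * u2 = (of_real c)\<^sup>2"
  proof -
    have "u1 + u2 = 2 + 2 * q\<^sup>2" by (simp add: u1_def u2_def power2_eq_square algebra_simps)
    then show "u1 + u2 = 4 - 2 * of_real c" unfolding q2 by simp
    have "u1 * u2 = (1 - q\<^sup>2)\<^sup>2" by (simp add: u1_def u2_def power2_eq_square algebra_simps)
    then show "u1 * u2 = (of_real c)\<^sup>2" unfolding q2 by simp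
  qed
  have u0: "u1 \<noteq> 0" "u2 \<noteq> 0" using nz by (simp_all add: u1_def u2_def)
  have cu: "cmod u1 = c" "cmod u2 = c" using c by (simp_all add: u1_def u2_def norm_power cm)
  define \<omega> where "\<omega> = u2 / u1"
  have \<omega>1: "cmod \<omega> = 1" using c by (simp add: \<omega>_def norm_divide cu)
  have u12: "u1 - u2 = 4 * q" by (simp add: u1_def u2_def power2_eq_square algebra_simps)
  have om: "1 - \<omega> = 4 * q / (1 + q)\<^sup>2" using u0 u12 unfolding \<omega>_def u1_def[symmetric] by (simp add: field_simps)
  have \<omega>2: "\<omega> \<noteq> 1" using om q0 nz by auto
  have cnj\<omega>: "cnj \<omega> = u1 / u2" by (simp add: \<omega>_def u1_def u2_def q_def)
  \<comment> \<open>Conjugation of \<open>\<omega>\<close> corresponds to the sign change of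
    \<open>q\<close>, so the second root is treated by the same formula with
    \<open>- q\<close>.\<close>
  have omc: "1 - cnj \<omega> = 4 * (- q) / (1 + (- q))\<^sup>2"
    using u0 u12 unfolding cnj\<omega> using u2_def by (simp add: field_simps)
  have cnj1: "cmod (cnj \<omega>) = 1" "cnj \<omega> \<noteq> 1" using \<omega>1 omc q0 nz by auto
  obtain M :: "real measure" and v C0 where M1: "prob_space M" and M2: "v \<in> borel_measurable M"
    and M3: "\<forall>y. 0 < v y" and M4: "\<forall>y. v y \<le> 1"
    and M5: "\<forall>k. (LINT y|M. of_real (v y) ^ k) = (pochhammer (1 / 2) k / fact k :: complex)"
    and C0: "C0 \<ge> 0" and evb: "\<forall>\<^sub>F n in sequentially. cmod (pochhammer (1 / 2) n / fact n - 1 / of_real (sqrt pi * real n powr (1 / 2)))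
       \<le> C0 * (1 / (real n powr (1 / 2) * real n))"
    using half_beta_moments by (elim exE conjE) (rule that; assumption)
  note M = M1 M2 M3[rule_format] M4[rule_format] M5[rule_format]
  define g1 where "g1 = (LINT y|M. 1 / (1 - \<omega> * of_real (v y)))"
  define g2 where "g2 = (LINT y|M. 1 / (1 - cnj \<omega> * of_real (v y)))"
  note G1 = cauchy_transform_half_beta[OF M \<omega>1 \<omega>2, folded g1_def, unfolded om]
  note G2 = cauchy_transform_half_beta[OF M cnj1, folded g2_def, unfolded omc]
  define b :: "nat \<Rightarrow> complex" where "b k = pochhammer (1 / 2) k / fact k" for k
  have "\<exists>C. \<forall>n. cmod ((\<Sum>k\<le>n. b k * b (n - k) * \<omega> ^ (n - k)) - b n * (g1 + \<omega> ^ n * g2)) \<le> C * cmod (b n - b (Suc n))"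
    unfolding g1_def g2_def
    by (rule moment_convolution_asymptotics[OF M(1-4) _ \<omega>1 \<omega>2]) (unfold b_def, rule M(5))
  then obtain C1 where C1: "\<forall>n. cmod ((\<Sum>k\<le>n. b k * b (n - k) * \<omega> ^ (n - k)) - b n * (g1 + \<omega> ^ n * g2)) \<le> C1 * cmod (b n - b (Suc n))" ..
  have \<delta>_eq: "\<delta> n = u1 ^ n * (\<Sum>k\<le>n. b k * b (n - k) * \<omega> ^ (n - k))" for n
  proof -
    have "\<delta> n = (\<Sum>k\<le>n. b k * b (n - k) * u1 ^ k * u2 ^ (n - k))"
      unfolding \<delta> b_def by (rule two_variable_diagonal_coeff[OF u])
    also have "\<dots> = (\<Sum>k\<le>n. u1 ^ n * (b k * b (n - k) * \<omega> ^ (n - k)))"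
    proof (rule sum.cong[OF refl])
      fix k assume "k \<in> {..n}"
      then have "u1 ^ n = u1 ^ k * u1 ^ (n - k)" by (simp add: power_add[symmetric])
      moreover have "u1 ^ (n - k) * \<omega> ^ (n - k) = u2 ^ (n - k)"
        using u0 by (simp add: \<omega>_def power_mult_distrib[symmetric])
      ultimately show "b k * b (n - k) * u1 ^ k * u2 ^ (n - k) = u1 ^ n * (b k * b (n - k) * \<omega> ^ (n - k))"
        by (metis (no_types, opaque_lifting) mult.assoc mult.left_commute)
    qed
    finally show ?thesis by (simp add: sum_distrib_left)
  qed
  have contr: "(\<Sum>x\<in>E. diag_contribution 2 x n) = u1 ^ n * ((g1 + \<omega> ^ n * g2) * (1 / of_real (sqrt pi * real n powr (1 / 2))))"
    if n: "n \<ge> 1" for n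
  proof -
    have d1: "diag_contribution 2 x1 n = u1 ^ n * g1 / of_real (sqrt pi * real n powr (1 / 2))"
      unfolding x1_def u1_def power_mult[symmetric]
      by (rule diag_contribution_two[OF _ q_def G1 n]) (use s in simp)
    have mq: "- q = \<i> * of_real (- s)" by (simp add: q_def)
    have d2: "diag_contribution 2 x2 n = u2 ^ n * g2 / of_real (sqrt pi * real n powr (1 / 2))"
      using diag_contribution_two[OF _ mq G2 n] s unfolding x2_def u2_def power_mult[symmetric] by simp
    have "u1 ^ n * \<omega> ^ n = u2 ^ n" using u0 by (simp add: \<omega>_def power_mult_distrib[symmetric])
    then show ?thesis unfolding E12 using ne d1 d2
      by (simp add: add_divide_distrib distrib_left mult.assoc[symmetric])
  qed
  define C where "C = \<bar>C1\<bar> * (1 / sqrt pi + C0) + C0 * (cmod g1 + cmod g2)"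
  have "\<forall>\<^sub>F n in sequentially. cmod (\<delta> n - (\<Sum>x\<in>E. diag_contribution 2 x n)) \<le> C / \<rho> ^ (2 * n) * (1 / (real n powr (1 / 2) * real n))"
    using evb eventually_ge_at_top[of 1]
  proof eventually_elim
    case (elim n)
    define w where "w = 1 / (real n powr (1 / 2) * real n)"
    define \<beta> where "\<beta> = 1 / complex_of_real (sqrt pi * real n powr (1 / 2))"
    have n: "real n > 0" using elim(2) by simp
    have w: "w > 0" using n by (simp add: w_def)
    have bb: "cmod (b n - \<beta>) \<le> C0 * w" using elim(1) by (simp add: b_def \<beta>_def w_def)
    have wn: "w * real n = 1 / real n powr (1 / 2)" using n by (simp add: w_def)
    have c\<beta>: "cmod \<beta> = 1 / sqrt pi * (w * real n)" unfolding wn by (simp add: \<beta>_def norm_divide norm_mult)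
    have "C0 * w \<le> C0 * (w * real n)" using C0 w elim(2) by (intro mult_left_mono) auto
    then have bn: "cmod (b n) \<le> (1 / sqrt pi + C0) * (w * real n)"
      using norm_triangle_sub[of "b n" \<beta>] bb c\<beta> by (simp add: distrib_right)
    \<comment> \<open>The moments are nearly constant at scale one; this quotient is the source of
      the relative error \<open>1 / n\<close>.\<close>
    have "b n - b (Suc n) = b n / of_nat (2 * (n + 1))"
    proof -
      have bS: "b (Suc n) = b n * ((1 / 2 + of_nat n) / of_nat (n + 1))"
        by (simp add: b_def pochhammer_Suc add.commute)
      have r: "(1 / 2 + of_nat n) / of_nat (n + 1) = (1 - 1 / of_nat (2 * (n + 1)) :: complex)"
        by (simp add: divide_simps del: of_nat_Suc) (simp add: algebra_simps)
      show ?thesis unfolding bS r right_diff_distrib by simp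
    qed
    then have "cmod (b n - b (Suc n)) = cmod (b n) / real (2 * (n + 1))" by (simp only: norm_divide norm_of_nat)
    also have "\<dots> \<le> cmod (b n) / real n" using n by (intro divide_left_mono) auto
    also have "\<dots> \<le> (1 / sqrt pi + C0) * (w * real n) / real n" using bn n by (intro divide_right_mono) auto
    also have "\<dots> = (1 / sqrt pi + C0) * w" using n by simp
    finally have bd: "cmod (b n - b (Suc n)) \<le> (1 / sqrt pi + C0) * w" .
    define S where "S = (\<Sum>k\<le>n. b k * b (n - k) * \<omega> ^ (n - k))"
    define g where "g = g1 + \<omega> ^ n * g2"
    have cg: "cmod g \<le> cmod g1 + cmod g2"
      unfolding g_def using norm_triangle_ineq[of g1 "\<omega> ^ n * g2"] by (simp add: norm_mult norm_power \<omega>1)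
    have "cmod (S - b n * g) \<le> C1 * cmod (b n - b (Suc n))" unfolding S_def g_def by (rule C1[rule_format])
    also have "\<dots> \<le> \<bar>C1\<bar> * ((1 / sqrt pi + C0) * w)" using bd by (intro mult_mono) auto
    finally have 1: "cmod (S - b n * g) \<le> \<bar>C1\<bar> * ((1 / sqrt pi + C0) * w)" .
    have 2: "cmod ((b n - \<beta>) * g) \<le> C0 * w * (cmod g1 + cmod g2)"
      unfolding norm_mult using bb cg C0 w by (intro mult_mono) auto
    have "\<delta> n - (\<Sum>x\<in>E. diag_contribution 2 x n) = u1 ^ n * ((S - b n * g) + (b n - \<beta>) * g)"
      unfolding \<delta>_eq contr[OF elim(2)] S_def[symmetric] g_def[symmetric] \<beta>_def[symmetric] by (simp add: algebra_simps)
    also have "cmod \<dots> = c ^ n * cmod ((S - b n * g) + (b n - \<beta>) * g)" by (simp add: norm_mult norm_power cu)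
    also have "\<dots> \<le> c ^ n * (\<bar>C1\<bar> * ((1 / sqrt pi + C0) * w) + C0 * w * (cmod g1 + cmod g2))"
      using 1 2 c by (intro mult_left_mono norm_triangle_le add_mono) auto
    also have "\<dots> = C * c ^ n * w" by (simp add: C_def algebra_simps)
    also have "c ^ n = 1 / \<rho> ^ (2 * n)" using c by (simp add: \<rho>_def power_mult power_divide)
    finally show ?case by (simp add: w_def)
  qed
  note bound = this
  have half: "(real 2 - 1) / 2 = 1 / 2" by simp
  have finE: "finite E" "E \<noteq> {}" unfolding E12 by simp_all
  have modE: "\<forall>x\<in>E. cmod x = \<rho> \<and> 1 - (of_nat 2 - 1) * x \<noteq> 0"
  proof
    fix x assume x: "x \<in> E"
    then have "cmod x = \<rho>" using mod unfolding E12 by auto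
    with nzx[OF x] show "cmod x = \<rho> \<and> 1 - (of_nat 2 - 1) * x \<noteq> 0" by (intro conjI)
  qed
  show ?thesis unfolding half
    by (rule exI[of _ \<rho>], rule exI[of _ C], rule conjI[OF \<rho> conjI[OF finE(1) conjI[OF finE(2) conjI[OF modE bound]]]])
qed

text \<open>In one variable the series is geometric with ratio \<open>1 - c\<close>, so the only
  contribution is exact and the error constant is 0.\<close>

lemma diagonal_asymptotics_one:
  fixes c :: real and \<delta> :: "nat \<Rightarrow> complex"
  assumes c: "c \<noteq> 1" and E: "E = min_modulus_roots (diag_poly 1 c)"
    and \<delta>: "\<And>n. \<delta> n = (\<Sum>k\<le>n. (- of_real c) ^ k * fact (1 * (n - k) + k) / (fact k * fact (n - k) ^ 1))"
  shows "\<exists>\<rho> C. \<rho> > 0 \<and> finite E \<and> E \<noteq> {} \<and> (\<forall>x\<in>E. cmod x = \<rho> \<and> 1 - (of_nat 1 - 1) * x \<noteq> 0) \<and>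
    (\<forall>\<^sub>F n in sequentially. cmod (\<delta> n - (\<Sum>x\<in>E. diag_contribution 1 x n)) \<le> C / \<rho> ^ (1 * n) * (1 / (real n powr ((real 1 - 1) / 2) * real n)))"
proof -
  define u where "u = 1 - complex_of_real c"
  have u: "u \<noteq> 0" unfolding u_def using c by (metis of_real_eq_1_iff right_minus_eq)
  have roots: "poly (diag_poly 1 c) x = 0 \<longleftrightarrow> x = 1 / u" for x
  proof -
    have "poly (diag_poly 1 c) x = 1 - u * x" unfolding poly_diag_poly u_def by (simp add: algebra_simps)
    then show ?thesis using u by (auto simp: nonzero_eq_divide_eq mult.commute)
  qed
  have E1: "E = {1 / u}" unfolding E min_modulus_roots_def roots by auto
  have \<delta>u: "\<delta> n = u ^ n" for n
  proof -
    have "u ^ n = (\<Sum>k\<le>n. of_nat (n choose k) * (- of_real c) ^ k * 1 ^ (n - k))"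
      unfolding binomial_ring[symmetric] u_def by simp
    also have "\<dots> = \<delta> n" unfolding \<delta> by (intro sum.cong refl) (simp add: binomial_fact)
    finally show ?thesis ..
  qed
  have dc: "diag_contribution 1 (1 / u) n = u ^ n" if "n \<ge> 1" for n
    using that u by (simp add: diag_contribution_def power_int_minus power_one_over inverse_eq_divide)
  have "\<forall>\<^sub>F n in sequentially. cmod (\<delta> n - (\<Sum>x\<in>E. diag_contribution 1 x n))
      \<le> 0 / cmod (1 / u) ^ (1 * n) * (1 / (real n powr ((real 1 - 1) / 2) * real n))"
    using eventually_ge_at_top[of 1] by (rule eventually_mono) (use \<delta>u dc E1 in simp)
  then show ?thesis using u unfolding E1
    by (intro exI[of _ "cmod (1 / u)"] exI[of _ 0] conjI ballI) auto
qed

text \<open>The sum of the contributions may cancel, so the whole error is attributed to a single one of them.\<close>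

lemma relative_error_from_absolute:
  fixes \<delta> :: "nat \<Rightarrow> complex"
  assumes E: "finite E" "E \<noteq> {}" and \<rho>: "\<rho> > 0" and d: "d \<ge> 1"
    and x: "\<And>x. x \<in> E \<Longrightarrow> cmod x = \<rho>" "\<And>x. x \<in> E \<Longrightarrow> 1 - (of_nat d - 1) * x \<noteq> 0"
    and bound: "\<forall>\<^sub>F n in sequentially. cmod (\<delta> n - (\<Sum>x\<in>E. diag_contribution d x n)) \<le> C / \<rho> ^ (d * n) * (1 / (real n powr ((real d - 1) / 2) * real n))"
  shows "\<exists>\<epsilon> :: complex \<Rightarrow> nat \<Rightarrow> complex. (\<forall>x\<in>E. \<epsilon> x \<in> O(\<lambda>n. 1 / of_nat n)) \<and>
           (\<forall>\<^sub>F n in sequentially. \<delta> n = (\<Sum>x\<in>E. diag_contribution d x n * (1 + \<epsilon> x n)))"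
proof -
  obtain z where z: "z \<in> E" using E(2) by blast
  have z0: "z \<noteq> 0" using x(1)[OF z] \<rho> by auto
  define \<beta> where "\<beta> = (real d - 1) / 2"
  \<comment> \<open>The modulus of the contribution of \<open>z\<close> apart from its dependence on
    \<open>n\<close>. It is positive, so the error may be divided by this single
    contribution.\<close>
  define K where "K = cmod (((1 - (of_nat d - 1) * z) / (2 * of_real pi * z)) powr of_real \<beta>)
     * cmod (1 / (of_real (sqrt (real d)) * (1 - (of_nat d - 1) * z)))"
  have K: "K > 0" using z0 x(2)[OF z] d by (simp add: K_def)
  have cz: "cmod (diag_contribution d z n) = K / (\<rho> ^ (d * n) * real n powr \<beta>)" for n
  proof -
    have "cmod (z powi (- int (d * n))) = 1 / \<rho> ^ (d * n)"
      unfolding power_int_minus power_int_of_nat norm_inverse norm_power x(1)[OF z] by (rule inverse_eq_divide)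
    then show ?thesis unfolding diag_contribution_def \<beta>_def[symmetric] norm_mult norm_divide[of "z powi _"] K_def by simp
  qed
  define err where "err n = \<delta> n - (\<Sum>x\<in>E. diag_contribution d x n)" for n
  define \<epsilon> where "\<epsilon> y n = (if y = z then err n / diag_contribution d z n else 0)" for y n
  have "\<epsilon> z \<in> O(\<lambda>n. 1 / of_nat n)"
  proof (rule bigoI[of _ "C / K"])
    show "\<forall>\<^sub>F n in sequentially. norm (\<epsilon> z n) \<le> C / K * norm (1 / of_nat n :: complex)"
      using bound eventually_ge_at_top[of 1]
    proof eventually_elim
      case (elim n)
      define r where "r = \<rho> ^ (d * n)"
      define N where "N = real n powr \<beta>"
      have pos: "r > 0" "N > 0" using \<rho> elim(2) by (simp_all add: r_def N_def)
      have "norm (\<epsilon> z n) = cmod (err n) / (K / (r * N))" by (simp add: \<epsilon>_def norm_divide cz r_def N_def)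
      also have "\<dots> \<le> C / r * (1 / (N * real n)) / (K / (r * N))"
        using elim(1) pos K unfolding err_def r_def N_def \<beta>_def by (intro divide_right_mono) auto
      also have "\<dots> = C / K * (1 / real n)" using pos by simp
      finally show ?case by (simp add: norm_divide)
    qed
  qed
  moreover have "\<epsilon> y \<in> O(\<lambda>n. 1 / of_nat n)" if "y \<noteq> z" for y
  proof -
    have "\<epsilon> y = (\<lambda>_. 0)" using that by (simp add: \<epsilon>_def fun_eq_iff)
    then show ?thesis by simp
  qed
  ultimately have "\<forall>y\<in>E. \<epsilon> y \<in> O(\<lambda>n. 1 / of_nat n)" by metis
  moreover have "\<forall>\<^sub>F n in sequentially. \<delta> n = (\<Sum>y\<in>E. diag_contribution d y n * (1 + \<epsilon> y n))"
    using eventually_ge_at_top[of 1]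
  proof eventually_elim
    case (elim n)
    have "cmod (diag_contribution d z n) > 0" unfolding cz using K \<rho> elim by simp
    then have "diag_contribution d y n * (1 + \<epsilon> y n) = diag_contribution d y n + (if y = z then err n else 0)" for y
      by (auto simp: \<epsilon>_def distrib_left)
    then have "(\<Sum>y\<in>E. diag_contribution d y n * (1 + \<epsilon> y n)) = (\<Sum>y\<in>E. diag_contribution d y n) + err n"
      using E(1) z by (simp add: sum.distrib)
    then show ?case by (simp add: err_def)
  qed
  ultimately show ?thesis by blast
qed

theorem theorem10:
  fixes c :: real
    and a :: "('d::finite \<Rightarrow> nat) \<Rightarrow> complex"
    and \<delta> :: "nat \<Rightarrow> complex"
    and E :: "complex set"
  assumes expansion: "has_power_series_at_origin (F_sym c :: complex ^ 'd \<Rightarrow> complex) a"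
    and diagonal: "\<And>n. \<delta> n = a (\<lambda>_. n)"
    and c_ne: "c \<noteq> (real CARD('d) - 1) ^ (CARD('d) - 1)"
    and E_eq: "E = min_modulus_roots (diag_poly CARD('d) c)"
  shows "\<exists>\<epsilon> :: complex \<Rightarrow> nat \<Rightarrow> complex.
           (\<forall>x\<in>E. \<epsilon> x \<in> O(\<lambda>n. 1 / of_nat n)) \<and>
           (\<forall>\<^sub>F n in sequentially.
              \<delta> n = (\<Sum>x\<in>E. diag_contribution CARD('d) x n * (1 + \<epsilon> x n)))"
proof -
  define d where "d = CARD('d)"
  have d: "d \<ge> 1" by (simp add: d_def Suc_leI)
  have \<delta>: "\<delta> n = (\<Sum>k\<le>n. (- of_real c) ^ k * fact (d * (n - k) + k) / (fact k * fact (n - k) ^ d))" for n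
    unfolding diagonal d_def by (rule F_sym_diagonal_coeff[OF expansion])
  note c_ne = c_ne[folded d_def] and E_eq = E_eq[folded d_def]
  \<comment> \<open>For \<open>d = 2\<close> the critical value is 1, so \<open>d = 2\<close>
    without \<open>c > 1\<close> means \<open>c < 1\<close> and belongs to the last
    alternative.\<close>
  consider "d = 1" | "d = 2" "c > 1" | "d \<ge> 2" "c < (real d - 1) ^ (d - 1) \<or> d \<ge> 3"
    using d c_ne by (cases "d = 1"; cases "d = 2"; cases "c > 1") auto
  then have "\<exists>\<rho> C. \<rho> > 0 \<and> finite E \<and> E \<noteq> {} \<and> (\<forall>x\<in>E. cmod x = \<rho> \<and> 1 - (of_nat d - 1) * x \<noteq> 0) \<and>
    (\<forall>\<^sub>F n in sequentially. cmod (\<delta> n - (\<Sum>x\<in>E. diag_contribution d x n)) \<le> C / \<rho> ^ (d * n) * (1 / (real n powr ((real d - 1) / 2) * real n)))"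
  proof cases
    case 1
    show ?thesis using c_ne E_eq \<delta> unfolding 1 by (intro diagonal_asymptotics_one[where c = c]) auto
  next
    case 2
    show ?thesis using 2(2) E_eq \<delta> unfolding 2(1) by (intro diagonal_asymptotics_two[where c = c])
  next
    case 3
    then show ?thesis by (intro diagonal_asymptotics[OF _ c_ne _ E_eq \<delta>])
  qed
  then obtain \<rho> C where *: "\<rho> > 0" "finite E" "E \<noteq> {}" "\<forall>x\<in>E. cmod x = \<rho> \<and> 1 - (of_nat d - 1) * x \<noteq> 0"
    and bound: "\<forall>\<^sub>F n in sequentially. cmod (\<delta> n - (\<Sum>x\<in>E. diag_contribution d x n)) \<le> C / \<rho> ^ (d * n) * (1 / (real n powr ((real d - 1) / 2) * real n))"
    by (elim exE conjE) (rule that; assumption)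
  show ?thesis unfolding d_def[symmetric]
    by (rule relative_error_from_absolute[OF *(2,3,1) d _ _ bound]) (use *(4) in auto)
qed

end
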